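(* Let $f:\mathbb{P}^2\to\mathbb{P}^2$ be an endomorphism of the complex projective plane of degree bigger than one. Then $f$ is completely ramified at at most nine points. No three points at which $f$ is completely ramified lie on a line, and no six such points lie on a conic. Moreover, if $f$ is completely ramified at nine points, then these nine points lie on a unique cubic curve, and this cubic has a singularity at one of these nine points.
   Context: An endomorphism of $\mathbb{P}^2$ is a morphism $f:\mathbb{P}^2\to\mathbb{P}^2$ of complex algebraic varieties. We say that $f$ is completely ramified at a point $P\in\mathbb{P}^2$ if $f^{-1}(P)$ (as a set) consists of exactly one point. *)

theory Defs
  imports "HOL-Analysis.Analysis" "HOL-Library.Poly_Mapping"
begin

text \<open>Polynomials in three variables over the complex numbers; the monomials are exponent
  vectors indexed by the three-element type \<open>3\<close>.\<close>

type_synonym poly3 = "(3 \<Rightarrow>\<^sub>0 nat) \<Rightarrow>\<^sub>0 complex"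

definition eval3 :: "poly3 \<Rightarrow> complex ^ 3 \<Rightarrow> complex" where
  "eval3 F x = (\<Sum>m\<in>Poly_Mapping.keys F.
     Poly_Mapping.lookup F m * (\<Prod>i\<in>UNIV. (x $ i) ^ Poly_Mapping.lookup m i))"

text \<open>The zero polynomial is homogeneous of every degree.\<close>

definition homogeneous3 :: "nat \<Rightarrow> poly3 \<Rightarrow> bool" where
  "homogeneous3 d F \<longleftrightarrow>
     (\<forall>m\<in>Poly_Mapping.keys F. (\<Sum>i\<in>UNIV. Poly_Mapping.lookup m i) = d)"

text \<open>For an exponent \<open>lookup m i = 0\<close> the subtraction of exponents truncates, but the coefficient
  is then zero.\<close>

definition pderiv3 :: "3 \<Rightarrow> poly3 \<Rightarrow> poly3" where
  "pderiv3 i F = (\<Sum>m\<in>Poly_Mapping.keys F.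
     Poly_Mapping.single (m - Poly_Mapping.single i 1)
       (of_nat (Poly_Mapping.lookup m i) * Poly_Mapping.lookup F m))"

lemma eval3_scale:
  assumes "homogeneous3 d F"
  shows "eval3 F (c *s x) = c ^ d * eval3 F x"
proof -
  have "Poly_Mapping.lookup F m * (\<Prod>i\<in>UNIV. ((c *s x) $ i) ^ Poly_Mapping.lookup m i) =
        c ^ d * (Poly_Mapping.lookup F m * (\<Prod>i\<in>UNIV. (x $ i) ^ Poly_Mapping.lookup m i))"
    if "m \<in> Poly_Mapping.keys F" for m
  proof -
    have "(\<Sum>i\<in>UNIV. Poly_Mapping.lookup m i) = d"
      using assms that by (auto simp: homogeneous3_def)
    then have "(\<Prod>i\<in>UNIV. c ^ Poly_Mapping.lookup m i) = c ^ d"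
      by (simp flip: power_sum)
    then show ?thesis
      by (simp add: power_mult_distrib prod.distrib)
  qed
  then show ?thesis
    unfolding eval3_def sum_distrib_left by (rule sum.cong[OF refl])
qed

definition proj_rel :: "complex ^ 3 \<Rightarrow> complex ^ 3 \<Rightarrow> bool" where
  "proj_rel x y \<longleftrightarrow> x \<noteq> 0 \<and> y \<noteq> 0 \<and> (\<exists>c. c \<noteq> 0 \<and> y = c *s x)"

lemma part_equivp_proj_rel: "part_equivp proj_rel"
proof (rule part_equivpI)
  have "proj_rel 1 1"
    unfolding proj_rel_def by (auto intro!: exI[of _ 1] simp: vec_eq_iff)
  then show "\<exists>x. proj_rel x x" by blast
  show "symp proj_rel"
  proof (rule sympI)
    fix x y assume "proj_rel x y"
    then obtain c where "x \<noteq> 0" "y \<noteq> 0" "c \<noteq> 0" "y = c *s x"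
      by (auto simp: proj_rel_def)
    then show "proj_rel y x"
      unfolding proj_rel_def by (auto intro!: exI[of _ "inverse c"])
  qed
  show "transp proj_rel"
  proof (rule transpI)
    fix x y z assume "proj_rel x y" "proj_rel y z"
    then obtain c d where "x \<noteq> 0" "z \<noteq> 0" "c \<noteq> 0" "d \<noteq> 0" "y = c *s x" "z = d *s y"
      by (auto simp: proj_rel_def)
    then show "proj_rel x z"
      unfolding proj_rel_def by (auto intro!: exI[of _ "d * c"])
  qed
qed

text \<open>The complex projective plane. For \<open>x \<noteq> 0\<close>, \<open>proj_point x\<close> is the point with homogeneous
  coordinates \<open>x\<close>; \<open>proj_point 0\<close> is meaningless and always guarded against below.\<close>

quotient_type proj_plane = "complex ^ 3" / partial: proj_rel
  morphisms rep_proj_plane proj_point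
  by (rule part_equivp_proj_rel)

lemma proj_point_eq_iff:
  assumes "x \<noteq> 0" "y \<noteq> 0"
  shows "proj_point x = proj_point y \<longleftrightarrow> (\<exists>c. c \<noteq> 0 \<and> y = c *s x)"
proof -
  have refl: "proj_rel z z" if "z \<noteq> 0" for z
    using that by (auto simp: proj_rel_def intro!: exI[of _ 1])
  show ?thesis
    using Quotient_rel[OF Quotient_proj_plane, of x y] refl[OF assms(1)] refl[OF assms(2)] assms
    by (auto simp: proj_rel_def)
qed

lemma proj_point_exhaust: obtains x where "x \<noteq> 0" "P = proj_point x"
proof -
  have "rep_proj_plane P \<noteq> 0"
    using Quotient_rep_reflp[OF Quotient_proj_plane, of P] by (simp add: proj_rel_def)
  moreover have "P = proj_point (rep_proj_plane P)"
    using Quotient_abs_rep[OF Quotient_proj_plane, of P] by (rule sym)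
  ultimately show ?thesis by (rule that)
qed

definition vanishes_at :: "poly3 \<Rightarrow> proj_plane \<Rightarrow> bool" where
  "vanishes_at F P \<longleftrightarrow> (\<forall>x. x \<noteq> 0 \<and> proj_point x = P \<longrightarrow> eval3 F x = 0)"

lemma vanishes_at_proj_point:
  assumes "homogeneous3 d F" "x \<noteq> 0"
  shows "vanishes_at F (proj_point x) \<longleftrightarrow> eval3 F x = 0"
proof
  assume "vanishes_at F (proj_point x)"
  with assms(2) show "eval3 F x = 0"
    unfolding vanishes_at_def by blast
next
  assume "eval3 F x = 0"
  then show "vanishes_at F (proj_point x)"
    unfolding vanishes_at_def
    using eval3_scale[OF assms(1)] proj_point_eq_iff[OF assms(2)]
    by (metis mult_zero_right)
qed

definition zariski_open :: "proj_plane set \<Rightarrow> bool" where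
  "zariski_open U \<longleftrightarrow>
     (\<exists>A. (\<forall>G\<in>A. \<exists>k. homogeneous3 k G) \<and> U = - {P. \<forall>G\<in>A. vanishes_at G P})"

text \<open>\<open>f\<close> is given on \<open>U\<close> by three forms of degree \<open>d\<close> without a common zero on \<open>U\<close>.\<close>

definition given_by_forms ::
    "nat \<Rightarrow> (3 \<Rightarrow> poly3) \<Rightarrow> proj_plane set \<Rightarrow> (proj_plane \<Rightarrow> proj_plane) \<Rightarrow> bool" where
  "given_by_forms d F U f \<longleftrightarrow>
     (\<forall>i. homogeneous3 d (F i)) \<and>
     (\<forall>x. x \<noteq> 0 \<and> proj_point x \<in> U \<longrightarrow>
        (\<chi> i. eval3 (F i) x) \<noteq> 0 \<and> f (proj_point x) = proj_point (\<chi> i. eval3 (F i) x))"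

text \<open>Morphisms of varieties are regular maps: they are given by forms Zariski-locally.\<close>

definition endomorphism :: "(proj_plane \<Rightarrow> proj_plane) \<Rightarrow> bool" where
  "endomorphism f \<longleftrightarrow> (\<forall>P. \<exists>U d F. zariski_open U \<and> P \<in> U \<and> given_by_forms d F U f)"

text \<open>The degree \<open>d\<close> of an endomorphism, in the sense that \<open>f\<^sup>* O(1) = O(d)\<close>: the common degree of
  forms without common zeros defining it on the whole plane. The degree of \<open>f\<close> as a finite map is
  \<open>d\<^sup>2\<close>, so that either degree is bigger than one if and only if the other one is.\<close>

definition endo_degree :: "(proj_plane \<Rightarrow> proj_plane) \<Rightarrow> nat" where
  "endo_degree f = (THE d. \<exists>F. given_by_forms d F UNIV f)"

definition completely_ramified :: "(proj_plane \<Rightarrow> proj_plane) \<Rightarrow> proj_plane \<Rightarrow> bool" where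
  "completely_ramified f P \<longleftrightarrow> (\<exists>Q. f -` {P} = {Q})"

text \<open>Plane curves are effective divisors: nonzero forms up to nonzero scalars. They may be
  reducible or non-reduced.\<close>

definition plane_curves :: "nat \<Rightarrow> poly3 set set" where
  "plane_curves k = {C. \<exists>F. F \<noteq> 0 \<and> homogeneous3 k F \<and>
     C = {Poly_Mapping.single 0 c * F | c. c \<noteq> 0}}"

definition curve_points :: "poly3 set \<Rightarrow> proj_plane set" where
  "curve_points C = {P. \<forall>F\<in>C. vanishes_at F P}"

definition singular_at :: "poly3 set \<Rightarrow> proj_plane \<Rightarrow> bool" where
  "singular_at C P \<longleftrightarrow>
     P \<in> curve_points C \<and> (\<forall>F\<in>C. \<forall>i. vanishes_at (pderiv3 i F) P)"

end

theory Submission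
  imports Defs
    "HOL-Computational_Algebra.Polynomial_Factorial"
    "HOL-Computational_Algebra.Field_as_Ring"
    "HOL-Computational_Algebra.Fundamental_Theorem_Algebra"
    "Jordan_Normal_Form.Char_Poly"
begin

text \<open>
  In fact there are at most three completely ramified points, and three of them are never
  collinear; the remaining claims are then vacuous. Let \<open>F : \<complex>\<^sup>3 \<rightarrow> \<complex>\<^sup>3\<close> be a lift of \<open>f\<close> by forms of degree
  \<open>d \<ge> 2\<close>, and let \<open>q\<^sub>i\<close> represent the unique point over the completely ramified point \<open>[F q\<^sub>i]\<close>. For a
  form \<open>g\<close> of degree \<open>d\<close>, the trace of \<open>g\<close> along \<open>F\<close> is a linear function on \<open>\<complex>\<^sup>3\<close> whose value at \<open>F q\<^sub>i\<close> is
  a fixed multiple of \<open>g q\<^sub>i\<close>. Hence every relation \<open>\<Sum>a\<^sub>i F q\<^sub>i = 0\<close> implies \<open>\<Sum>a\<^sub>i g q\<^sub>i = 0\<close> for all forms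
  \<open>g\<close> of degree \<open>d\<close>. But forms of degree \<open>d\<close> separate three points, and four points if \<open>d \<ge> 3\<close>; so three
  points are never collinear and a fourth one is impossible. If \<open>d = 2\<close>, four points \<open>[q\<^sub>i]\<close> would have
  to be collinear. Then \<open>F = (s\<^sup>2 + ma, st + mb, t\<^sup>2 + mc)\<close> in suitable coordinates, where \<open>m = 0\<close> is the
  line through them, and the absence of further points in the four fibres forces \<open>F\<close> to have a
  nontrivial zero.

  The trace is only needed over a line or a conic through the points in question. There it is
  the sum of the roots of the minimal polynomial of \<open>g\<close> over \<open>\<complex>[\<tau>]\<close>, where \<open>\<tau>\<close> is the parameter of the
  curve.
\<close>

text \<open>The trace is linear because \<open>g\<close> has the same degree \<open>d\<close> as the
  coordinates of \<open>F\<close>: compactness bounds \<open>g\<close> by a multiple of the norm of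
  \<open>F\<close>, which becomes a degree bound for the trace along a curve. Along a curve of
  degree k the trace is a polynomial of degree at most k, so its values at k + 2 parameters satisfy
  one interpolation relation. Scaling a point by a d-th root multiplies its image by any nonzero
  constant, so every relation between three (k = 1) or four (k = 2) images with nonzero coefficients
  takes this form. The number of roots depends on \<open>g\<close>, which is harmless since each
  relation involves a single \<open>g\<close>.

  The main obstacle is that every root must be a value of \<open>g\<close> on the fibre, also over
  special \<tau>. This needs integrality over the three forms and surjectivity; both rest on
  \<open>F\<close> having only the trivial zero, through the Nullstellensatz and a dimension count.
  A separate task is that a morphism is given by forms only locally: a global triple arises by
  dividing a local one by its gcd.\<close>

no_notation vec_index (infixl "$" 100)

section \<open>Polynomial functions\<close>

text \<open>Polynomials are treated as functions, so that identities are checked pointwise. Formal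
  polynomials in three variables return only where gcds or the degree of the endomorphism are at
  stake.\<close>

inductive pf :: "(complex^3 \<Rightarrow> complex) \<Rightarrow> bool" where
  const: "pf (\<lambda>x. c)"
| coord: "pf (\<lambda>x. x $ i)"
| add: "pf u \<Longrightarrow> pf v \<Longrightarrow> pf (\<lambda>x. u x + v x)"
| mult: "pf u \<Longrightarrow> pf v \<Longrightarrow> pf (\<lambda>x. u x * v x)"

lemma pf_uminus: "pf u \<Longrightarrow> pf (\<lambda>x. - u x)"
  using pf.mult[OF pf.const[of "-1"], of u] by simp

lemma pf_diff: "pf u \<Longrightarrow> pf v \<Longrightarrow> pf (\<lambda>x. u x - v x)"
  using pf.add[OF _ pf_uminus, of u v] by simp

lemma pf_power: "pf u \<Longrightarrow> pf (\<lambda>x. u x ^ n)"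
  by (induction n) (auto intro: pf.intros)

lemma pf_sum: "(\<And>i. i \<in> I \<Longrightarrow> pf (u i)) \<Longrightarrow> pf (\<lambda>x. \<Sum>i\<in>I. u i x)"
  by (induction I rule: infinite_finite_induct) (auto intro: pf.intros)

lemma pf_prod: "(\<And>i. i \<in> I \<Longrightarrow> pf (u i)) \<Longrightarrow> pf (\<lambda>x. \<Prod>i\<in>I. u i x)"
  by (induction I rule: infinite_finite_induct) (auto intro: pf.intros)

lemmas pf_intros = pf.intros pf_uminus pf_diff pf_power pf_sum pf_prod

lemma continuous_on_pf: "pf u \<Longrightarrow> continuous_on S u"
  by (induction rule: pf.induct) (auto intro!: continuous_intros)

lemma pf_along_polynomial_curve:
  assumes "pf u" "\<And>i. \<exists>p. \<forall>t. \<gamma> t $ i = poly p t"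
  shows "\<exists>p. \<forall>t. u (\<gamma> t) = poly p t"
  using assms(1)
proof induction
  case (const c)
  show ?case by (rule exI[of _ "[:c:]"]) simp
next
  case (coord i)
  show ?case by (rule assms(2))
next
  case (add u v)
  then obtain p q where "\<forall>t. u (\<gamma> t) = poly p t" "\<forall>t. v (\<gamma> t) = poly q t" by blast
  then show ?case by (intro exI[of _ "p + q"]) simp
next
  case (mult u v)
  then obtain p q where "\<forall>t. u (\<gamma> t) = poly p t" "\<forall>t. v (\<gamma> t) = poly q t" by blast
  then show ?case by (intro exI[of _ "p * q"]) simp
qed

definition homog :: "nat \<Rightarrow> (complex^3 \<Rightarrow> complex) \<Rightarrow> bool" where
  "homog d u \<longleftrightarrow> (\<forall>c x. u (c *s x) = c ^ d * u x)"

lemma homog_coord: "homog 1 (\<lambda>x. x $ i)"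
  by (simp add: homog_def)

lemma homog_diff: "homog d u \<Longrightarrow> homog d v \<Longrightarrow> homog d (\<lambda>x. u x - v x)"
  by (simp add: homog_def algebra_simps)

lemma homog_scale: "homog d u \<Longrightarrow> homog d (\<lambda>x. c * u x)"
  by (simp add: homog_def algebra_simps)

lemma homog_mult: "homog d u \<Longrightarrow> homog e v \<Longrightarrow> homog (d + e) (\<lambda>x. u x * v x)"
  by (simp add: homog_def power_add algebra_simps)

lemma homog_power: "homog d u \<Longrightarrow> homog (d * n) (\<lambda>x. u x ^ n)"
  by (simp add: homog_def power_mult power_mult_distrib)

section \<open>Spans of monomials\<close>

inductive_set cspan :: "('a \<Rightarrow> complex) set \<Rightarrow> ('a \<Rightarrow> complex) set" for B where
  zero: "(\<lambda>x. 0) \<in> cspan B"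
| step: "u \<in> cspan B \<Longrightarrow> b \<in> B \<Longrightarrow> (\<lambda>x. u x + c * b x) \<in> cspan B"

lemma cspan_base: "b \<in> B \<Longrightarrow> b \<in> cspan B"
  using cspan.step[OF cspan.zero, of b B 1] by simp

lemma cspan_add:
  assumes "u \<in> cspan B" "v \<in> cspan B"
  shows "(\<lambda>x. u x + v x) \<in> cspan B"
  using assms(2)
proof induction
  case zero
  then show ?case using assms(1) by simp
next
  case (step v b c)
  then show ?case using cspan.step[of "\<lambda>x. u x + v x" B b c] by (simp add: add.assoc)
qed

lemma cspan_scale: "u \<in> cspan B \<Longrightarrow> (\<lambda>x. a * u x) \<in> cspan B"
proof (induction u rule: cspan.induct)
  case zero
  then show ?case by (simp add: cspan.zero)
next
  case (step v b c)
  then show ?case using cspan.step[of "\<lambda>x. a * v x" B b "a * c"] by (simp add: algebra_simps)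
qed

lemma cspan_sum: "(\<And>i. i \<in> I \<Longrightarrow> u i \<in> cspan B) \<Longrightarrow> (\<lambda>x. \<Sum>i\<in>I. u i x) \<in> cspan B"
  by (induction I rule: infinite_finite_induct) (auto intro: cspan.zero cspan_add)

lemma cspan_trans:
  assumes "u \<in> cspan B" "\<And>b. b \<in> B \<Longrightarrow> b \<in> cspan C"
  shows "u \<in> cspan C"
  using assms(1)
proof induction
  case zero
  then show ?case by (rule cspan.zero)
next
  case (step v b c)
  then show ?case using cspan_add[OF step.IH cspan_scale[OF assms(2)]] by blast
qed

lemma cspan_mult:
  assumes "u \<in> cspan B" "v \<in> cspan C" "\<And>b c. b \<in> B \<Longrightarrow> c \<in> C \<Longrightarrow> (\<lambda>x. b x * c x) \<in> cspan D"
  shows "(\<lambda>x. u x * v x) \<in> cspan D"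
  using assms(1)
proof induction
  case zero
  then show ?case by (simp add: cspan.zero)
next
  case (step u b k)
  have *: "(\<lambda>x. b x * v x) \<in> cspan D" using assms(2)
  proof induction
    case zero
    then show ?case by (simp add: cspan.zero)
  next
    case (step v c l)
    then show ?case
      using cspan_add[OF step.IH cspan_scale[OF assms(3)[OF \<open>b \<in> B\<close> \<open>c \<in> C\<close>], of l]]
      by (simp add: algebra_simps)
  qed
  then show ?case using cspan_add[OF step.IH cspan_scale[OF *, of k]]
    by (simp add: algebra_simps)
qed

lemma cspan_finite:
  assumes "u \<in> cspan B" "finite B"
  shows "\<exists>c. \<forall>x. u x = (\<Sum>b\<in>B. c b * b x)"
  using assms(1)
proof induction
  case zero
  show ?case by (rule exI[of _ "\<lambda>_. 0"]) simp
next
  case (step u b k)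
  then obtain c where c: "\<forall>x. u x = (\<Sum>b\<in>B. c b * b x)" by blast
  have "u x + k * b x = (\<Sum>b'\<in>B. (c b' + (if b' = b then k else 0)) * b' x)" for x
    using c step.hyps assms(2)
    by (simp add: algebra_simps sum.distrib if_distrib[of "\<lambda>t. _ * t"] cong: if_cong)
  then show ?case by (intro exI[of _ "\<lambda>b'. c b' + (if b' = b then k else 0)"]) blast
qed

definition mon :: "nat \<Rightarrow> nat \<Rightarrow> nat \<Rightarrow> complex^3 \<Rightarrow> complex" where
  "mon i j k x = (x $ 1) ^ i * (x $ 2) ^ j * (x $ 3) ^ k"

lemma mon_mult: "mon i j k x * mon i' j' k' x = mon (i + i') (j + j') (k + k') x"
  by (simp add: mon_def power_add)

lemma mon_scale: "mon i j k (c *s x) = c ^ (i + j + k) * mon i j k x"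
  by (simp add: mon_def power_add power_mult_distrib)

lemma pf_mon: "pf (mon i j k)"
  unfolding mon_def[abs_def] by (intro pf_intros)

definition deg_le :: "nat \<Rightarrow> (complex^3 \<Rightarrow> complex) set" where
  "deg_le n = cspan {mon i j k |i j k. i + j + k \<le> n}"

lemma deg_le_mono: "u \<in> deg_le m \<Longrightarrow> m \<le> n \<Longrightarrow> u \<in> deg_le n"
  unfolding deg_le_def by (erule cspan_trans) (force intro: cspan_base)

lemma deg_le_mult: "u \<in> deg_le m \<Longrightarrow> v \<in> deg_le n \<Longrightarrow> (\<lambda>x. u x * v x) \<in> deg_le (m + n)"
  unfolding deg_le_def
proof (erule (1) cspan_mult)
  fix b c :: "complex^3 \<Rightarrow> complex"
  assume "b \<in> {mon i j k |i j k. i + j + k \<le> m}" "c \<in> {mon i j k |i j k. i + j + k \<le> n}"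
  then obtain i j k i' j' k' where *: "b = mon i j k" "i + j + k \<le> m" "c = mon i' j' k'" "i' + j' + k' \<le> n"
    by blast
  have "(\<lambda>x. b x * c x) = mon (i + i') (j + j') (k + k')"
    using * by (simp add: mon_mult fun_eq_iff)
  then show "(\<lambda>x. b x * c x) \<in> cspan {mon i j k |i j k. i + j + k \<le> m + n}"
    using * by (intro cspan_base) (force)
qed

lemma mon_in_deg_le: "i + j + k \<le> n \<Longrightarrow> mon i j k \<in> deg_le n"
  unfolding deg_le_def by (rule cspan_base) blast

lemma finite_mons: "finite {mon i j k |i j k. i + j + k \<le> n}"
proof (rule finite_subset)
  show "{mon i j k |i j k. i + j + k \<le> n} \<subseteq> (\<lambda>(i, j, k). mon i j k) ` ({..n} \<times> {..n} \<times> {..n})"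
    by (auto simp: image_iff Bex_def) (metis le_add1 le_add2 le_trans add.commute)
qed auto

lemma pf_in_deg_le: "pf u \<Longrightarrow> \<exists>n. u \<in> deg_le n"
proof (induction rule: pf.induct)
  case (const c)
  have "mon 0 0 0 \<in> deg_le 0" by (rule mon_in_deg_le) simp
  then have "(\<lambda>x. c * mon 0 0 0 x) \<in> deg_le 0" unfolding deg_le_def by (rule cspan_scale)
  then show ?case by (auto simp: mon_def)
next
  case (coord i)
  have "(\<lambda>x::complex^3. x $ 1) = mon 1 0 0" "(\<lambda>x::complex^3. x $ 2) = mon 0 1 0"
    "(\<lambda>x::complex^3. x $ 3) = mon 0 0 1" by (simp_all add: mon_def fun_eq_iff)
  then show ?case using mon_in_deg_le[of 1 0 0 1] mon_in_deg_le[of 0 1 0 1] mon_in_deg_le[of 0 0 1 1]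
    by (cases i rule: exhaust_3[THEN disjE]) (auto intro!: exI[of _ 1])
next
  case (add u v)
  then obtain m n where "u \<in> deg_le m" "v \<in> deg_le n" by blast
  then have "u \<in> deg_le (max m n)" "v \<in> deg_le (max m n)" by (auto intro: deg_le_mono)
  then show ?case unfolding deg_le_def using cspan_add by blast
next
  case (mult u v)
  then show ?case using deg_le_mult by blast
qed

section \<open>A homogeneous linear system with more unknowns than equations\<close>

text \<open>Gaussian elimination by induction on the equations: an equation \<open>a\<close> with
  nonzero coefficient at the unknown \<open>p\<close> is solved for \<open>p\<close> and substituted
  into the others.\<close>

lemma nontrivial_kernel:
  fixes M :: "'b \<Rightarrow> 'j \<Rightarrow> complex"
  assumes "finite B" "finite J" "card B < card J"
  shows "\<exists>\<beta>. (\<exists>j\<in>J. \<beta> j \<noteq> 0) \<and> (\<forall>b\<in>B. (\<Sum>j\<in>J. \<beta> j * M b j) = 0)"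
  using assms
proof (induction B arbitrary: J M rule: finite_induct)
  case empty
  then have "J \<noteq> {}" by auto
  then show ?case by (intro exI[of _ "\<lambda>_. 1"]) auto
next
  case (insert a B)
  show ?case
  proof (cases "\<forall>j\<in>J. M a j = 0")
    case True
    have "card B < card J" using insert by simp
    from insert.IH[OF insert.prems(1) this, of M] show ?thesis using True by auto
  next
    case False
    then obtain p where p: "p \<in> J" "M a p \<noteq> 0" by blast
    let ?N = "\<lambda>b j. M b j - M a j / M a p * M b p"
    have "card B < card (J - {p})" using insert p by (simp add: card_Diff_singleton)
    from insert.IH[OF _ this, of ?N] insert.prems(1) obtain \<beta> where
      \<beta>: "\<exists>j\<in>J - {p}. \<beta> j \<noteq> 0" "\<forall>b\<in>B. (\<Sum>j\<in>J - {p}. \<beta> j * ?N b j) = 0" by auto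
    define s where "s = (\<Sum>j\<in>J - {p}. \<beta> j * M a j)"
    define \<gamma> where "\<gamma> = \<beta>(p := - s / M a p)"
    have sum: "(\<Sum>j\<in>J. \<gamma> j * M b j) = (\<Sum>j\<in>J - {p}. \<beta> j * M b j) - s / M a p * M b p" for b
    proof -
      have "(\<Sum>j\<in>J. \<gamma> j * M b j) = \<gamma> p * M b p + (\<Sum>j\<in>J - {p}. \<gamma> j * M b j)"
        using p insert.prems(1) by (simp add: sum.remove)
      also have "(\<Sum>j\<in>J - {p}. \<gamma> j * M b j) = (\<Sum>j\<in>J - {p}. \<beta> j * M b j)"
        by (rule sum.cong) (auto simp: \<gamma>_def)
      finally show ?thesis by (simp add: \<gamma>_def)
    qed
    have "(\<Sum>j\<in>J. \<gamma> j * M b j) = 0" if "b \<in> B" for b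
    proof -
      have "0 = (\<Sum>j\<in>J - {p}. \<beta> j * ?N b j)" using \<beta>(2) that by simp
      also have "\<dots> = (\<Sum>j\<in>J - {p}. \<beta> j * M b j - \<beta> j * M a j * (M b p / M a p))"
        by (rule sum.cong) (auto simp: algebra_simps)
      also have "\<dots> = (\<Sum>j\<in>J - {p}. \<beta> j * M b j) - s * (M b p / M a p)"
        by (simp only: sum_subtractf s_def sum_distrib_right)
      finally show ?thesis using sum[of b] by simp
    qed
    moreover have "(\<Sum>j\<in>J. \<gamma> j * M a j) = 0"
      using sum[of a] p by (simp add: s_def)
    moreover have "\<exists>j\<in>J. \<gamma> j \<noteq> 0" using \<beta>(1) by (auto simp: \<gamma>_def)
    ultimately show ?thesis by auto
  qed
qed

text \<open>Serves two dimension counts: for the inverses of x_i - c in the Nullstellensatz, and for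
  the monomials behind surjectivity.\<close>

lemma cspan_dependent:
  assumes "finite B" "finite J" "card B < card J" "\<And>j. j \<in> J \<Longrightarrow> u j \<in> cspan B"
  shows "\<exists>\<beta>. (\<exists>j\<in>J. \<beta> j \<noteq> 0) \<and> (\<forall>x. (\<Sum>j\<in>J. \<beta> j * u j x) = 0)"
proof -
  have "\<forall>j\<in>J. \<exists>c. \<forall>x. u j x = (\<Sum>b\<in>B. c b * b x)"
    using cspan_finite[OF assms(4,1)] by blast
  then obtain c where c: "\<And>j x. j \<in> J \<Longrightarrow> u j x = (\<Sum>b\<in>B. c j b * b x)" by metis
  obtain \<beta> where \<beta>: "\<exists>j\<in>J. \<beta> j \<noteq> 0" "\<forall>b\<in>B. (\<Sum>j\<in>J. \<beta> j * c j b) = 0"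
    using nontrivial_kernel[OF assms(1-3), of "\<lambda>b j. c j b"] by blast
  have "(\<Sum>j\<in>J. \<beta> j * u j x) = 0" for x
  proof -
    have "(\<Sum>j\<in>J. \<beta> j * u j x) = (\<Sum>j\<in>J. \<Sum>b\<in>B. \<beta> j * c j b * b x)"
      by (rule sum.cong) (simp_all add: c sum_distrib_left mult.assoc)
    also have "\<dots> = (\<Sum>b\<in>B. (\<Sum>j\<in>J. \<beta> j * c j b) * b x)"
      by (subst sum.swap) (simp add: sum_distrib_right)
    finally show ?thesis using \<beta>(2) by simp
  qed
  with \<beta>(1) show ?thesis by blast
qed

section \<open>The weak Nullstellensatz\<close>

definition pf_ideal :: "(complex^3 \<Rightarrow> complex) set \<Rightarrow> bool" where
  "pf_ideal I \<longleftrightarrow> I \<subseteq> Collect pf \<and> (\<lambda>x. 0) \<in> I \<and>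
     (\<forall>u\<in>I. \<forall>v\<in>I. (\<lambda>x. u x + v x) \<in> I) \<and> (\<forall>u\<in>I. \<forall>v. pf v \<longrightarrow> (\<lambda>x. v x * u x) \<in> I)"

lemma pf_idealD:
  assumes "pf_ideal I"
  shows "u \<in> I \<Longrightarrow> pf u" "(\<lambda>x. 0) \<in> I" "u \<in> I \<Longrightarrow> v \<in> I \<Longrightarrow> (\<lambda>x. u x + v x) \<in> I"
    "u \<in> I \<Longrightarrow> pf w \<Longrightarrow> (\<lambda>x. w x * u x) \<in> I" "u \<in> I \<Longrightarrow> pf w \<Longrightarrow> (\<lambda>x. u x * w x) \<in> I"
  using assms unfolding pf_ideal_def by (auto simp: mult.commute)

lemma fun_mem_cong: "u \<in> A \<Longrightarrow> (\<And>x. u x = v x) \<Longrightarrow> v \<in> A"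
  by (metis ext)

lemma pf_ideal_sum:
  assumes "pf_ideal I" "\<And>j. j \<in> J \<Longrightarrow> u j \<in> I"
  shows "(\<lambda>x. \<Sum>j\<in>J. u j x) \<in> I"
  using assms(2)
  by (induction J rule: infinite_finite_induct) (auto intro: pf_idealD[OF assms(1)])

lemma pf_ideal_diff:
  assumes "pf_ideal I" "u \<in> I" "v \<in> I"
  shows "(\<lambda>x. u x - v x) \<in> I"
  using pf_idealD(3)[OF assms(1,2) pf_idealD(4)[OF assms(1,3) pf.const[of "-1"]]] by simp

lemma pf_ideal_adjoin:
  assumes I: "pf_ideal I" and w: "pf w"
  shows "pf_ideal {\<lambda>x. u x + v x * w x |u v. u \<in> I \<and> pf v}" (is "pf_ideal ?J")
  unfolding pf_ideal_def
proof (intro conjI ballI allI impI)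
  show "?J \<subseteq> Collect pf" using w pf_idealD(1)[OF I] by (auto intro: pf.intros)
  show "(\<lambda>x. 0) \<in> ?J"
    using pf_idealD(2)[OF I] pf.const[of 0] by (force intro!: exI[of _ "\<lambda>x. 0"])
next
  fix a b assume "a \<in> ?J" "b \<in> ?J"
  then obtain u v u' v' where *: "a = (\<lambda>x. u x + v x * w x)" "b = (\<lambda>x. u' x + v' x * w x)"
    "u \<in> I" "u' \<in> I" "pf v" "pf v'" by blast
  then show "(\<lambda>x. a x + b x) \<in> ?J"
    by (intro CollectI exI[of _ "\<lambda>x. u x + u' x"] exI[of _ "\<lambda>x. v x + v' x"])
       (auto simp: algebra_simps intro: pf_idealD(3)[OF I] pf.add)
next
  fix a b assume "a \<in> ?J" and b: "pf b"
  then obtain u v where *: "a = (\<lambda>x. u x + v x * w x)" "u \<in> I" "pf v" by blast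
  then show "(\<lambda>x. b x * a x) \<in> ?J" using b
    by (intro CollectI exI[of _ "\<lambda>x. b x * u x"] exI[of _ "\<lambda>x. b x * v x"])
       (auto simp: algebra_simps intro: pf_idealD(4)[OF I] pf.mult)
qed

lemma maximal_pf_ideal_exists:
  assumes "pf_ideal I" "(\<lambda>x. 1) \<notin> I"
  obtains M where "I \<subseteq> M" "pf_ideal M" "(\<lambda>x. 1) \<notin> M"
    "\<And>N. pf_ideal N \<Longrightarrow> M \<subseteq> N \<Longrightarrow> (\<lambda>x. 1) \<notin> N \<Longrightarrow> N = M"
proof -
  let ?A = "{N. pf_ideal N \<and> I \<subseteq> N \<and> (\<lambda>x. 1) \<notin> N}"
  have "\<exists>M\<in>?A. \<forall>X\<in>?A. M \<subseteq> X \<longrightarrow> X = M"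
  proof (rule subset_Zorn_nonempty)
    show "?A \<noteq> {}" using assms by blast
    fix \<C> assume ne: "\<C> \<noteq> {}" and ch: "subset.chain ?A \<C>"
    have ideal: "pf_ideal N" if "N \<in> \<C>" for N
      using that ch unfolding subset.chain_def by blast
    have "pf_ideal (\<Union>\<C>)" unfolding pf_ideal_def
    proof (intro conjI ballI allI impI)
      show "\<Union>\<C> \<subseteq> Collect pf" using pf_idealD(1)[OF ideal] by blast
      show "(\<lambda>x. 0) \<in> \<Union>\<C>" using ne pf_idealD(2)[OF ideal] by blast
      fix u assume "u \<in> \<Union>\<C>"
      then obtain N where N: "N \<in> \<C>" "u \<in> N" by blast
      show "(\<lambda>x. v x * u x) \<in> \<Union>\<C>" if "pf v" for v
        using pf_idealD(4)[OF ideal N(2) that] N(1) by blast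
      fix v assume "v \<in> \<Union>\<C>"
      then obtain N' where N': "N' \<in> \<C>" "v \<in> N'" by blast
      have "N \<subseteq> N' \<or> N' \<subseteq> N" using ch N N' unfolding subset.chain_def by blast
      then show "(\<lambda>x. u x + v x) \<in> \<Union>\<C>"
        using N N' pf_idealD(3)[OF ideal] by blast
    qed
    then show "\<Union>\<C> \<in> ?A" using ne ch unfolding subset.chain_def by blast
  qed
  then obtain M where "M \<in> ?A" "\<forall>X\<in>?A. M \<subseteq> X \<longrightarrow> X = M" by blast
  then show ?thesis by (intro that[of M]) auto
qed

section \<open>Polynomials modulo a maximal ideal\<close>

context
  fixes M :: "(complex^3 \<Rightarrow> complex) set"
  assumes M: "pf_ideal M" and M1: "(\<lambda>x. 1) \<notin> M"
    and max: "\<And>N. pf_ideal N \<Longrightarrow> M \<subseteq> N \<Longrightarrow> (\<lambda>x. 1) \<notin> N \<Longrightarrow> N = M"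
begin

lemma maximal_inverse:
  assumes "pf w" "w \<notin> M"
  shows "\<exists>v. pf v \<and> (\<lambda>x. 1 - v x * w x) \<in> M"
proof -
  let ?J = "{\<lambda>x. u x + v x * w x |u v. u \<in> M \<and> pf v}"
  have "M \<subseteq> ?J"
  proof
    fix u assume "u \<in> M"
    then show "u \<in> ?J" using pf.const[of 0]
      by (intro CollectI exI[of _ u] exI[of _ "\<lambda>x. 0"]) simp
  qed
  moreover have "w \<in> ?J" using pf_idealD(2)[OF M] pf.const[of 1]
    by (intro CollectI exI[of _ "\<lambda>x. 0"] exI[of _ "\<lambda>x. 1"]) simp
  ultimately have "(\<lambda>x. 1) \<in> ?J" using max[OF pf_ideal_adjoin[OF M assms(1)]] assms(2) by blast
  then obtain u v where *: "(\<lambda>x. 1) = (\<lambda>x. u x + v x * w x)" "u \<in> M" "pf v" by blast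
  have "(\<lambda>x. 1 - v x * w x) \<in> M"
    by (rule fun_mem_cong[OF *(2)]) (use fun_cong[OF *(1)] in \<open>simp add: algebra_simps\<close>)
  with * show ?thesis by blast
qed

lemma maximal_prime:
  assumes "pf u" "pf v" "(\<lambda>x. u x * v x) \<in> M"
  shows "u \<in> M \<or> v \<in> M"
proof (rule disjCI)
  assume "v \<notin> M"
  then obtain w where w: "pf w" "(\<lambda>x. 1 - w x * v x) \<in> M" using maximal_inverse assms(2) by blast
  have "(\<lambda>x. u x * (1 - w x * v x) + w x * (u x * v x)) \<in> M"
    by (intro pf_idealD(3)[OF M] pf_idealD(4)[OF M] w assms)
  then show "u \<in> M" by (rule fun_mem_cong) (simp add: algebra_simps)
qed

lemma maximal_const:
  assumes "(\<lambda>x. c) \<in> M"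
  shows "c = 0"
proof (rule ccontr)
  assume "c \<noteq> 0"
  then show False using pf_idealD(4)[OF M assms pf.const[of "1 / c"]] M1 by simp
qed

text \<open>The fundamental theorem of algebra splits off one linear factor of \<open>Q\<close> at a
  time. As \<open>M\<close> is prime, it contains either that factor or the cofactor, to which the
  induction applies.\<close>

lemma maximal_root:
  assumes "Q \<noteq> 0" "(\<lambda>x. poly Q (x $ i)) \<in> M"
  shows "\<exists>c. (\<lambda>x. x $ i - c) \<in> M"
  using assms
proof (induction "degree Q" arbitrary: Q)
  case 0
  then obtain a where "Q = [:a:]" by (metis degree_eq_zeroE)
  with 0 show ?case using maximal_const[of a] by auto
next
  case (Suc n)
  then have "\<not> constant (poly Q)" by (simp add: constant_degree)
  then obtain z where "poly Q z = 0" using fundamental_theorem_of_algebra by blast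
  then obtain Q' where Q': "Q = [:- z, 1:] * Q'" by (metis dvdE poly_eq_0_iff_dvd)
  have "Q' \<noteq> 0" using Suc Q' by auto
  then have deg: "n = degree Q'" using Suc.hyps(2) Q' by (simp add: degree_mult_eq del: mult_pCons_left)
  have "pf (\<lambda>x. poly Q' (x $ i))"
  proof (induction Q')
    case 0 show ?case by (simp add: pf.const)
  next
    case (pCons a p)
    then show ?case using pf.add[OF pf.const[of a] pf.mult[OF pf.coord[of i] pCons.IH]] by simp
  qed
  moreover have "pf (\<lambda>x. x $ i - z)" by (intro pf_intros)
  moreover have "(\<lambda>x. (x $ i - z) * poly Q' (x $ i)) \<in> M"
    by (rule fun_mem_cong[OF Suc.prems(2)]) (simp add: Q' algebra_simps)
  ultimately show ?case using Suc.hyps(1)[OF deg \<open>Q' \<noteq> 0\<close>] maximal_prime by blast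
qed

text \<open>If no \<open>x\<^sub>i - c\<close> lay in \<open>M\<close>, these uncountably many elements would all be invertible modulo
  \<open>M\<close>, while polynomials form a space of countable dimension; clearing denominators in a linear
  relation between the inverses gives a polynomial in \<open>x\<^sub>i\<close> alone that lies in \<open>M\<close>.\<close>

lemma maximal_coordinate: "\<exists>c. (\<lambda>x. x $ i - c) \<in> M"
proof (rule ccontr)
  assume neg: "\<nexists>c. (\<lambda>x. x $ i - c) \<in> M"
  have "\<forall>c. \<exists>v. pf v \<and> (\<lambda>x. 1 - v x * (x $ i - c)) \<in> M"
    using neg by (intro allI maximal_inverse pf_intros) blast
  then obtain v where v: "\<And>c. pf (v c)" "\<And>c. (\<lambda>x. 1 - v c x * (x $ i - c)) \<in> M" by metis
  \<comment> \<open>There are uncountably many \<open>c\<close> but only countably many degree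
    bounds, so infinitely many of the inverses share one bound \<open>n\<close>.\<close>
  have "(UNIV :: complex set) = (\<Union>n. {c. v c \<in> deg_le n})" using pf_in_deg_le[OF v(1)] by auto
  then have "uncountable (\<Union>n. {c. v c \<in> deg_le n})" using uncountable_UNIV_complex by simp
  then obtain n where "uncountable {c. v c \<in> deg_le n}"
    using countable_UN[of UNIV "\<lambda>n. {c. v c \<in> deg_le n}"] by blast
  then have n: "infinite {c. v c \<in> deg_le n}" using countable_finite by blast
  let ?B = "{mon i j k |i j k. i + j + k \<le> n}"
  obtain J where J: "J \<subseteq> {c. v c \<in> deg_le n}" "finite J" "card J = Suc (card ?B)"
    using infinite_arbitrarily_large[OF n] by blast
  obtain \<beta> where \<beta>: "\<exists>j\<in>J. \<beta> j \<noteq> 0" "\<And>x. (\<Sum>j\<in>J. \<beta> j * v j x) = 0"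
    using cspan_dependent[OF finite_mons J(2), of n v] J unfolding deg_le_def by auto
  define Q where "Q = (\<Sum>j\<in>J. [:\<beta> j:] * (\<Prod>l\<in>J - {j}. [:- l, 1:]))"
  have Qval: "poly Q z = (\<Sum>j\<in>J. \<beta> j * (\<Prod>l\<in>J - {j}. z - l))" for z
    by (simp add: Q_def poly_sum poly_prod algebra_simps)
  obtain j0 where j0: "j0 \<in> J" "\<beta> j0 \<noteq> 0" using \<beta>(1) by blast
  \<comment> \<open>Every summand with j \<noteq> j0 contains the factor for l = j0, which vanishes
    at \<open>j0\<close>. So only one summand survives, and it is nonzero.\<close>
  have "poly Q j0 = (\<Sum>j\<in>J. if j = j0 then \<beta> j0 * (\<Prod>l\<in>J - {j0}. j0 - l) else 0)"
    unfolding Qval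
  proof (rule sum.cong[OF refl])
    fix j assume "j \<in> J"
    show "\<beta> j * (\<Prod>l\<in>J - {j}. j0 - l) = (if j = j0 then \<beta> j0 * (\<Prod>l\<in>J - {j0}. j0 - l) else 0)"
      using j0 J(2) by (auto intro!: prod_zero)
  qed
  then have "poly Q j0 = \<beta> j0 * (\<Prod>l\<in>J - {j0}. j0 - l)" using j0 J(2) by simp
  then have "poly Q j0 \<noteq> 0" using j0 J(2) by auto
  then have "Q \<noteq> 0" by auto
  moreover have "(\<lambda>x. poly Q (x $ i)) \<in> M"
  proof -
    have "(\<lambda>x. \<Sum>j\<in>J. \<beta> j * (\<Prod>l\<in>J - {j}. x $ i - l) * (1 - v j x * (x $ i - j))) \<in> M"
      by (intro pf_ideal_sum[OF M] pf_idealD(4)[OF M] v pf_intros)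
    moreover have "(\<Sum>j\<in>J. \<beta> j * (\<Prod>l\<in>J - {j}. x $ i - l) * (1 - v j x * (x $ i - j))) = poly Q (x $ i)"
      for x :: "complex^3"
    proof -
      have "(\<Sum>j\<in>J. \<beta> j * (\<Prod>l\<in>J - {j}. x $ i - l) * (1 - v j x * (x $ i - j)))
        = (\<Sum>j\<in>J. \<beta> j * (\<Prod>l\<in>J - {j}. x $ i - l)
             - (\<beta> j * v j x) * ((x $ i - j) * (\<Prod>l\<in>J - {j}. x $ i - l)))"
        by (rule sum.cong) (simp_all add: algebra_simps)
      also have "\<dots> = (\<Sum>j\<in>J. \<beta> j * (\<Prod>l\<in>J - {j}. x $ i - l)
             - (\<beta> j * v j x) * (\<Prod>l\<in>J. x $ i - l))"
        by (rule sum.cong) (simp_all add: prod.remove[OF J(2)])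
      also have "\<dots> = poly Q (x $ i) - (\<Sum>j\<in>J. \<beta> j * v j x) * (\<Prod>l\<in>J. x $ i - l)"
        by (simp add: sum_subtractf Qval sum_distrib_right)
      finally show ?thesis by (simp add: \<beta>(2))
    qed
    ultimately show ?thesis by (rule fun_mem_cong)
  qed
  ultimately show False using maximal_root neg by blast
qed

lemma maximal_zero: "\<exists>x. \<forall>u\<in>M. u x = 0"
proof -
  have "\<forall>i. \<exists>c. (\<lambda>x. x $ i - c) \<in> M" using maximal_coordinate by blast
  then obtain c where c: "\<And>i. (\<lambda>x. x $ i - c i) \<in> M" by metis
  define p :: "complex^3" where "p = (\<chi> i. c i)"
  \<comment> \<open>Modulo \<open>M\<close> every polynomial is congruent to its value at
    \<open>p\<close>. For a member of \<open>M\<close> this value is a constant in \<open>M\<close>,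
    hence zero.\<close>
  have "(\<lambda>x. u x - u p) \<in> M" if "pf u" for u
    using that
  proof induction
    case (const a)
    show ?case using pf_idealD(2)[OF M] by simp
  next
    case (coord i)
    show ?case using c by (simp add: p_def)
  next
    case (add u v)
    show ?case by (rule fun_mem_cong[OF pf_idealD(3)[OF M add.IH]]) (simp add: algebra_simps)
  next
    case (mult u v)
    have "(\<lambda>x. u x * (v x - v p) + v p * (u x - u p)) \<in> M"
      by (intro pf_idealD(3)[OF M] pf_idealD(4)[OF M] mult pf_intros)
    then show ?case by (rule fun_mem_cong) (simp add: algebra_simps)
  qed
  then have "(\<lambda>x. u p) \<in> M" if "u \<in> M" for u
    using pf_ideal_diff[OF M that, of "\<lambda>x. u x - u p"] pf_idealD(1)[OF M that] by simp
  then show ?thesis using maximal_const by blast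
qed

end

theorem weak_nullstellensatz:
  assumes "pf_ideal I" "\<And>x. \<exists>u\<in>I. u x \<noteq> 0"
  shows "(\<lambda>x. 1) \<in> I"
proof (rule ccontr)
  assume "(\<lambda>x. 1) \<notin> I"
  from maximal_pf_ideal_exists[OF assms(1) this] obtain M where "I \<subseteq> M" "pf_ideal M" "(\<lambda>x. 1) \<notin> M"
    and max: "\<And>N. pf_ideal N \<Longrightarrow> M \<subseteq> N \<Longrightarrow> (\<lambda>x. 1) \<notin> N \<Longrightarrow> N = M" by blast
  moreover from maximal_zero[OF this(2-3) max] obtain x where "\<forall>u\<in>M. u x = 0" by blast
  ultimately show False using assms(2)[of x] by blast
qed

text \<open>Applied with h = x_i - 1 to dehomogenize at a coordinate, and with h = g - t0 to detect
  the values of \<open>g\<close> on a fibre.\<close>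

corollary weak_nullstellensatz4:
  fixes G :: "complex^3 \<Rightarrow> complex^3"
  assumes "\<And>i. pf (\<lambda>x. G x $ i)" "pf h" "\<And>x. G x \<noteq> 0 \<or> h x \<noteq> 0"
  shows "\<exists>u v. (\<forall>i. pf (\<lambda>x. u x $ i)) \<and> pf v \<and> (\<forall>x. 1 = (\<Sum>i\<in>UNIV. u x $ i * G x $ i) + v x * h x)"
proof -
  let ?I = "{\<lambda>x. (\<Sum>i\<in>UNIV. u x $ i * G x $ i) + v x * h x |u v. (\<forall>i. pf (\<lambda>x. u x $ i)) \<and> pf v}"
  have mem: "(\<lambda>x. (\<Sum>i\<in>UNIV. u x $ i * G x $ i) + v x * h x) \<in> ?I"
    if "\<And>i. pf (\<lambda>x. u x $ i)" "pf v" for u :: "complex^3 \<Rightarrow> complex^3" and v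
    using that by blast
  have "pf_ideal ?I" unfolding pf_ideal_def
  proof (intro conjI ballI allI impI)
    show "?I \<subseteq> Collect pf" using assms(1,2) by (auto intro!: pf_intros)
    show "(\<lambda>x. 0) \<in> ?I" using mem[of "\<lambda>x. 0" "\<lambda>x. 0"] by (simp add: pf.const)
  next
    fix a b assume "a \<in> ?I" "b \<in> ?I"
    then obtain u v u' v' where *: "a = (\<lambda>x. (\<Sum>i\<in>UNIV. u x $ i * G x $ i) + v x * h x)"
      "b = (\<lambda>x. (\<Sum>i\<in>UNIV. u' x $ i * G x $ i) + v' x * h x)"
      "\<And>i. pf (\<lambda>x. u x $ i)" "\<And>i. pf (\<lambda>x. u' x $ i)" "pf v" "pf v'" by blast
    have "(\<lambda>x. (\<Sum>i\<in>UNIV. (u x + u' x) $ i * G x $ i) + (v x + v' x) * h x) \<in> ?I"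
      by (rule mem) (auto intro!: pf.add * simp del: vector_space_over_itself.scale_left_distrib)
    then show "(\<lambda>x. a x + b x) \<in> ?I" by (simp add: * algebra_simps sum.distrib)
  next
    fix a b assume "a \<in> ?I" and b: "pf b"
    then obtain u v where *: "a = (\<lambda>x. (\<Sum>i\<in>UNIV. u x $ i * G x $ i) + v x * h x)"
      "\<And>i. pf (\<lambda>x. u x $ i)" "pf v" by blast
    have "(\<lambda>x. (\<Sum>i\<in>UNIV. (b x *s u x) $ i * G x $ i) + (b x * v x) * h x) \<in> ?I"
      by (rule mem) (auto intro!: pf.mult * b)
    then show "(\<lambda>x. b x * a x) \<in> ?I" by (simp add: * algebra_simps sum_distrib_left)
  qed
  moreover have "\<exists>u\<in>?I. u x \<noteq> 0" for x
  proof (cases "h x = 0")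
    case True
    then obtain i where "G x $ i \<noteq> 0" using assms(3)[of x] by (auto simp: Finite_Cartesian_Product.vec_eq_iff)
    moreover have "(\<lambda>y. (\<Sum>j\<in>UNIV. (axis i 1 :: complex^3) $ j * G y $ j) + 0 * h y) \<in> ?I"
      by (rule mem) (auto intro: pf.const)
    moreover have "(\<Sum>j\<in>UNIV. (axis i 1 :: complex^3) $ j * G y $ j) = G y $ i" for y
      by (simp add: axis_def if_distrib[of "\<lambda>t. t * _"] cong: if_cong)
    ultimately show ?thesis by (intro bexI) auto
  next
    case False
    moreover have "(\<lambda>y. (\<Sum>j\<in>UNIV. (0 :: complex^3) $ j * G y $ j) + 1 * h y) \<in> ?I"
      by (rule mem) (auto intro: pf.const)
    ultimately show ?thesis by (intro bexI) auto
  qed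
  ultimately have "(\<lambda>x. 1) \<in> ?I" by (rule weak_nullstellensatz)
  then obtain u v where *: "(\<lambda>x. 1) = (\<lambda>x. (\<Sum>i\<in>UNIV. u x $ i * G x $ i) + v x * h x)"
    "\<And>i. pf (\<lambda>x. u x $ i)" "pf v" by blast
  from fun_cong[OF *(1)] *(2,3) show ?thesis by blast
qed

section \<open>Polynomials as a module over the ring generated by three forms\<close>

lemma coord_power_deg_le: "(\<lambda>x. (x $ i) ^ k) \<in> deg_le k"
proof -
  have "(\<lambda>x::complex^3. (x $ 1) ^ k) = mon k 0 0" "(\<lambda>x::complex^3. (x $ 2) ^ k) = mon 0 k 0"
    "(\<lambda>x::complex^3. (x $ 3) ^ k) = mon 0 0 k" by (simp_all add: mon_def fun_eq_iff)
  then show ?thesis using mon_in_deg_le[of k 0 0 k] mon_in_deg_le[of 0 k 0 k] mon_in_deg_le[of 0 0 k k]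
    by (cases i rule: exhaust_3[THEN disjE]) auto
qed

text \<open>A monomial of degree e \<le> n is multiplied by the missing power of x_i, of exponent n
  - e, so the degree bound \<open>n\<close> is kept.\<close>

lemma homogenize:
  assumes "u \<in> deg_le n"
  shows "\<exists>w\<in>deg_le n. \<forall>x. x $ i \<noteq> 0 \<longrightarrow> w x = (x $ i) ^ n * u (inverse (x $ i) *s x)"
  using assms unfolding deg_le_def
proof induction
  case zero
  show ?case by (rule bexI[OF _ cspan.zero]) simp
next
  case (step u b c)
  then obtain w where w: "w \<in> deg_le n" "\<And>x. x $ i \<noteq> 0 \<Longrightarrow> w x = (x $ i) ^ n * u (inverse (x $ i) *s x)"
    unfolding deg_le_def by blast
  from step obtain j k l where b: "b = mon j k l" "j + k + l \<le> n" by blast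
  let ?e = "n - (j + k + l)"
  have td: "(\<lambda>x. (x $ i) ^ ?e * mon j k l x) \<in> deg_le n"
    using deg_le_mult[OF coord_power_deg_le[of i ?e] mon_in_deg_le[OF order_refl, of j k l]] b(2) by simp
  have eq: "(x $ i) ^ ?e * mon j k l x = (x $ i) ^ n * mon j k l (inverse (x $ i) *s x)" if "x $ i \<noteq> 0" for x
  proof -
    have "(x $ i) ^ n = (x $ i) ^ ?e * (x $ i) ^ (j + k + l)" using b(2) by (simp flip: power_add)
    then show ?thesis using that by (simp add: mon_scale power_inverse)
  qed
  show ?case
  proof (rule bexI[of _ "\<lambda>x. w x + c * ((x $ i) ^ ?e * mon j k l x)"])
    show "(\<lambda>x. w x + c * ((x $ i) ^ ?e * mon j k l x)) \<in> cspan {mon i j k |i j k. i + j + k \<le> n}"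
      using w(1) td unfolding deg_le_def by (intro cspan_add cspan_scale)
    show "\<forall>x. x $ i \<noteq> 0 \<longrightarrow> w x + c * ((x $ i) ^ ?e * mon j k l x) =
      (x $ i) ^ n * (u (inverse (x $ i) *s x) + c * b (inverse (x $ i) *s x))"
      using w(2) eq b(1) by (simp add: algebra_simps)
  qed
qed

locale forms =
  fixes F :: "complex^3 \<Rightarrow> complex^3" and d :: nat
  assumes pf_F: "\<And>i. pf (\<lambda>x. F x $ i)"
    and homog_F: "\<And>i. homog d (\<lambda>x. F x $ i)"
    and d_pos: "d > 0"
    and zero_F: "\<And>x. F x = 0 \<Longrightarrow> x = 0"
begin

lemma F_scale: "F (c *s x) = c ^ d *s F x"
  using homog_F by (simp add: homog_def Finite_Cartesian_Product.vec_eq_iff)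

lemma F_0: "F 0 = 0"
  using F_scale[of 0 0] unfolding zero_power[OF d_pos] by simp

text \<open>\<open>F\<close> has no zero on the plane x_i = 1, so the Nullstellensatz writes 1 there
  as a combination of the components of \<open>F\<close>. Homogenizing with respect to x_i gives the
  power of x_i.\<close>

lemma coord_power_in_ideal_aux:
  "\<exists>m0. \<forall>m\<ge>m0. m \<ge> d \<and> (\<exists>w. (\<forall>j. w j \<in> deg_le (m - d)) \<and> (\<forall>x. (x $ i) ^ m = (\<Sum>j\<in>UNIV. w j x * F x $ j)))"
proof -
  have "F x \<noteq> 0 \<or> x $ i - 1 \<noteq> 0" for x using zero_F[of x] by auto
  then have "\<exists>u v. (\<forall>j. pf (\<lambda>x. u x $ j)) \<and> pf v \<and>
      (\<forall>x. 1 = (\<Sum>j\<in>UNIV. u x $ j * F x $ j) + v x * (x $ i - 1))"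
    by (intro weak_nullstellensatz4 pf_F pf_intros)
  then obtain u :: "complex^3 \<Rightarrow> complex^3" and v where u: "\<And>j. pf (\<lambda>x. u x $ j)"
    "\<And>x. 1 = (\<Sum>j\<in>UNIV. u x $ j * F x $ j) + v x * (x $ i - 1)" by blast
  have "\<forall>j. \<exists>n. (\<lambda>x. u x $ j) \<in> deg_le n" using pf_in_deg_le[OF u(1)] by blast
  from choice[OF this] obtain N where N: "\<And>j. (\<lambda>x. u x $ j) \<in> deg_le (N j)" by blast
  define n where "n = Max (range N)"
  have "(\<lambda>x. u x $ j) \<in> deg_le n" for j by (rule deg_le_mono[OF N]) (simp add: n_def)
  then have "\<forall>j. \<exists>w. w \<in> deg_le n \<and> (\<forall>x. x $ i \<noteq> 0 \<longrightarrow> w x = (x $ i) ^ n * u (inverse (x $ i) *s x) $ j)"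
    using homogenize by blast
  from choice[OF this] obtain w where w: "\<And>j. w j \<in> deg_le n"
    "\<And>j x. x $ i \<noteq> 0 \<Longrightarrow> w j x = (x $ i) ^ n * u (inverse (x $ i) *s x) $ j" by blast
  have eq: "(x $ i) ^ (n + d) = (\<Sum>j\<in>UNIV. w j x * F x $ j)" if "x $ i \<noteq> 0" for x
  proof -
    have "1 = (\<Sum>j\<in>UNIV. u (inverse (x $ i) *s x) $ j * (inverse (x $ i) ^ d * F x $ j))"
      using u(2)[of "inverse (x $ i) *s x"] that by (simp add: F_scale)
    then have "(x $ i) ^ (n + d) = (x $ i) ^ (n + d) *
       (\<Sum>j\<in>UNIV. u (inverse (x $ i) *s x) $ j * (inverse (x $ i) ^ d * F x $ j))" by simp
    also have "\<dots> = (\<Sum>j\<in>UNIV. w j x * F x $ j)"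
      unfolding sum_distrib_left
      by (rule sum.cong) (use that in \<open>simp_all add: w(2) power_add power_inverse\<close>)
    finally show ?thesis .
  qed
  show ?thesis
  proof (intro exI[of _ "n + d + 1"] allI impI conjI)
    fix m assume m: "n + d + 1 \<le> m"
    then show "d \<le> m" by simp
    \<comment> \<open>At least one extra factor x_i is multiplied in, so that both sides vanish
      where x_i = 0 and the identity holds there as well.\<close>
    let ?k = "m - (n + d)"
    have k: "m = ?k + (n + d)" "?k > 0" "?k + n = m - d" using m by auto
    show "\<exists>w. (\<forall>j. w j \<in> deg_le (m - d)) \<and> (\<forall>x. (x $ i) ^ m = (\<Sum>j\<in>UNIV. w j x * F x $ j))"
    proof (intro exI[of _ "\<lambda>j x. (x $ i) ^ ?k * w j x"] conjI allI)
      show "(\<lambda>x. (x $ i) ^ ?k * w j x) \<in> deg_le (m - d)" for j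
        using deg_le_mult[OF coord_power_deg_le w(1)[of j], of i ?k] k(3) by simp
      fix x :: "complex^3"
      show "(x $ i) ^ m = (\<Sum>j\<in>UNIV. (x $ i) ^ ?k * w j x * F x $ j)"
      proof (cases "x $ i = 0")
        case True
        then show ?thesis using k m by (simp add: power_0_left)
      next
        case False
        have "(x $ i) ^ m = (x $ i) ^ ?k * (x $ i) ^ (n + d)" using k(1) by (metis power_add)
        then show ?thesis using eq[OF False] by (simp add: sum_distrib_left mult.assoc)
      qed
    qed
  qed
qed

lemma coord_power_in_ideal:
  "\<exists>m>0. m \<ge> d \<and> (\<forall>i. \<exists>w. (\<forall>j. w j \<in> deg_le (m - d)) \<and> (\<forall>x. (x $ i) ^ m = (\<Sum>j\<in>UNIV. w j x * F x $ j)))"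
proof -
  have "\<forall>i. \<exists>m0. \<forall>m\<ge>m0. m \<ge> d \<and> (\<exists>w. (\<forall>j. w j \<in> deg_le (m - d)) \<and>
      (\<forall>x. (x $ i) ^ m = (\<Sum>j\<in>UNIV. w j x * F x $ j)))"
    by (rule allI, rule coord_power_in_ideal_aux)
  from choice[OF this] obtain m0 where m0: "\<forall>i. \<forall>m\<ge>m0 i. m \<ge> d \<and> (\<exists>w. (\<forall>j. w j \<in> deg_le (m - d)) \<and>
      (\<forall>x. (x $ i) ^ m = (\<Sum>j\<in>UNIV. w j x * F x $ j)))" ..
  show ?thesis
  proof (intro exI[of _ "Suc (Max (range m0))"] conjI allI)
    have "m0 i \<le> Suc (Max (range m0))" for i by (rule le_SucI, rule Max_ge) auto
    note * = m0[rule_format, OF this]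
    show "d \<le> Suc (Max (range m0))" by (rule conjunct1[OF *[of 1]])
    show "\<exists>w. (\<forall>j. w j \<in> deg_le (Suc (Max (range m0)) - d)) \<and>
      (\<forall>x. (x $ i) ^ Suc (Max (range m0)) = (\<Sum>j\<in>UNIV. w j x * F x $ j))" for i
      by (rule conjunct2[OF *])
  qed simp
qed

definition boxmons :: "nat \<Rightarrow> (complex^3 \<Rightarrow> complex) set" where
  "boxmons m = {mon i j k |i j k. i < m \<and> j < m \<and> k < m}"

text \<open>Module generators times monomials in \<open>F\<close>. The exponent bound
  \<open>n\<close> keeps the set finite, of size quadratic in \<open>n\<close> once one component of
  \<open>F\<close> vanishes.\<close>

definition Fprods :: "nat \<Rightarrow> nat \<Rightarrow> (complex^3 \<Rightarrow> complex) set" where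
  "Fprods m n = {\<lambda>x. mon a b c (F x) * e x |a b c e. a \<le> n \<and> b \<le> n \<and> c \<le> n \<and> e \<in> boxmons m}"

lemma finite_boxmons: "finite (boxmons m)"
proof (rule finite_subset)
  show "boxmons m \<subseteq> (\<lambda>(i, j, k). mon i j k) ` ({..<m} \<times> {..<m} \<times> {..<m})"
  proof
    fix u assume "u \<in> boxmons m"
    then obtain i j k where "u = mon i j k" "i < m" "j < m" "k < m" unfolding boxmons_def by blast
    then show "u \<in> (\<lambda>(i, j, k). mon i j k) ` ({..<m} \<times> {..<m} \<times> {..<m})"
      by (intro image_eqI[of _ _ "(i, j, k)"]) auto
  qed
qed auto

text \<open>Induction on the degree: a monomial with an exponent at least \<open>m\<close> contains
  some x_l^m, which is a combination of the F_h. The coefficients then have degree at most n - d <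
  n. All other monomials lie in the box.\<close>

lemma generated_deg_le:
  "\<exists>m>0. \<forall>n. deg_le n \<subseteq> cspan (Fprods m n)"
proof -
  obtain m where m: "m > 0" "m \<ge> d" and
    "\<forall>i. \<exists>w. (\<forall>j. w j \<in> deg_le (m - d)) \<and> (\<forall>x. (x $ i) ^ m = (\<Sum>j\<in>UNIV. w j x * F x $ j))"
    using coord_power_in_ideal by blast
  from choice[OF this(3)] obtain w where w: "\<And>i j. w i j \<in> deg_le (m - d)"
    "\<And>i x. (x $ i) ^ m = (\<Sum>j\<in>UNIV. w i j x * F x $ j)" by blast
  \<comment> \<open>Multiplication by F_j raises a single exponent by one, which the gap between
    \<open>k\<close> and \<open>n\<close> absorbs.\<close>
  have F_mult: "(\<lambda>x. u x * F x $ j) \<in> cspan (Fprods m n)" if "u \<in> cspan (Fprods m k)" "k < n" for u j k n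
    using that(1)
  proof induction
    case zero
    then show ?case by (simp add: cspan.zero)
  next
    case (step u b c)
    from step.hyps obtain a1 a2 a3 e where b: "b = (\<lambda>x. mon a1 a2 a3 (F x) * e x)"
      "a1 \<le> k" "a2 \<le> k" "a3 \<le> k" "e \<in> boxmons m" unfolding Fprods_def by blast
    have "\<exists>b1 b2 b3. b1 \<le> n \<and> b2 \<le> n \<and> b3 \<le> n \<and> (\<forall>y. mon a1 a2 a3 y * y $ j = mon b1 b2 b3 y)"
    proof (cases j rule: exhaust_3[THEN disjE])
      case 1
      then show ?thesis using b that(2) by (intro exI[of _ "Suc a1"] exI[of _ a2] exI[of _ a3]) (auto simp: mon_def)
    next
      case 2
      then show ?thesis
      proof
        assume "j = 2"
        then show ?thesis using b that(2) by (intro exI[of _ a1] exI[of _ "Suc a2"] exI[of _ a3]) (auto simp: mon_def)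
      next
        assume "j = 3"
        then show ?thesis using b that(2) by (intro exI[of _ a1] exI[of _ a2] exI[of _ "Suc a3"]) (auto simp: mon_def)
      qed
    qed
    then obtain b1 b2 b3 where b': "b1 \<le> n" "b2 \<le> n" "b3 \<le> n" "\<And>y. mon a1 a2 a3 y * y $ j = mon b1 b2 b3 y"
      by blast
    have "(\<lambda>x. mon b1 b2 b3 (F x) * e x) \<in> Fprods m n" unfolding Fprods_def using b' b by blast
    then have "(\<lambda>x. u x * F x $ j + c * (mon b1 b2 b3 (F x) * e x)) \<in> cspan (Fprods m n)"
      using step.IH by (rule cspan.step[rotated])
    then show ?case by (rule fun_mem_cong) (simp add: b algebra_simps flip: b'(4))
  qed
  have "mon i j k \<in> cspan (Fprods m n) \<and> deg_le n \<subseteq> cspan (Fprods m n)" if "i + j + k \<le> n" for i j k n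
    using that
  proof (induction n arbitrary: i j k rule: less_induct)
    case (less n)
    have mem: "mon i j k \<in> cspan (Fprods m n)" if le: "i + j + k \<le> n" for i j k
    proof -
      have big: "(\<lambda>x. v x * (x $ l) ^ m) \<in> cspan (Fprods m n)" if v: "v \<in> deg_le (n - m)" and "m \<le> n" for v l
      proof -
        have "(\<lambda>x. v x * w l h x * F x $ h) \<in> cspan (Fprods m n)" for h
        proof (rule F_mult)
          have "(\<lambda>x. v x * w l h x) \<in> deg_le (n - m + (m - d))" by (rule deg_le_mult[OF v w(1)])
          also have "n - m + (m - d) = n - d" using m \<open>m \<le> n\<close> by simp
          finally show "(\<lambda>x. v x * w l h x) \<in> cspan (Fprods m (n - d))"
            using less.IH[of "n - d" 0 0 0] m \<open>m \<le> n\<close> d_pos by auto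
          show "n - d < n" using m \<open>m \<le> n\<close> d_pos by simp
        qed
        then have "(\<lambda>x. \<Sum>h\<in>UNIV. v x * w l h x * F x $ h) \<in> cspan (Fprods m n)" by (rule cspan_sum)
        then show ?thesis by (rule fun_mem_cong) (simp add: w(2) sum_distrib_left mult.assoc)
      qed
      consider "i \<ge> m" | "j \<ge> m" | "k \<ge> m" | "i < m \<and> j < m \<and> k < m" by linarith
      then show ?thesis
      proof cases
        case 1
        have "mon (i - m) j k \<in> deg_le (n - m)" by (rule mon_in_deg_le) (use le 1 in simp)
        then have "(\<lambda>x. mon (i - m) j k x * (x $ 1) ^ m) \<in> cspan (Fprods m n)" by (rule big) (use le 1 in simp)
        then show ?thesis by (rule fun_mem_cong) (use 1 in \<open>simp add: mon_def mult_ac flip: power_add\<close>)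
      next
        case 2
        have "mon i (j - m) k \<in> deg_le (n - m)" by (rule mon_in_deg_le) (use le 2 in simp)
        then have "(\<lambda>x. mon i (j - m) k x * (x $ 2) ^ m) \<in> cspan (Fprods m n)" by (rule big) (use le 2 in simp)
        then show ?thesis by (rule fun_mem_cong) (use 2 in \<open>simp add: mon_def mult_ac flip: power_add\<close>)
      next
        case 3
        have "mon i j (k - m) \<in> deg_le (n - m)" by (rule mon_in_deg_le) (use le 3 in simp)
        then have "(\<lambda>x. mon i j (k - m) x * (x $ 3) ^ m) \<in> cspan (Fprods m n)" by (rule big) (use le 3 in simp)
        then show ?thesis by (rule fun_mem_cong) (use 3 in \<open>simp add: mon_def mult_ac flip: power_add\<close>)
      next
        case 4
        then have "mon i j k \<in> boxmons m" unfolding boxmons_def by blast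
        moreover have "mon i j k = (\<lambda>x. mon 0 0 0 (F x) * mon i j k x)" by (simp add: mon_def fun_eq_iff)
        ultimately have "mon i j k \<in> Fprods m n" unfolding Fprods_def
          by (intro CollectI exI[of _ 0] exI[of _ "mon i j k"] conjI le0)
        then show ?thesis by (rule cspan_base)
      qed
    qed
    moreover have "deg_le n \<subseteq> cspan (Fprods m n)"
      unfolding deg_le_def using mem cspan_trans[of _ "{mon i j k |i j k. i + j + k \<le> n}" "Fprods m n"] by blast
    ultimately show ?case using less.prems by blast
  qed
  from this[of 0 0 0] m(1) show ?thesis by auto
qed

lemma finitely_generated:
  obtains E where "finite E" "\<And>e. e \<in> E \<Longrightarrow> pf e" "(\<lambda>x. 1) \<in> E"
    "\<And>u. pf u \<Longrightarrow> \<exists>h. (\<forall>e\<in>E. pf (h e)) \<and> (\<forall>x. u x = (\<Sum>e\<in>E. h e (F x) * e x))"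
proof -
  obtain m where m: "m > 0" "\<And>n. deg_le n \<subseteq> cspan (Fprods m n)" using generated_deg_le by blast
  show ?thesis
  proof (rule that[of "boxmons m"])
    show "finite (boxmons m)" by (rule finite_boxmons)
    show "pf e" if "e \<in> boxmons m" for e using that pf_mon unfolding boxmons_def by blast
    have "(\<lambda>x::complex^3. 1) = mon 0 0 0" by (simp add: mon_def fun_eq_iff)
    then show "(\<lambda>x. 1) \<in> boxmons m" unfolding boxmons_def using m(1) by auto
    fix u :: "complex^3 \<Rightarrow> complex" assume "pf u"
    then obtain n where "u \<in> cspan (Fprods m n)" using pf_in_deg_le m(2) by blast
    then show "\<exists>h. (\<forall>e\<in>boxmons m. pf (h e)) \<and> (\<forall>x. u x = (\<Sum>e\<in>boxmons m. h e (F x) * e x))"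
    proof induction
      case zero
      show ?case by (rule exI[of _ "\<lambda>_ _. 0"]) (simp add: pf.const)
    next
      case (step u b k)
      then obtain h where h: "\<And>e. e \<in> boxmons m \<Longrightarrow> pf (h e)" "\<And>x. u x = (\<Sum>e\<in>boxmons m. h e (F x) * e x)"
        by blast
      from step obtain a1 a2 a3 e0 where b: "b = (\<lambda>x. mon a1 a2 a3 (F x) * e0 x)" "e0 \<in> boxmons m"
        unfolding Fprods_def by blast
      let ?h = "\<lambda>e y. h e y + (if e = e0 then k else 0) * mon a1 a2 a3 y"
      have "(\<Sum>e\<in>boxmons m. (if e = e0 then k else 0) * mon a1 a2 a3 y * e x) = k * mon a1 a2 a3 y * e0 x" for x y
      proof -
        have "(\<Sum>e\<in>boxmons m. (if e = e0 then k else 0) * mon a1 a2 a3 y * e x)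
          = (\<Sum>e\<in>boxmons m. if e = e0 then k * mon a1 a2 a3 y * e0 x else 0)"
          by (rule sum.cong) auto
        then show ?thesis using finite_boxmons b(2) by simp
      qed
      then have "u x + k * b x = (\<Sum>e\<in>boxmons m. ?h e (F x) * e x)" for x
        by (simp add: b h(2) distrib_right sum.distrib mult.assoc)
      moreover have "\<forall>e\<in>boxmons m. pf (?h e)" using h(1) by (auto intro!: pf.add pf.mult pf.const pf_mon)
      ultimately show ?case by (intro exI[of _ ?h] conjI allI)
    qed
  qed
qed

end

section \<open>Surjectivity\<close>

lemma monomials_independent:
  assumes "\<And>x. (\<Sum>(i, j, k)\<in>{..n} \<times> {..n} \<times> {..n}. \<beta> (i, j, k) * mon i j k x) = 0"
    and "i \<le> n" "j \<le> n" "k \<le> n"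
  shows "\<beta> (i, j, k) = (0 :: complex)"
proof -
  have *: "(\<Sum>i\<le>n. (\<Sum>j\<le>n. (\<Sum>k\<le>n. \<beta> (i, j, k) * c ^ k) * b ^ j) * a ^ i) = 0" for a b c
    using assms(1)[of "vector [a, b, c]"]
    by (simp add: mon_def sum.cartesian_product[symmetric] sum_distrib_right sum_distrib_left mult_ac)
  have 1: "(\<Sum>j\<le>n. (\<Sum>k\<le>n. \<beta> (i, j, k) * c ^ k) * b ^ j) = 0" for b c
    using *[of c b] polyfun_eq_0[of "\<lambda>i. \<Sum>j\<le>n. (\<Sum>k\<le>n. \<beta> (i, j, k) * c ^ k) * b ^ j" n] assms(2) by blast
  have 2: "(\<Sum>k\<le>n. \<beta> (i, j, k) * c ^ k) = 0" for c
    using 1[of c] polyfun_eq_0[of "\<lambda>j. \<Sum>k\<le>n. \<beta> (i, j, k) * c ^ k" n] assms(3) by blast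
  show ?thesis
    using 2 polyfun_eq_0[of "\<lambda>k. \<beta> (i, j, k)" n] assms(4) by blast
qed

lemma complex_root_exists: "d > 0 \<Longrightarrow> \<exists>w::complex. w ^ d = z"
  by (metis exists_complex_root less_not_refl)

context forms
begin

text \<open>Two forms of positive degree in three variables have a nontrivial common zero: otherwise
  the \<open>(n + 1)\<^sup>3\<close> monomials with exponents at most \<open>n\<close> would lie in a space of
  dimension \<open>O(n\<^sup>2)\<close>.\<close>

lemma third_component_nonzero: "\<exists>x. F x $ 3 \<noteq> 0"
proof (rule ccontr)
  assume "\<nexists>x. F x $ 3 \<noteq> 0"
  then have F3: "F x $ 3 = 0" for x by blast
  obtain m where m: "\<And>n. deg_le n \<subseteq> cspan (Fprods m n)" using generated_deg_le by blast
  \<comment> \<open>Exponents up to \<open>n\<close> give degree up to 3n, hence at most (3n + 1)^2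
    N spanning functions when F_3 = 0. This is at most 9N (n + 1)^2 = n (n + 1)^2, below the number
    (n + 1)^3 of monomials.\<close>
  define N n where "N = card (boxmons m)" and "n = 9 * N"
  let ?g = "\<lambda>(a, b, e) x. mon a b 0 (F x) * e x"
  let ?A = "{..3 * n} \<times> {..3 * n} \<times> boxmons m"
  let ?B = "?g ` ?A"
  have "Fprods m (3 * n) \<subseteq> cspan ?B"
  proof
    fix u assume "u \<in> Fprods m (3 * n)"
    then obtain a b c e where u: "u = (\<lambda>x. mon a b c (F x) * e x)" "a \<le> 3 * n" "b \<le> 3 * n" "e \<in> boxmons m"
      unfolding Fprods_def by blast
    show "u \<in> cspan ?B"
    proof (cases "c = 0")
      case True
      then have "u \<in> ?B" using u by (intro image_eqI[of _ _ "(a, b, e)"]) auto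
      then show ?thesis by (rule cspan_base)
    next
      case False
      then have "u = (\<lambda>x. 0)" by (simp add: u(1) mon_def F3 power_0_left)
      then show ?thesis using cspan.zero by simp
    qed
  qed
  then have span: "deg_le (3 * n) \<subseteq> cspan ?B" using m[of "3 * n"] cspan_trans by blast
  let ?J = "{..n} \<times> {..n} \<times> {..n}"
  have fin: "finite ?A" using finite_boxmons by simp
  have "card ?B \<le> card ?A" by (rule card_image_le[OF fin])
  also have "\<dots> = (3 * n + 1) * (3 * n + 1) * N" by (simp only: card_cartesian_product N_def card_atMost Suc_eq_plus1 mult.assoc)
  also have "\<dots> < Suc n * Suc n * Suc n"
  proof -
    have "(3 * n + 1) * (3 * n + 1) * N \<le> (3 * Suc n) * (3 * Suc n) * N" by (intro mult_le_mono) auto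
    also have "\<dots> = Suc n * Suc n * n" by (simp add: n_def algebra_simps)
    also have "\<dots> < Suc n * Suc n * Suc n" by simp
    finally show ?thesis .
  qed
  finally have card: "card ?B < card ?J" by (simp only: card_cartesian_product card_atMost mult.assoc)
  have "case j of (i, j, k) \<Rightarrow> mon i j k \<in> cspan ?B" if "j \<in> ?J" for j
    using that span mon_in_deg_le by fastforce
  then obtain \<beta> where \<beta>: "\<exists>j\<in>?J. \<beta> j \<noteq> 0"
    "\<And>x. (\<Sum>j\<in>?J. \<beta> j * (case j of (i, j, k) \<Rightarrow> mon i j k) x) = 0"
    using cspan_dependent[OF finite_imageI[OF fin] _ card, of "\<lambda>(i, j, k). mon i j k"]
    by (auto simp: case_prod_beta)
  then have "(\<Sum>(i, j, k)\<in>?J. \<beta> (i, j, k) * mon i j k x) = 0" for x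
    using \<beta>(2)[of x] by (simp add: case_prod_beta)
  from monomials_independent[OF this] \<beta>(1) show False by auto
qed

end

text \<open>Two minors of the pair (F x, p) have a nontrivial common zero by
  \<open>third_component_nonzero\<close>, applied with zero as third form. There F x is a multiple
  of \<open>p\<close>, nonzero because x \<noteq> 0, and a d-th root scales it to
  \<open>p\<close>.\<close>

lemma (in forms) surjective:
  assumes "p \<noteq> 0"
  shows "\<exists>x. F x = p"
proof -
  obtain i where i: "p $ i \<noteq> 0" using assms by (auto simp: Finite_Cartesian_Product.vec_eq_iff)
  have "\<exists>j k. \<forall>l. l = i \<or> l = j \<or> l = k" using exhaust_3 by metis
  then obtain j k where jk: "\<And>l. l = i \<or> l = j \<or> l = k" by blast
  let ?G = "\<lambda>x. vector [p $ i * F x $ j - p $ j * F x $ i, p $ i * F x $ k - p $ k * F x $ i, 0] :: complex^3"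
  have "\<exists>x. ?G x = 0 \<and> x \<noteq> 0"
  proof (rule ccontr)
    assume neg: "\<nexists>x. ?G x = 0 \<and> x \<noteq> 0"
    interpret G: forms ?G d
    proof
      show "pf (\<lambda>x. ?G x $ l)" for l
        by (cases l rule: exhaust_3[THEN disjE]) (auto intro!: pf_intros pf_F)
      show "homog d (\<lambda>x. ?G x $ l)" for l
        using homog_F by (cases l rule: exhaust_3[THEN disjE]) (auto simp: homog_def algebra_simps)
      show "d > 0" by (rule d_pos)
      show "x = 0" if "?G x = 0" for x using neg that by blast
    qed
    show False using G.third_component_nonzero by simp
  qed
  then obtain x where x: "?G x = 0" "x \<noteq> 0" by blast
  define c where "c = F x $ i / p $ i"
  from x(1) have "p $ i * F x $ j = p $ j * F x $ i" "p $ i * F x $ k = p $ k * F x $ i"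
    by (simp_all add: Finite_Cartesian_Product.vec_eq_iff forall_3)
  then have "F x $ l = c * p $ l" for l
    using jk[of l] i by (auto simp: c_def field_simps)
  then have Fx: "F x = c *s p" by (simp add: Finite_Cartesian_Product.vec_eq_iff)
  then have "c \<noteq> 0" using x(2) zero_F by fastforce
  moreover obtain w where "w ^ d = 1 / c" using complex_root_exists[OF d_pos] by blast
  ultimately have "F (w *s x) = p" by (simp add: F_scale Fx)
  then show ?thesis ..
qed

section \<open>Univariate polynomials\<close>

lemma poly_over_power_tendsto:
  fixes p :: "complex poly"
  assumes "degree p \<le> n"
  shows "((\<lambda>x. poly p x / x ^ n) \<longlongrightarrow> coeff p n) at_infinity"
proof (cases "degree p = n")
  case True
  then show ?thesis using poly_divide_tendsto_aux[of p] by simp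
next
  case False
  then have lt: "degree p < degree (monom (1::complex) n)" using assms by (simp add: degree_monom_eq)
  \<comment> \<open>Adding x^n makes \<open>n\<close> the exact degree, so that the limit for
    leading coefficients applies; the added 1 is subtracted again.\<close>
  let ?q = "p + monom 1 n"
  have "degree ?q = n" "lead_coeff ?q = 1"
    using lt by (simp_all add: degree_add_eq_right degree_monom_eq coeff_eq_0 del: lead_coeff_monom)
  then have "((\<lambda>x. poly ?q x / x ^ n) \<longlongrightarrow> 1) at_infinity" using poly_divide_tendsto_aux[of ?q] by simp
  then have lim: "((\<lambda>x. poly ?q x / x ^ n - 1) \<longlongrightarrow> 0) at_infinity"
    by (auto intro: tendsto_eq_intros)
  have ev: "\<forall>\<^sub>F x in at_infinity. poly ?q x / x ^ n - 1 = poly p x / x ^ n"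
  proof (rule eventually_at_infinityI[of 1])
    fix x :: complex assume "1 \<le> norm x"
    then have "x \<noteq> 0" by auto
    then show "poly ?q x / x ^ n - 1 = poly p x / x ^ n" by (simp add: poly_monom field_simps)
  qed
  have "coeff p n = 0" using lt by (simp add: coeff_eq_0 degree_monom_eq)
  then show ?thesis using lim tendsto_cong[OF ev] by simp
qed

text \<open>Were the degree of \<open>t\<close> larger than \<open>k\<close>, dividing by its power
  of \<open>x\<close> would send the right side to 0 at infinity and the left side to the norm of
  the leading coefficient.\<close>

lemma degree_le_of_growth:
  fixes t :: "complex poly"
  assumes "\<And>i. i \<in> I \<Longrightarrow> degree (p i) \<le> k" and le: "\<And>x. norm (poly t x) \<le> C * (\<Sum>i\<in>I. norm (poly (p i) x))"
  shows "degree t \<le> k"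
proof (rule ccontr)
  assume neg: "\<not> degree t \<le> k"
  let ?n = "degree t"
  have "((\<lambda>x. poly (p i) x / x ^ ?n) \<longlongrightarrow> 0) at_infinity" if "i \<in> I" for i
    using poly_over_power_tendsto[of "p i" ?n] assms(1)[OF that] neg by (simp add: coeff_eq_0)
  then have "((\<lambda>x. C * (\<Sum>i\<in>I. norm (poly (p i) x / x ^ ?n))) \<longlongrightarrow> C * (\<Sum>i\<in>I. 0)) at_infinity"
    by (intro tendsto_mult tendsto_sum tendsto_const) (rule tendsto_norm_zero)
  moreover have "((\<lambda>x. norm (poly t x / x ^ ?n)) \<longlongrightarrow> norm (lead_coeff t)) at_infinity"
    by (intro tendsto_norm poly_over_power_tendsto) simp
  moreover have "\<forall>\<^sub>F x in at_infinity. norm (poly t x / x ^ ?n) \<le> C * (\<Sum>i\<in>I. norm (poly (p i) x / x ^ ?n))"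
  proof (rule always_eventually, rule allI)
    fix x :: complex
    have "norm (poly t x / x ^ ?n) \<le> C * (\<Sum>i\<in>I. norm (poly (p i) x)) / norm (x ^ ?n)"
      unfolding norm_divide using le[of x] by (intro divide_right_mono) auto
    then show "norm (poly t x / x ^ ?n) \<le> C * (\<Sum>i\<in>I. norm (poly (p i) x / x ^ ?n))"
      by (simp add: norm_divide sum_divide_distrib sum_distrib_left)
  qed
  ultimately have "norm (lead_coeff t) \<le> C * (\<Sum>i\<in>I. 0)" by (intro tendsto_le[OF trivial_limit_at_infinity])
  then show False using neg by auto
qed

lemma coeff_prod_linear_factors:
  "degree (\<Prod>a\<leftarrow>as. [:- a, 1:]) = length as \<and> lead_coeff (\<Prod>a\<leftarrow>as. [:- a, 1 :: complex:]) = 1 \<and>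
   (as \<noteq> [] \<longrightarrow> coeff (\<Prod>a\<leftarrow>as. [:- a, 1:]) (length as - 1) = - sum_list as)"
proof (induction as)
  case Nil
  then show ?case by simp
next
  case (Cons a as)
  let ?p = "\<Prod>a\<leftarrow>as. [:- a, 1:]"
  have c1: "coeff ?p (length as) = 1" using Cons by metis
  have "?p \<noteq> 0" using Cons by auto
  then have deg: "degree ([:- a, 1:] * ?p) = Suc (length as)"
    using Cons by (subst degree_mult_eq) auto
  moreover have "lead_coeff ([:- a, 1:] * ?p) = 1"
    using Cons c1 by (simp only: lead_coeff_mult) simp
  moreover have "coeff ([:- a, 1:] * ?p) (length as) = - (a + sum_list as)"
    using Cons c1 by (cases as) (auto simp: coeff_pCons split: nat.splits)
  ultimately show ?case by simp
qed

text \<open>Vieta's formula; the list contains the roots with multiplicity.\<close>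

lemma sum_of_roots:
  fixes p :: "complex poly"
  assumes "degree p > 0"
  shows "\<exists>as. length as = degree p \<and> (\<forall>a\<in>set as. poly p a = 0) \<and>
    coeff p (degree p - 1) = - lead_coeff p * sum_list as"
proof -
  obtain A where A: "size A = degree p" "p = Polynomial.smult (lead_coeff p) (\<Prod>x\<in>#A. [:- x, 1:])"
    using alg_closed_imp_factorization[of p] assms by force
  obtain as where as: "A = mset as" by (metis ex_mset)
  have len: "length as = degree p" using A(1) as by simp
  have p: "p = Polynomial.smult (lead_coeff p) (\<Prod>a\<leftarrow>as. [:- a, 1:])"
    using A(2) unfolding as by (metis mset_map prod_mset_prod_list)
  have "poly p a = 0" if "a \<in> set as" for a
  proof -
    have "[:- a, 1:] dvd (\<Prod>a\<leftarrow>as. [:- a, 1:])" using that by (intro prod_list_dvd) auto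
    then show ?thesis by (subst p) (simp add: poly_eq_0_iff_dvd dvd_smult)
  qed
  moreover have "coeff p (degree p - 1) = - lead_coeff p * sum_list as"
  proof -
    have "as \<noteq> []" using len assms by auto
    then have "coeff (\<Prod>a\<leftarrow>as. [:- a, 1:]) (degree p - 1) = - sum_list as"
      using coeff_prod_linear_factors[of as] len by simp
    then show ?thesis by (subst p) simp
  qed
  ultimately show ?thesis using len by blast
qed

section \<open>The fibres of \<open>F\<close> over a polynomial curve\<close>

text \<open>A polynomial in \<open>T\<close> with coefficients in \<open>\<complex>[\<tau>]\<close>, evaluated at \<open>\<tau>\<close> and \<open>T\<close>.\<close>

definition ev2 :: "complex \<Rightarrow> complex \<Rightarrow> complex poly poly \<Rightarrow> complex" where
  "ev2 \<tau> T h = poly (poly h [:T:]) \<tau>"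

interpretation ev2: comm_ring_hom "ev2 \<tau> T"
  by unfold_locales (simp_all add: ev2_def)

lemma comm_ring_hom_poly: "comm_ring_hom (\<lambda>p :: complex poly. poly p \<tau>)"
  by unfold_locales simp_all

lemma ev2_map_poly: "ev2 \<tau> T h = poly (map_poly (\<lambda>p. poly p \<tau>) h) T"
  by (induction h) (simp_all add: ev2_def map_poly_pCons)

lemma ev2_const: "ev2 \<tau> T [:s:] = poly s \<tau>"
  by (simp add: ev2_def)

context forms
begin

text \<open>On the compact unit sphere \<open>F\<close> has no zero, so the quotient is bounded;
  equal degrees of \<open>g\<close> and \<open>F\<close> carry the bound to all vectors.\<close>

lemma homog_bounded_by_F:
  assumes "pf g" "homog d g"
  shows "\<exists>C\<ge>0. \<forall>x. norm (g x) \<le> C * (\<Sum>i\<in>UNIV. norm (F x $ i))"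
proof -
  let ?S = "sphere (0 :: complex^3) 1"
  let ?n = "\<lambda>x. \<Sum>i\<in>UNIV. norm (F x $ i)"
  have contF: "continuous_on ?S ?n"
    by (intro continuous_intros continuous_on_pf pf_F)
  have pos: "?n x > 0" if "x \<in> ?S" for x
  proof -
    have "F x \<noteq> 0" using that zero_F[of x] by auto
    then obtain i where "F x $ i \<noteq> 0" by (auto simp: Finite_Cartesian_Product.vec_eq_iff)
    then show ?thesis by (intro sum_pos2[of _ i]) auto
  qed
  have "continuous_on ?S (\<lambda>x. norm (g x) / ?n x)"
    using pos by (intro continuous_intros contF continuous_on_pf assms(1)) force
  then have "compact ((\<lambda>x. norm (g x) / ?n x) ` ?S)" by (intro compact_continuous_image) auto
  then have "bounded ((\<lambda>x. norm (g x) / ?n x) ` ?S)" by (rule compact_imp_bounded)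
  then obtain C where C: "C > 0" "\<And>x. x \<in> ?S \<Longrightarrow> norm (norm (g x) / ?n x) \<le> C"
    unfolding bounded_pos by auto
  have "norm (g x) \<le> C * ?n x" for x
  proof (cases "x = 0")
    case True
    have "g (0 *s 0) = 0 ^ d * g 0" using assms(2) unfolding homog_def by blast
    then have "g 0 = 0" by (simp add: zero_power[OF d_pos])
    then show ?thesis using True F_0 by simp
  next
    case False
    define a :: complex where "a = of_real (norm x)"
    define y where "y = inverse a *s x"
    have a: "a \<noteq> 0" "norm a = norm x" using False by (simp_all add: a_def)
    have y: "y = (1 / norm x) *\<^sub>R x"
      by (simp add: y_def a_def Finite_Cartesian_Product.vec_eq_iff divide_inverse
        scaleR_conv_of_real[where 'a = complex])
    have yS: "y \<in> ?S" using False by (simp add: y)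
    have x: "x = a *s y" using a by (simp add: y_def)
    have "norm (g y) / ?n y \<le> C"
      using order_trans[OF abs_ge_self C(2)[OF yS, unfolded real_norm_def]] .
    then have "norm (g y) \<le> C * ?n y" using pos[OF yS] by (simp add: pos_divide_le_eq)
    then have "norm a ^ d * norm (g y) \<le> norm a ^ d * (C * ?n y)" by (intro mult_left_mono) auto
    then show ?thesis
      using assms(2) unfolding x homog_def
      by (simp add: F_scale norm_mult norm_power sum_distrib_left mult_ac)
  qed
  with C(1) show ?thesis by (intro exI[of _ C]) auto
qed

text \<open>Over the curve the coefficients, polynomials in \<open>F x\<close>, become polynomials
  in \<tau>. The generators are numbered to serve as matrix indices, and the generator 1 keeps their
  vector of values nonzero.\<close>

lemma finitely_generated_over_curve:
  fixes \<gamma> :: "complex \<Rightarrow> complex^3"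
  assumes "\<And>i. \<exists>p. \<forall>t. \<gamma> t $ i = poly p t"
  obtains N :: nat and e where "\<And>k. k < N \<Longrightarrow> pf (e k)" "\<exists>k<N. e k = (\<lambda>x. 1)"
    "\<And>u. pf u \<Longrightarrow> \<exists>q. \<forall>x \<tau>. F x = \<gamma> \<tau> \<longrightarrow> u x = (\<Sum>k<N. poly (q k) \<tau> * e k x)"
proof -
  obtain E where E: "finite E" "\<And>e. e \<in> E \<Longrightarrow> pf e" "(\<lambda>x. 1) \<in> E"
    "\<And>u. pf u \<Longrightarrow> \<exists>h. (\<forall>e\<in>E. pf (h e)) \<and> (\<forall>x. u x = (\<Sum>e\<in>E. h e (F x) * e x))"
    using finitely_generated by blast
  obtain \<phi> where \<phi>: "bij_betw \<phi> {..<card E} E"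
    using ex_bij_betw_nat_finite[OF E(1)] by (auto simp: atLeast0LessThan)
  show ?thesis
  proof (rule that[of "card E" \<phi>])
    show "pf (\<phi> k)" if "k < card E" for k
      using that \<phi> E(2) by (auto dest: bij_betwE)
    obtain k where k: "(\<lambda>x. 1) = \<phi> k" "k \<in> {..<card E}"
      using bij_betw_imp_surj_on[OF \<phi>] E(3) by blast
    then show "\<exists>k<card E. \<phi> k = (\<lambda>x. 1)"
      by (intro exI[of _ k] conjI) (simp_all only: lessThan_iff)
    fix u assume "pf u"
    then obtain h where h: "\<And>e. e \<in> E \<Longrightarrow> pf (h e)" "\<And>x. u x = (\<Sum>e\<in>E. h e (F x) * e x)"
      using E(4) by blast
    have "\<forall>e. \<exists>p. e \<in> E \<longrightarrow> (\<forall>t. h e (\<gamma> t) = poly p t)"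
      using pf_along_polynomial_curve[OF h(1) assms] by blast
    from choice[OF this] obtain p where p: "\<And>e t. e \<in> E \<Longrightarrow> h e (\<gamma> t) = poly (p e) t" by blast
    have "u x = (\<Sum>k<card E. poly (p (\<phi> k)) \<tau> * \<phi> k x)" if "F x = \<gamma> \<tau>" for x \<tau>
    proof -
      have "u x = (\<Sum>e\<in>E. poly (p e) \<tau> * e x)" using h(2) p that by simp
      also have "\<dots> = (\<Sum>k<card E. poly (p (\<phi> k)) \<tau> * \<phi> k x)"
        by (rule sum.reindex_bij_betw[OF \<phi>, symmetric])
      finally show ?thesis .
    qed
    then show "\<exists>q. \<forall>x \<tau>. F x = \<gamma> \<tau> \<longrightarrow> u x = (\<Sum>k<card E. poly (q k) \<tau> * \<phi> k x)"
      by (intro exI[of _ "\<lambda>k. p (\<phi> k)"] allI impI)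
  qed
qed

end

locale forms_curve = forms +
  fixes \<gamma> :: "complex \<Rightarrow> complex^3" and cp :: "3 \<Rightarrow> complex poly" and g :: "complex^3 \<Rightarrow> complex"
  assumes curve: "\<And>i t. \<gamma> t $ i = poly (cp i) t"
    and pf_g: "pf g"
begin

text \<open>The factor \<open>s\<close> allows a relation to fail over finitely many \<open>\<tau>\<close>. This makes the ideal of relations
  saturated, hence principal.\<close>

definition rels :: "complex poly poly set" where
  "rels = {h. \<exists>s. s \<noteq> 0 \<and> (\<forall>x \<tau>. F x = \<gamma> \<tau> \<longrightarrow> poly s \<tau> * ev2 \<tau> (g x) h = 0)}"

lemma relsI: "(\<And>x \<tau>. F x = \<gamma> \<tau> \<Longrightarrow> ev2 \<tau> (g x) h = 0) \<Longrightarrow> h \<in> rels"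
  unfolding rels_def by (intro CollectI exI[of _ 1]) simp

lemma rels_mult: "h \<in> rels \<Longrightarrow> k * h \<in> rels"
  unfolding rels_def by (auto simp: ev2.hom_mult)

lemma rels_diff:
  assumes "h \<in> rels" "h' \<in> rels"
  shows "h - h' \<in> rels"
proof -
  obtain s s' where s: "s \<noteq> 0" "\<And>x \<tau>. F x = \<gamma> \<tau> \<Longrightarrow> poly s \<tau> * ev2 \<tau> (g x) h = 0"
    "s' \<noteq> 0" "\<And>x \<tau>. F x = \<gamma> \<tau> \<Longrightarrow> poly s' \<tau> * ev2 \<tau> (g x) h' = 0"
    using assms unfolding rels_def by blast
  have "poly (s * s') \<tau> * ev2 \<tau> (g x) (h - h') = 0" if "F x = \<gamma> \<tau>" for x \<tau>
    using s(2,4)[OF that] by (auto simp: ev2.hom_minus)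
  with s(1,3) show ?thesis unfolding rels_def by (intro CollectI exI[of _ "s * s'"]) auto
qed

lemma rels_saturated:
  assumes "[:a:] * h \<in> rels" "a \<noteq> 0"
  shows "h \<in> rels"
proof -
  obtain s where s: "s \<noteq> 0" "\<And>x \<tau>. F x = \<gamma> \<tau> \<Longrightarrow> poly s \<tau> * ev2 \<tau> (g x) ([:a:] * h) = 0"
    using assms unfolding rels_def by blast
  have "poly (s * a) \<tau> * ev2 \<tau> (g x) h = 0" if "F x = \<gamma> \<tau>" for x \<tau>
    using s(2)[OF that] by (simp only: ev2.hom_mult ev2_const poly_mult) (simp add: mult.assoc)
  with s(1) assms(2) show ?thesis unfolding rels_def by (intro CollectI exI[of _ "s * a"]) auto
qed

text \<open>By surjectivity every \<tau> has a point over it, so a relation free of \<open>T\<close>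
  must vanish at every \<tau> once multiplied by \<open>s\<close>.\<close>

lemma rels_const:
  assumes "[:a:] \<in> rels"
  shows "a = 0"
proof -
  obtain s where s: "s \<noteq> 0" "\<And>x \<tau>. F x = \<gamma> \<tau> \<Longrightarrow> poly s \<tau> * poly a \<tau> = 0"
    using assms unfolding rels_def mem_Collect_eq ev2_const by (elim exE conjE) simp
  have "poly (s * a) \<tau> = 0" for \<tau>
  proof -
    obtain x where "F x = \<gamma> \<tau>"
      using surjective[of "\<gamma> \<tau>"] F_0 by (cases "\<gamma> \<tau> = 0") auto
    then show ?thesis using s(2) by (simp only: poly_mult)
  qed
  then have "s * a = 0" using poly_all_0_iff_0 by blast
  with s(1) show ?thesis by simp
qed

text \<open>Integrality by the determinant trick: at a point \<open>x\<close> over \<tau> the values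
  of the generators form an eigenvector, with eigenvalue \<open>g x\<close>, of the matrix of
  multiplication by \<open>g\<close>. Its characteristic polynomial is monic.\<close>

lemma monic_relation: "\<exists>h\<in>rels. lead_coeff h = 1"
proof -
  obtain N :: nat and e where e: "\<And>k. k < N \<Longrightarrow> pf (e k)" "\<exists>k<N. e k = (\<lambda>x. 1)"
    "\<And>u. pf u \<Longrightarrow> \<exists>q. \<forall>x \<tau>. F x = \<gamma> \<tau> \<longrightarrow> u x = (\<Sum>k<N. poly (q k) \<tau> * e k x)"
    using finitely_generated_over_curve[of \<gamma>] curve by blast
  have "\<forall>j. \<exists>q. j < N \<longrightarrow> (\<forall>x \<tau>. F x = \<gamma> \<tau> \<longrightarrow> g x * e j x = (\<Sum>k<N. poly (q k) \<tau> * e k x))"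
    using e(3)[OF pf.mult[OF pf_g e(1)]] by blast
  from choice[OF this] obtain q where
    q: "\<And>j x \<tau>. j < N \<Longrightarrow> F x = \<gamma> \<tau> \<Longrightarrow> g x * e j x = (\<Sum>k<N. poly (q j k) \<tau> * e k x)" by blast
  define A where "A = mat N N (\<lambda>(j, k). q j k)"
  have A: "A \<in> carrier_mat N N" by (simp add: A_def)
  have "ev2 \<tau> (g x) (char_poly A) = 0" if "F x = \<gamma> \<tau>" for x \<tau>
  proof -
    let ?A = "map_mat (\<lambda>p. poly p \<tau>) A" and ?v = "vec N (\<lambda>j. e j x)"
    have "?A *\<^sub>v ?v = g x \<cdot>\<^sub>v ?v"
      by (rule eq_vecI) (simp_all add: A_def scalar_prod_def q[OF _ that] atLeast0LessThan)
    moreover have "?v \<noteq> 0\<^sub>v N"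
    proof
      assume "?v = 0\<^sub>v N"
      then have "vec_index ?v k = 0" if "k < N" for k using that by simp
      then have "e k x = 0" if "k < N" for k using that by simp
      moreover obtain k where "k < N" "e k = (\<lambda>x. 1)" using e(2) by blast
      ultimately show False by (metis zero_neq_one)
    qed
    ultimately have "eigenvalue ?A (g x)"
      unfolding eigenvalue_def eigenvector_def by (intro exI[of _ ?v]) (simp add: A_def)
    then have "poly (char_poly ?A) (g x) = 0"
      using eigenvalue_root_char_poly[of ?A N] A by simp
    then show ?thesis by (simp add: comm_ring_hom.char_poly_hom[OF comm_ring_hom_poly A] ev2_map_poly)
  qed
  then have "char_poly A \<in> rels" by (rule relsI)
  moreover have "lead_coeff (char_poly A) = 1" using degree_monic_char_poly[OF A] by simp
  ultimately show ?thesis by blast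
qed

text \<open>Outside the image of \<open>(\<tau>, g)\<close> the Nullstellensatz writes \<open>1\<close> as a combination of
  functions vanishing at \<open>\<tau>\<^sub>0\<close> and at \<open>t\<^sub>0\<close>, and the determinant trick turns this into a relation.\<close>

lemma relation_avoiding:
  assumes "\<And>x. F x = \<gamma> \<tau>\<^sub>0 \<Longrightarrow> g x \<noteq> t\<^sub>0"
  shows "\<exists>h\<in>rels. ev2 \<tau>\<^sub>0 t\<^sub>0 h = 1"
proof -
  obtain N :: nat and e where e: "\<And>k. k < N \<Longrightarrow> pf (e k)" "\<exists>k<N. e k = (\<lambda>x. 1)"
    "\<And>u. pf u \<Longrightarrow> \<exists>q. \<forall>x \<tau>. F x = \<gamma> \<tau> \<longrightarrow> u x = (\<Sum>k<N. poly (q k) \<tau> * e k x)"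
    using finitely_generated_over_curve[of \<gamma>] curve by blast
  have "\<exists>u v. (\<forall>i. pf (\<lambda>x. u x $ i)) \<and> pf v \<and>
      (\<forall>x. 1 = (\<Sum>i\<in>UNIV. u x $ i * (F x - \<gamma> \<tau>\<^sub>0) $ i) + v x * (g x - t\<^sub>0))"
    using assms by (intro weak_nullstellensatz4)
      (auto intro!: pf_diff pf_F pf_g pf.const simp: vector_minus_component)
  then obtain u :: "complex^3 \<Rightarrow> complex^3" and v where u: "\<And>i. pf (\<lambda>x. u x $ i)" and v: "pf v"
    and 1: "\<And>x. 1 = (\<Sum>i\<in>UNIV. u x $ i * (F x - \<gamma> \<tau>\<^sub>0) $ i) + v x * (g x - t\<^sub>0)" by blast
  have "\<forall>ij. \<exists>q. snd ij < N \<longrightarrow>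
      (\<forall>x \<tau>. F x = \<gamma> \<tau> \<longrightarrow> u x $ fst ij * e (snd ij) x = (\<Sum>k<N. poly (q k) \<tau> * e k x))"
    using e(3)[OF pf.mult[OF u e(1)]] by blast
  from choice[OF this] obtain q where
    q: "\<And>i j x \<tau>. j < N \<Longrightarrow> F x = \<gamma> \<tau> \<Longrightarrow> u x $ i * e j x = (\<Sum>k<N. poly (q (i, j) k) \<tau> * e k x)"
    by auto
  have "\<forall>j. \<exists>r. j < N \<longrightarrow> (\<forall>x \<tau>. F x = \<gamma> \<tau> \<longrightarrow> v x * e j x = (\<Sum>k<N. poly (r k) \<tau> * e k x))"
    using e(3)[OF pf.mult[OF v e(1)]] by blast
  from choice[OF this] obtain r where
    r: "\<And>j x \<tau>. j < N \<Longrightarrow> F x = \<gamma> \<tau> \<Longrightarrow> v x * e j x = (\<Sum>k<N. poly (r j k) \<tau> * e k x)" by blast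
  define m where "m j k = (\<Sum>i\<in>UNIV. [:q (i, j) k * (cp i - [:\<gamma> \<tau>\<^sub>0 $ i:]):]) + [:r j k:] * [:[:- t\<^sub>0:], 1:]" for j k
  have ev_m: "ev2 \<tau> T (m j k) =
     (\<Sum>i\<in>UNIV. poly (q (i, j) k) \<tau> * (\<gamma> \<tau> $ i - \<gamma> \<tau>\<^sub>0 $ i)) + poly (r j k) \<tau> * (T - t\<^sub>0)" for \<tau> T j k
    unfolding m_def by (simp add: ev2.hom_add ev2.hom_sum ev2.hom_mult ev2_const curve)
      (simp add: ev2_def algebra_simps)
  define A where "A = mat N N (\<lambda>(j, k). (if j = k then 1 else 0) - m j k)"
  have A: "A \<in> carrier_mat N N" by (simp add: A_def)
  have "ev2 \<tau> (g x) (det A) = 0" if Fx: "F x = \<gamma> \<tau>" for x \<tau>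
  proof -
    let ?A = "map_mat (ev2 \<tau> (g x)) A" and ?v = "vec N (\<lambda>j. e j x)"
    have sys: "e j x = (\<Sum>k<N. ev2 \<tau> (g x) (m j k) * e k x)" if j: "j < N" for j
    proof -
      have "e j x = ((\<Sum>i\<in>UNIV. u x $ i * (F x - \<gamma> \<tau>\<^sub>0) $ i) + v x * (g x - t\<^sub>0)) * e j x"
        using 1[of x] by simp
      also have "\<dots> = (\<Sum>i\<in>UNIV. (u x $ i * e j x) * (\<gamma> \<tau> $ i - \<gamma> \<tau>\<^sub>0 $ i)) + (v x * e j x) * (g x - t\<^sub>0)"
        unfolding Fx distrib_right sum_distrib_right vector_minus_component by (simp add: mult_ac)
      also have "\<dots> = (\<Sum>i\<in>UNIV. \<Sum>k<N. poly (q (i, j) k) \<tau> * (\<gamma> \<tau> $ i - \<gamma> \<tau>\<^sub>0 $ i) * e k x)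
          + (\<Sum>k<N. poly (r j k) \<tau> * (g x - t\<^sub>0) * e k x)"
        unfolding q[OF j Fx] r[OF j Fx] sum_distrib_right by (simp add: mult_ac)
      also have "\<dots> = (\<Sum>k<N. ev2 \<tau> (g x) (m j k) * e k x)"
        by (subst sum.swap) (simp add: ev_m distrib_right sum.distrib sum_distrib_right)
      finally show ?thesis .
    qed
    have "?A *\<^sub>v ?v = 0\<^sub>v N"
    proof (rule eq_vecI)
      fix j assume "j < dim_vec (0\<^sub>v N :: complex vec)"
      then have j: "j < N" by simp
      have "vec_index (?A *\<^sub>v ?v) j = (\<Sum>k<N. ev2 \<tau> (g x) ((if j = k then 1 else 0) - m j k) * e k x)"
        using j by (simp add: A_def scalar_prod_def atLeast0LessThan)
      also have "\<dots> = (\<Sum>k<N. (if j = k then e j x else 0) - ev2 \<tau> (g x) (m j k) * e k x)"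
        by (rule sum.cong) (auto simp: ev2.hom_minus left_diff_distrib)
      also have "\<dots> = 0" using j sys[OF j] by (simp add: sum_subtractf)
      finally show "vec_index (?A *\<^sub>v ?v) j = vec_index (0\<^sub>v N) j" using j by simp
    qed (simp add: A_def)
    moreover have "?v \<noteq> 0\<^sub>v N"
    proof
      assume "?v = 0\<^sub>v N"
      then have "vec_index ?v k = 0" if "k < N" for k using that by simp
      then have "e k x = 0" if "k < N" for k using that by simp
      moreover obtain k where "k < N" "e k = (\<lambda>x. 1)" using e(2) by blast
      ultimately show False by (metis zero_neq_one)
    qed
    ultimately have "det ?A = 0"
      using det_0_iff_vec_prod_zero[of ?A N] A by (auto intro!: exI[of _ ?v])
    then show ?thesis by simp
  qed
  then have "det A \<in> rels" by (rule relsI)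
  moreover have "ev2 \<tau>\<^sub>0 t\<^sub>0 (det A) = 1"
  proof -
    have "map_mat (ev2 \<tau>\<^sub>0 t\<^sub>0) A = 1\<^sub>m N"
      by (rule eq_matI) (auto simp: A_def ev2.hom_minus ev_m)
    then have "det (map_mat (ev2 \<tau>\<^sub>0 t\<^sub>0) A) = 1" by simp
    then show ?thesis by simp
  qed
  ultimately show ?thesis by blast
qed

text \<open>A primitive relation of least degree divides all others by Gauss's lemma. Since it
  divides the monic one, its leading coefficient is a unit of \<complex>[\<tau>]; hence its degree
  in \<open>T\<close> drops at no \<tau>.\<close>

lemma generator:
  obtains P c where "degree P > 0" "lead_coeff P = [:c:]" "c \<noteq> 0" "\<forall>h\<in>rels. P dvd h"
proof -
  obtain H where H: "H \<in> rels" "lead_coeff H = 1" using monic_relation by blast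
  then have "H \<in> rels \<and> H \<noteq> 0" by auto
  from ex_has_least_nat[of "\<lambda>h. h \<in> rels \<and> h \<noteq> 0", OF this, of degree]
  obtain P0 where P0: "P0 \<in> rels" "P0 \<noteq> 0"
    and min: "\<And>h. h \<in> rels \<Longrightarrow> h \<noteq> 0 \<Longrightarrow> degree P0 \<le> degree h" by blast
  define P where "P = primitive_part P0"
  have eq: "P0 = [:content P0:] * P" unfolding P_def by simp
  have P: "P \<in> rels" using P0(1) rels_saturated[of "content P0" P] P0(2) eq by simp
  have Pnz: "P \<noteq> 0" using P0(2) eq by auto
  have content: "content P = 1" unfolding P_def using P0(2) by simp
  have deg: "degree P = degree P0" unfolding P_def by simp
  have dvd: "P dvd h" if h: "h \<in> rels" for h
  proof -
    \<comment> \<open>Pseudo-division stands in for division with remainder over the ring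
      \<complex>[\<tau>]. The factor it introduces is removed over the field of fractions, and
      primitivity brings the divisibility back.\<close>
    obtain q r where qr: "pseudo_divmod h P = (q, r)" by force
    let ?a = "lead_coeff P ^ (Suc (degree h) - degree P)"
    have a: "?a \<noteq> 0" using Pnz by simp
    have pd: "[:?a:] * h = P * q + r" "r = 0 \<or> degree r < degree P"
      using pseudo_divmod[OF Pnz qr] by simp_all
    have "r = [:?a:] * h - q * P" using pd(1) by (simp add: mult.commute)
    then have "r \<in> rels" using rels_diff[OF rels_mult[OF h] rels_mult[OF P]] by (simp only:)
    then have "r = 0" using pd(2) min[of r] unfolding deg by linarith
    then have "fract_poly ([:?a:] * h) = fract_poly P * fract_poly q" using pd(1) by simp
    then have "Polynomial.smult (to_fract ?a) (fract_poly h) = fract_poly P * fract_poly q" by simp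
    then have "fract_poly P dvd Polynomial.smult (to_fract ?a) (fract_poly h)" by (rule dvdI)
    then have "fract_poly P dvd fract_poly h" by (rule dvd_smult_cancel) (use a in simp)
    then show ?thesis using content by (rule fract_poly_dvdD)
  qed
  then obtain Q where Q: "H = P * Q" using H(1) by blast
  then have "1 = lead_coeff P * lead_coeff Q" using H(2) by (simp only: lead_coeff_mult)
  then have "lead_coeff P dvd 1" by (rule dvdI)
  then obtain c where c: "lead_coeff P = [:c:]" "c dvd 1" unfolding is_unit_poly_iff by blast
  have "degree P > 0"
  proof (rule ccontr)
    assume "\<not> degree P > 0"
    then have "degree P = 0" by simp
    then obtain a where "P = [:a:]" by (rule degree_eq_zeroE)
    then show False using P Pnz rels_const by auto
  qed
  then show ?thesis using c dvd by (intro that[of P c]) auto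
qed

end

section \<open>The trace\<close>

text \<open>The sum of the roots of the generator plays the role of the trace of \<open>g\<close>: it is a
  polynomial in \<open>\<tau>\<close> whose degree is controlled by the growth of \<open>g\<close>, and over \<open>\<tau>\<close> with a single
  value of \<open>g\<close> on the fibre it is a multiple of that value.\<close>

lemma (in forms_curve) trace:
  assumes "homog d g" "\<And>i. degree (cp i) \<le> k"
  obtains r t where "r > 0" "degree t \<le> k"
    "\<forall>\<tau> v. (\<forall>x. F x = \<gamma> \<tau> \<longrightarrow> g x = v) \<longrightarrow> poly t \<tau> = of_nat r * v"
proof -
  obtain P c where P: "degree P > 0" "lead_coeff P = [:c:]" "c \<noteq> 0" "\<forall>h\<in>rels. P dvd h"
    by (rule generator)
  \<comment> \<open>A root that is not a value of \<open>g\<close> on the fibre would be avoided by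
    some relation, equal to 1 there, although every relation is a multiple of
    \<open>P\<close>.\<close>
  have roots: "\<exists>x. F x = \<gamma> \<tau> \<and> g x = z" if "ev2 \<tau> z P = 0" for \<tau> z
  proof (rule ccontr)
    assume "\<nexists>x. F x = \<gamma> \<tau> \<and> g x = z"
    then obtain h where h: "h \<in> rels" "ev2 \<tau> z h = 1" using relation_avoiding[of \<tau> z] by blast
    from bspec[OF P(4) h(1)] obtain Q where "h = P * Q" by (rule dvdE)
    then show False using h(2) that by (simp add: ev2.hom_mult)
  qed
  define r where "r = degree P"
  \<comment> \<open>By Vieta this is the sum of the roots; dividing by the leading coefficient keeps
    it a polynomial because that coefficient is the constant \<open>c\<close>.\<close>
  define t where "t = Polynomial.smult (- 1 / c) (coeff P (r - 1))"
  have sum: "\<exists>as. length as = r \<and> (\<forall>a\<in>set as. \<exists>x. F x = \<gamma> \<tau> \<and> g x = a) \<and> poly t \<tau> = sum_list as" for \<tau>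
  proof -
    let ?p = "map_poly (\<lambda>p. poly p \<tau>) P"
    have c: "coeff ?p n = poly (coeff P n) \<tau>" for n by (simp add: coeff_map_poly)
    have "coeff ?p r = c" using P(2) by (simp add: c r_def)
    moreover have "degree ?p \<le> r" unfolding r_def by (rule degree_map_poly_le)
    ultimately have deg: "degree ?p = r" using P(3) by (metis le_antisym le_degree)
    then obtain as where as: "length as = r" "\<forall>a\<in>set as. poly ?p a = 0"
      "coeff ?p (r - 1) = - lead_coeff ?p * sum_list as"
      using sum_of_roots[of ?p] P(1) unfolding r_def by auto
    have "poly t \<tau> = sum_list as"
      using as(3) \<open>coeff ?p r = c\<close> P(3) by (simp add: t_def c deg field_simps)
    moreover have "\<forall>a\<in>set as. \<exists>x. F x = \<gamma> \<tau> \<and> g x = a"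
      using as(2) roots unfolding ev2_map_poly by blast
    ultimately show ?thesis using as(1) by blast
  qed
  obtain C where C: "C \<ge> 0" "\<And>x. norm (g x) \<le> C * (\<Sum>i\<in>UNIV. norm (F x $ i))"
    using homog_bounded_by_F[OF pf_g assms(1)] by blast
  have bound: "norm (poly t \<tau>) \<le> (of_nat r * C) * (\<Sum>i\<in>UNIV. norm (poly (cp i) \<tau>))" for \<tau>
  proof -
    obtain as where as: "length as = r" "\<forall>a\<in>set as. \<exists>x. F x = \<gamma> \<tau> \<and> g x = a" "poly t \<tau> = sum_list as"
      using sum by blast
    let ?B = "C * (\<Sum>i\<in>UNIV. norm (poly (cp i) \<tau>))"
    have "norm a \<le> ?B" if "a \<in> set as" for a
    proof -
      obtain x where "F x = \<gamma> \<tau>" "g x = a" using as(2) \<open>a \<in> set as\<close> by blast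
      then show ?thesis using C(2)[of x] by (simp add: curve)
    qed
    then have "norm (sum_list as) \<le> of_nat (length as) * ?B"
    proof (induction as)
      case (Cons a as)
      then have "norm a \<le> ?B" "norm (sum_list as) \<le> of_nat (length as) * ?B" by auto
      then show ?case using norm_triangle_ineq[of a "sum_list as"] by (simp add: algebra_simps)
    qed simp
    then show ?thesis using as by (simp add: mult.assoc)
  qed
  show ?thesis
  proof (rule that[of r t])
    show "r > 0" using P(1) by (simp add: r_def)
    show "degree t \<le> k" by (rule degree_le_of_growth[OF _ bound]) (rule assms(2))
    show "\<forall>\<tau> v. (\<forall>x. F x = \<gamma> \<tau> \<longrightarrow> g x = v) \<longrightarrow> poly t \<tau> = of_nat r * v"
    proof (intro allI impI)
      fix \<tau> v assume v: "\<forall>x. F x = \<gamma> \<tau> \<longrightarrow> g x = v"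
      obtain as where as: "length as = r" "\<forall>a\<in>set as. \<exists>x. F x = \<gamma> \<tau> \<and> g x = a" "poly t \<tau> = sum_list as"
        using sum by blast
      have "\<forall>a\<in>set as. a = v"
      proof
        fix a assume "a \<in> set as"
        then obtain x where "F x = \<gamma> \<tau>" "g x = a" using as(2) by blast
        then show "a = v" using v by auto
    qed
      then have "sum_list as = of_nat (length as) * v" by (induction as) (auto simp: algebra_simps)
      then show "poly t \<tau> = of_nat r * v" using as by simp
    qed
  qed
qed

section \<open>Linear relations between completely ramified points\<close>

text \<open>\<open>q\<close> represents the only point over the point represented by \<open>F q\<close>.\<close>

definition ram :: "(complex^3 \<Rightarrow> complex^3) \<Rightarrow> complex^3 \<Rightarrow> bool" where
  "ram F q \<longleftrightarrow> q \<noteq> 0 \<and> (\<forall>x c. c \<noteq> 0 \<longrightarrow> F x = c *s F q \<longrightarrow> (\<exists>w. x = w *s q))"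

lemma poly_of_degree_le:
  assumes "degree (t :: complex poly) \<le> n"
  shows "poly t x = (\<Sum>i\<le>n. coeff t i * x ^ i)"
  using arg_cong[OF poly_as_sum_of_monoms'[OF assms], of "\<lambda>p. poly p x"]
  by (simp add: poly_sum poly_monom)

text \<open>Lagrange interpolation at 2 from the nodes 0 and 1, and in
  \<open>degree_2_values\<close> from 0, 1 and -1. All weights are nonzero, so rescaling the points
  can match any relation with nonzero coefficients.\<close>

lemma degree_1_values:
  assumes "degree (t :: complex poly) \<le> 1"
  shows "poly t 2 = - poly t 0 + 2 * poly t 1"
  by (simp add: poly_of_degree_le[OF assms])

lemma degree_2_values:
  assumes "degree (t :: complex poly) \<le> 2"
  shows "poly t 2 = - 3 * poly t 0 + 3 * poly t 1 + poly t (- 1)"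
  by (simp add: poly_of_degree_le[OF assms] numeral_2_eq_2)

context forms
begin

lemma ram_nonzero: "ram F q \<Longrightarrow> F q \<noteq> 0"
  using zero_F by (auto simp: ram_def)

lemma ram_scale:
  assumes "ram F q" "w \<noteq> 0"
  shows "ram F (w *s q)"
  unfolding ram_def
proof (intro conjI allI impI)
  show "w *s q \<noteq> 0" using assms by (simp add: ram_def vector_mul_eq_0)
  fix x c assume "c \<noteq> 0" "F x = c *s F (w *s q)"
  then have "F x = (c * w ^ d) *s F q" "c * w ^ d \<noteq> 0" using assms(2) by (simp_all add: F_scale)
  then obtain v where "x = v *s q" using assms(1) unfolding ram_def by blast
  then have "x = (v / w) *s (w *s q)" using assms(2) by simp
  then show "\<exists>v. x = v *s (w *s q)" ..
qed

text \<open>The fibre consists of multiples w q with w^d = 1, and a form of degree exactly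
  \<open>d\<close> does not see such factors.\<close>

lemma ram_fibre_value:
  assumes "ram F q" "homog d g" "F x = F q"
  shows "g x = g q"
proof -
  have "F x = 1 *s F q" using assms(3) by simp
  then obtain w where x: "x = w *s q" using assms(1) unfolding ram_def by (metis zero_neq_one)
  then have "w ^ d *s F q = F q" using assms(3) by (simp add: F_scale)
  then have "(w ^ d - 1) *s F q = 0" by (simp add: vector_sub_rdistrib)
  then have "w ^ d - 1 = 0" using ram_nonzero[OF assms(1)] unfolding vector_mul_eq_0 by blast
  then have "w ^ d = 1" by simp
  then show ?thesis using assms(2) by (simp add: x homog_def)
qed

text \<open>After rescaling, the three images lie at the parameters 0, 1, 2 of an affine line. The
  trace along it has degree at most 1, so the values of \<open>g\<close> satisfy the same
  interpolation relation.\<close>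

lemma relation3:
  assumes "pf g" "homog d g" "ram F q1" "ram F q2" "ram F q3" "a1 \<noteq> 0" "a2 \<noteq> 0" "a3 \<noteq> 0"
    and rel: "a1 *s F q1 + a2 *s F q2 + a3 *s F q3 = 0"
  shows "a1 * g q1 + a2 * g q2 + a3 * g q3 = 0"
proof -
  \<comment> \<open>Chosen so that F q3 = - F (w1 q1) + 2 F (w2 q2), with the weights of
    \<open>degree_1_values\<close>.\<close>
  obtain w1 where w1: "w1 ^ d = a1 / a3" using complex_root_exists[OF d_pos] ..
  obtain w2 where w2: "w2 ^ d = - a2 / (2 * a3)" using complex_root_exists[OF d_pos] ..
  note w = w1 w2
  have w0: "w1 \<noteq> 0" "w2 \<noteq> 0" using w assms(6-8) d_pos by (auto simp: zero_power)
  let ?q1 = "w1 *s q1" and ?q2 = "w2 *s q2"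
  let ?cp = "\<lambda>i. [:F ?q1 $ i, F ?q2 $ i - F ?q1 $ i:]"
  let ?\<gamma> = "\<lambda>\<tau>. \<chi> i. poly (?cp i) \<tau>"
  interpret forms_curve F d ?\<gamma> ?cp g
    by unfold_locales (simp_all only: vec_lambda_beta assms(1))
  obtain r t where t: "r > 0" "degree t \<le> 1"
    "\<forall>\<tau> v. (\<forall>x. F x = ?\<gamma> \<tau> \<longrightarrow> g x = v) \<longrightarrow> poly t \<tau> = of_nat r * v"
  proof (rule trace[OF assms(2), of 1])
    show "degree (?cp i) \<le> 1" for i by simp
  qed
  have val: "poly t \<tau> = of_nat r * g q" if "ram F q" "?\<gamma> \<tau> = F q" for q \<tau>
    by (rule t(3)[rule_format], rule ram_fibre_value[OF that(1) assms(2)]) (simp only: that(2))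
  have v0: "poly t 0 = of_nat r * g ?q1" by (rule val[OF ram_scale[OF assms(3) w0(1)]]) (simp add: Finite_Cartesian_Product.vec_eq_iff field_simps)
  have v1: "poly t 1 = of_nat r * g ?q2" by (rule val[OF ram_scale[OF assms(4) w0(2)]]) (simp add: Finite_Cartesian_Product.vec_eq_iff field_simps)
  have "?\<gamma> 2 $ i = F q3 $ i" for i
  proof -
    have "a1 * F q1 $ i + a2 * F q2 $ i + a3 * F q3 $ i = 0"
      using arg_cong[OF rel, of "\<lambda>v. v $ i"] by simp
    then have "a3 * F q3 $ i = - (a1 * F q1 $ i + a2 * F q2 $ i)"
      by (intro eq_neg_iff_add_eq_0[THEN iffD2]) (simp add: add_ac)
    then have "F q3 $ i = - (a1 / a3) * F q1 $ i - (a2 / a3) * F q2 $ i"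
      using assms(8) by (simp add: field_simps)
    then show ?thesis by (simp add: F_scale w field_simps)
  qed
  then have v2: "poly t 2 = of_nat r * g q3"
    by (intro val assms(5)) (simp add: Finite_Cartesian_Product.vec_eq_iff)
  have "of_nat r * g q3 = of_nat r * (- g ?q1 + 2 * g ?q2)"
    using degree_1_values[OF t(2)] unfolding v0 v1 v2 by (simp add: algebra_simps)
  then have "g q3 = - g ?q1 + 2 * g ?q2" using t(1) by (simp only: mult_cancel_left of_nat_eq_0_iff) simp
  also have "\<dots> = - (a1 / a3) * g q1 - (a2 / a3) * g q2"
    using assms(2) by (simp add: homog_def w)
  finally show ?thesis using assms(8) by (simp add: field_simps)
qed

text \<open>The same argument on a parametrized quadratic curve with the four images at 0, 1, -1,
  2.\<close>

lemma relation4: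
  assumes "pf g" "homog d g" "ram F q1" "ram F q2" "ram F q3" "ram F q4"
    and nz: "a1 \<noteq> 0" "a2 \<noteq> 0" "a3 \<noteq> 0" "a4 \<noteq> 0"
    and rel: "a1 *s F q1 + a2 *s F q2 + a3 *s F q3 + a4 *s F q4 = 0"
  shows "a1 * g q1 + a2 * g q2 + a3 * g q3 + a4 * g q4 = 0"
proof -
  \<comment> \<open>Chosen to match the weights -3, 3, 1 of \<open>degree_2_values\<close>.\<close>
  obtain w1 where w1: "w1 ^ d = a1 / (3 * a4)" using complex_root_exists[OF d_pos] ..
  obtain w2 where w2: "w2 ^ d = - a2 / (3 * a4)" using complex_root_exists[OF d_pos] ..
  obtain w3 where w3: "w3 ^ d = - a3 / a4" using complex_root_exists[OF d_pos] ..
  note w = w1 w2 w3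
  have w0: "w1 \<noteq> 0" "w2 \<noteq> 0" "w3 \<noteq> 0" using w nz d_pos by (auto simp: zero_power)
  let ?q1 = "w1 *s q1" and ?q2 = "w2 *s q2" and ?q3 = "w3 *s q3"
  \<comment> \<open>The quadratic interpolation of F ?q1, F ?q2, F ?q3 at 0, 1, -1.\<close>
  let ?cp = "\<lambda>i. [:F ?q1 $ i, (F ?q2 $ i - F ?q3 $ i) / 2, (F ?q2 $ i + F ?q3 $ i) / 2 - F ?q1 $ i:]"
  let ?\<gamma> = "\<lambda>\<tau>. \<chi> i. poly (?cp i) \<tau>"
  interpret forms_curve F d ?\<gamma> ?cp g
    by unfold_locales (simp_all only: vec_lambda_beta assms(1))
  obtain r t where t: "r > 0" "degree t \<le> 2"
    "\<forall>\<tau> v. (\<forall>x. F x = ?\<gamma> \<tau> \<longrightarrow> g x = v) \<longrightarrow> poly t \<tau> = of_nat r * v"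
  proof (rule trace[OF assms(2), of 2])
    show "degree (?cp i) \<le> 2" for i by simp
  qed
  have val: "poly t \<tau> = of_nat r * g q" if "ram F q" "?\<gamma> \<tau> = F q" for q \<tau>
    by (rule t(3)[rule_format], rule ram_fibre_value[OF that(1) assms(2)]) (simp only: that(2))
  have v0: "poly t 0 = of_nat r * g ?q1" by (rule val[OF ram_scale[OF assms(3) w0(1)]]) (simp add: Finite_Cartesian_Product.vec_eq_iff field_simps)
  have v1: "poly t 1 = of_nat r * g ?q2" by (rule val[OF ram_scale[OF assms(4) w0(2)]]) (simp add: Finite_Cartesian_Product.vec_eq_iff field_simps)
  have v2: "poly t (- 1) = of_nat r * g ?q3" by (rule val[OF ram_scale[OF assms(5) w0(3)]]) (simp add: Finite_Cartesian_Product.vec_eq_iff field_simps)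
  have "?\<gamma> 2 $ i = F q4 $ i" for i
  proof -
    have "a1 * F q1 $ i + a2 * F q2 $ i + a3 * F q3 $ i + a4 * F q4 $ i = 0"
      using arg_cong[OF rel, of "\<lambda>v. v $ i"] by simp
    then have "a4 * F q4 $ i = - (a1 * F q1 $ i + a2 * F q2 $ i + a3 * F q3 $ i)"
      by (intro eq_neg_iff_add_eq_0[THEN iffD2]) (simp add: add_ac)
    then have "F q4 $ i = - (a1 / a4) * F q1 $ i - (a2 / a4) * F q2 $ i - (a3 / a4) * F q3 $ i"
      using nz(4) by (simp add: field_simps)
    moreover have "?\<gamma> 2 $ i = - 3 * F ?q1 $ i + 3 * F ?q2 $ i + F ?q3 $ i" by (simp add: field_simps)
    ultimately show ?thesis by (simp add: F_scale w)
  qed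
  then have v3: "poly t 2 = of_nat r * g q4"
    by (intro val assms(6)) (simp add: Finite_Cartesian_Product.vec_eq_iff)
  have "of_nat r * g q4 = of_nat r * (- 3 * g ?q1 + 3 * g ?q2 + g ?q3)"
    using degree_2_values[OF t(2)] unfolding v0 v1 v2 v3 by (simp add: algebra_simps)
  then have "g q4 = - 3 * g ?q1 + 3 * g ?q2 + g ?q3"
    using t(1) by (simp only: mult_cancel_left of_nat_eq_0_iff) simp
  also have "\<dots> = - (a1 / a4) * g q1 - (a2 / a4) * g q2 - (a3 / a4) * g q3"
    using assms(2) by (simp add: homog_def w)
  finally show ?thesis using nz(4) by (simp add: field_simps)
qed

end

section \<open>Separating points by linear forms\<close>

lemma linear_form_nonzero:
  assumes "q \<noteq> 0"
  shows "\<exists>l. pf l \<and> homog 1 l \<and> l q \<noteq> 0"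
proof -
  obtain i where "q $ i \<noteq> 0" using assms by (auto simp: Finite_Cartesian_Product.vec_eq_iff)
  then show ?thesis by (intro exI[of _ "\<lambda>x. x $ i"] conjI pf.coord homog_coord)
qed

lemma linear_form_separates:
  assumes "q' \<noteq> 0" "\<And>w. q \<noteq> w *s q'"
  shows "\<exists>l. pf l \<and> homog 1 l \<and> l q' = 0 \<and> l q \<noteq> 0"
proof -
  obtain i where i: "q' $ i \<noteq> 0" using assms(1) by (auto simp: Finite_Cartesian_Product.vec_eq_iff)
  have "\<exists>j. q' $ i * q $ j \<noteq> q' $ j * q $ i"
  proof (rule ccontr)
    assume "\<nexists>j. q' $ i * q $ j \<noteq> q' $ j * q $ i"
    then have *: "q' $ i * q $ j = q' $ j * q $ i" for j by blast
    have eq: "q $ j = ((q $ i / q' $ i) *s q') $ j" for j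
    proof -
      have "q $ j = (q' $ i * q $ j) / q' $ i" using i by simp
      also have "\<dots> = (q' $ j * q $ i) / q' $ i" by (simp only: *)
      finally show ?thesis by simp
    qed
    have "q = (q $ i / q' $ i) *s q'" unfolding Finite_Cartesian_Product.vec_eq_iff using eq by blast
    then show False using assms(2) by blast
  qed
  then obtain j where j: "q' $ i * q $ j \<noteq> q' $ j * q $ i" by blast
  let ?l = "\<lambda>x. q' $ i * x $ j - q' $ j * x $ i"
  have "pf ?l" by (intro pf_intros)
  moreover have "homog 1 ?l" by (intro homog_diff homog_scale homog_coord)
  moreover have "?l q' = 0" by simp
  moreover have "?l q \<noteq> 0" using j by simp
  ultimately show ?thesis by (intro exI[of _ ?l] conjI)
qed

definition indep :: "complex^3 \<Rightarrow> complex^3 \<Rightarrow> bool" where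
  "indep p q \<longleftrightarrow> p \<noteq> 0 \<and> q \<noteq> 0 \<and> (\<forall>w. p \<noteq> w *s q)"

lemma indep_sym:
  assumes "indep p q"
  shows "indep q p"
proof -
  have "q \<noteq> w *s p" for w
  proof
    assume q: "q = w *s p"
    then have "w \<noteq> 0" using assms by (auto simp: indep_def)
    then have "p = (1 / w) *s q" by (simp add: q)
    then show False using assms by (simp add: indep_def)
  qed
  then show ?thesis using assms by (simp add: indep_def)
qed

lemma indep_separates:
  assumes "indep q q'"
  shows "\<exists>l. pf l \<and> homog 1 l \<and> l q' = 0 \<and> l q \<noteq> 0"
proof (rule linear_form_separates)
  show "q' \<noteq> 0" using assms by (simp add: indep_def)
  show "q \<noteq> w *s q'" for w using assms by (simp add: indep_def)
qed

context forms
begin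

text \<open>Proportional images would put \<open>q1\<close> over the same projective point as
  \<open>q2\<close>, whose fibre contains only the multiples of \<open>q2\<close>.\<close>

lemma ram_pair_independent:
  assumes "ram F q1" "ram F q2" "indep q1 q2" "a1 *s F q1 + a2 *s F q2 = 0"
  shows "a1 = 0 \<and> a2 = 0"
proof (rule ccontr)
  assume neg: "\<not> ?thesis"
  have eq: "a1 *s F q1 = (- a2) *s F q2"
  proof -
    have "a1 *s F q1 = - (a2 *s F q2)" using assms(4) by (rule eq_neg_iff_add_eq_0[THEN iffD2])
    also have "\<dots> = (- a2) *s F q2" by (simp add: Finite_Cartesian_Product.vec_eq_iff)
    finally show ?thesis .
  qed
  have a1: "a1 \<noteq> 0"
  proof
    assume "a1 = 0"
    with eq neg have "F q2 = 0" by (simp add: vector_mul_eq_0)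
    then show False using ram_nonzero[OF assms(2)] by simp
  qed
  have F: "F q1 = (- a2 / a1) *s F q2"
    using arg_cong[OF eq, of "\<lambda>v. (1 / a1) *s v"] a1 by simp
  then have "- a2 / a1 \<noteq> 0" using ram_nonzero[OF assms(1)] by auto
  then show False using F assms(2,3) unfolding ram_def indep_def by blast
qed

lemma ram_triple_independent:
  assumes "d \<ge> 2" "ram F q1" "ram F q2" "ram F q3" "indep q1 q2" "indep q1 q3" "indep q2 q3"
    and rel: "a1 *s F q1 + a2 *s F q2 + a3 *s F q3 = 0"
  shows "a1 = 0 \<and> a2 = 0 \<and> a3 = 0"
proof -
  consider "a1 = 0" | "a2 = 0" | "a3 = 0" | "a1 \<noteq> 0 \<and> a2 \<noteq> 0 \<and> a3 \<noteq> 0" by blast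
  then show ?thesis
  proof cases
    case 1
    then show ?thesis using rel ram_pair_independent[OF assms(3,4,7), of a2 a3] by simp
  next
    case 2
    then show ?thesis using rel ram_pair_independent[OF assms(2,4,6), of a1 a3] by simp
  next
    case 3
    then show ?thesis using rel ram_pair_independent[OF assms(2,3,5), of a1 a2] by simp
  next
    case 4
    obtain l1 where l1: "pf l1" "homog 1 l1" "l1 q1 = 0" "l1 q3 \<noteq> 0"
      using indep_separates[OF indep_sym[OF assms(6)]] by blast
    obtain l2 where l2: "pf l2" "homog 1 l2" "l2 q2 = 0" "l2 q3 \<noteq> 0"
      using indep_separates[OF indep_sym[OF assms(7)]] by blast
    obtain l where l: "pf l" "homog 1 l" "l q3 \<noteq> 0"
      using linear_form_nonzero assms(4) unfolding ram_def by blast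
    \<comment> \<open>Vanishes at \<open>q1\<close> and \<open>q2\<close> but not at
      \<open>q3\<close>; the power of \<open>l\<close> fills the degree up to \<open>d\<close>,
      which is where d \<ge> 2 enters.\<close>
    let ?g = "\<lambda>x. l1 x * l2 x * l x ^ (d - 2)"
    have "homog (1 + 1 + 1 * (d - 2)) ?g" by (intro homog_mult homog_power l l1 l2)
    moreover have "1 + 1 + 1 * (d - 2) = d" using assms(1) by simp
    ultimately have hom: "homog d ?g" by (simp only:)
    have pf: "pf ?g" by (intro pf_intros l l1 l2)
    have "a1 * ?g q1 + a2 * ?g q2 + a3 * ?g q3 = 0"
      using 4 by (intro relation3[OF pf hom assms(2-4) _ _ _ rel]) blast+
    then have "a3 * ?g q3 = 0" by (simp only: l1(3) l2(3)) simp
    then show ?thesis using 4 l l1 l2 by simp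
  qed
qed

text \<open>With d \<ge> 3 there is room for three linear factors killing \<open>q1\<close>,
  \<open>q2\<close>, \<open>q3\<close> and leaving \<open>q4\<close>, so the transferred relation
  forces a4 = 0.\<close>

lemma ram_quadruple_high_degree:
  assumes "d \<ge> 3" "ram F q1" "ram F q2" "ram F q3" "ram F q4"
    and "indep q1 q4" "indep q2 q4" "indep q3 q4"
    and nz: "a1 \<noteq> 0" "a2 \<noteq> 0" "a3 \<noteq> 0" "a4 \<noteq> 0"
    and rel: "a1 *s F q1 + a2 *s F q2 + a3 *s F q3 + a4 *s F q4 = 0"
  shows False
proof -
  obtain l1 where l1: "pf l1" "homog 1 l1" "l1 q1 = 0" "l1 q4 \<noteq> 0"
    using indep_separates[OF indep_sym[OF assms(6)]] by blast
  obtain l2 where l2: "pf l2" "homog 1 l2" "l2 q2 = 0" "l2 q4 \<noteq> 0"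
    using indep_separates[OF indep_sym[OF assms(7)]] by blast
  obtain l3 where l3: "pf l3" "homog 1 l3" "l3 q3 = 0" "l3 q4 \<noteq> 0"
    using indep_separates[OF indep_sym[OF assms(8)]] by blast
  obtain l where l: "pf l" "homog 1 l" "l q4 \<noteq> 0"
    using linear_form_nonzero assms(5) unfolding ram_def by blast
  let ?g = "\<lambda>x. l1 x * l2 x * l3 x * l x ^ (d - 3)"
  have "homog (1 + 1 + 1 + 1 * (d - 3)) ?g" by (intro homog_mult homog_power l l1 l2 l3)
  moreover have "1 + 1 + 1 + 1 * (d - 3) = d" using assms(1) by simp
  ultimately have hom: "homog d ?g" by (simp only:)
  have "pf ?g" by (intro pf_intros l l1 l2 l3)
  from relation4[OF this hom assms(2-5) nz rel] have "a4 * ?g q4 = 0"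
    by (simp only: l1(3) l2(3) l3(3)) simp
  then show False using nz l l1 l2 l3 by simp
qed

end

section \<open>Quadratic maps\<close>

text \<open>Expanding u (c x) in powers of \<open>c\<close> produces the homogeneous parts of
  \<open>u\<close>; comparison with c^n u x leaves only the part of degree \<open>n\<close>, or
  nothing if \<open>n\<close> exceeds the degree bound.\<close>

lemma homog_pf_span:
  assumes "pf u" "homog n u"
  shows "u \<in> cspan {mon i j k |i j k. i + j + k = n}"
proof -
  obtain N where "u \<in> deg_le N" using pf_in_deg_le[OF assms(1)] by blast
  then have "\<exists>v. (\<forall>l. v l \<in> cspan {mon i j k |i j k. i + j + k = l}) \<and> (\<forall>c x. u (c *s x) = (\<Sum>l\<le>N. v l x * c ^ l))"
    unfolding deg_le_def
  proof induction
    case zero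
    show ?case by (intro exI[of _ "\<lambda>_ _. 0"]) (simp add: cspan.zero)
  next
    case (step u b a)
    then obtain v where v: "\<And>l. v l \<in> cspan {mon i j k |i j k. i + j + k = l}"
      "\<And>c x. u (c *s x) = (\<Sum>l\<le>N. v l x * c ^ l)" by blast
    from step obtain i j k where b: "b = mon i j k" "i + j + k \<le> N" by blast
    let ?v = "\<lambda>l x. v l x + (if l = i + j + k then a else 0) * mon i j k x"
    have "?v l \<in> cspan {mon i j k |i j k. i + j + k = l}" for l
    proof (cases "l = i + j + k")
      case True
      have "mon i j k \<in> {mon i j k |i j k. i + j + k = l}" unfolding True by blast
      then show ?thesis by (rule cspan.step[OF v(1)])
    next
      case False
      then show ?thesis using v(1)[of l] by simp
    qed
    moreover have "u (c *s x) + a * b (c *s x) = (\<Sum>l\<le>N. ?v l x * c ^ l)" for c x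
    proof -
      have "(\<Sum>l\<le>N. (if l = i + j + k then a else 0) * mon i j k x * c ^ l)
        = (\<Sum>l\<le>N. if l = i + j + k then a * mon i j k x * c ^ (i + j + k) else 0)"
        by (rule sum.cong) auto
      also have "\<dots> = a * b (c *s x)" using b(2) by (simp add: b(1) mon_scale mult_ac)
      finally show ?thesis by (simp only: v(2) distrib_right sum.distrib)
    qed
    ultimately show ?case by (intro exI[of _ ?v] conjI allI)
  qed
  then obtain v where v: "\<And>l. v l \<in> cspan {mon i j k |i j k. i + j + k = l}"
    "\<And>c x. u (c *s x) = (\<Sum>l\<le>N. v l x * c ^ l)" by blast
  show ?thesis
  proof (cases "n \<le> N")
    case True
    have "u x = v n x" for x
    proof -
      have "(\<Sum>l\<le>N. (v l x - (if l = n then u x else 0)) * c ^ l) = 0" for c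
      proof -
        have "(\<Sum>l\<le>N. (if l = n then u x else 0) * c ^ l) = (\<Sum>l\<le>N. if l = n then u x * c ^ n else 0)"
          by (rule sum.cong) auto
        also have "\<dots> = u (c *s x)" using True assms(2) by (simp add: homog_def)
        finally show ?thesis by (simp add: v(2) left_diff_distrib sum_subtractf)
      qed
      then have "\<forall>l\<le>N. v l x - (if l = n then u x else 0) = 0"
        using polyfun_eq_0[of "\<lambda>l. v l x - (if l = n then u x else 0)" N] by blast
      from this[rule_format, OF True] show ?thesis by simp
    qed
    then show ?thesis using fun_mem_cong[OF v(1)[of n], of u] by simp
  next
    case False
    have "u x = 0" for x
    proof -
      let ?w = "\<lambda>l. (if l = n then u x else 0) - (if l \<le> N then v l x else 0)"
      have "(\<Sum>l\<le>n. ?w l * c ^ l) = 0" for c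
      proof -
        have "(\<Sum>l\<le>n. (if l = n then u x else 0) * c ^ l) = (\<Sum>l\<le>n. if l = n then u x * c ^ n else 0)"
          by (rule sum.cong) auto
        also have "\<dots> = u (c *s x)" using assms(2) by (simp add: homog_def)
        finally have 1: "(\<Sum>l\<le>n. (if l = n then u x else 0) * c ^ l) = u (c *s x)" .
        have 2: "(\<Sum>l\<le>n. (if l \<le> N then v l x else 0) * c ^ l) = (\<Sum>l\<le>N. v l x * c ^ l)"
          by (rule sum.mono_neutral_cong_right) (use False in auto)
        show ?thesis by (simp only: left_diff_distrib sum_subtractf 1 2 v(2)) simp
      qed
      then have "\<forall>l\<le>n. ?w l = 0" using polyfun_eq_0[of ?w n] by blast
      from this[rule_format, of n] show ?thesis using False by simp
    qed
    then show ?thesis using fun_mem_cong[OF cspan.zero, of u] by simp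
  qed
qed

lemma quadratic_form_explicit:
  assumes "pf u" "homog 2 u"
  shows "\<exists>c :: nat \<Rightarrow> complex. \<forall>x. u x = c 0 * (x $ 1)\<^sup>2 + c 1 * (x $ 2)\<^sup>2 + c 2 * (x $ 3)\<^sup>2
    + c 3 * (x $ 1 * x $ 2) + c 4 * (x $ 1 * x $ 3) + c 5 * (x $ 2 * x $ 3)"
  using homog_pf_span[OF assms]
proof induction
  case zero
  show ?case by (rule exI[of _ "\<lambda>_. 0"]) simp
next
  case (step u m k)
  then obtain c :: "nat \<Rightarrow> complex" where u: "\<And>x. u x = c 0 * (x $ 1)\<^sup>2 + c 1 * (x $ 2)\<^sup>2 + c 2 * (x $ 3)\<^sup>2
    + c 3 * (x $ 1 * x $ 2) + c 4 * (x $ 1 * x $ 3) + c 5 * (x $ 2 * x $ 3)" by blast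
  from step obtain i j l where m: "m = mon i j l" "i + j + l = 2" by blast
  have "(i = 2 \<and> j = 0 \<and> l = 0) \<or> (i = 0 \<and> j = 2 \<and> l = 0) \<or> (i = 0 \<and> j = 0 \<and> l = 2) \<or> (i = 1 \<and> j = 1 \<and> l = 0) \<or> (i = 1 \<and> j = 0 \<and> l = 1) \<or> (i = 0 \<and> j = 1 \<and> l = 1)"
    using m(2) by presburger
  then show ?case
  proof (elim disjE)
    assume "i = 2 \<and> j = 0 \<and> l = 0"
    then show ?thesis by (intro exI[of _ "c(0 := c 0 + k)"]) (simp add: u m(1) mon_def distrib_right)
  next
    assume "i = 0 \<and> j = 2 \<and> l = 0"
    then show ?thesis by (intro exI[of _ "c(1 := c 1 + k)"]) (simp add: u m(1) mon_def distrib_right)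
  next
    assume "i = 0 \<and> j = 0 \<and> l = 2"
    then show ?thesis by (intro exI[of _ "c(2 := c 2 + k)"]) (simp add: u m(1) mon_def distrib_right)
  next
    assume "i = 1 \<and> j = 1 \<and> l = 0"
    then show ?thesis by (intro exI[of _ "c(3 := c 3 + k)"]) (simp add: u m(1) mon_def distrib_right)
  next
    assume "i = 1 \<and> j = 0 \<and> l = 1"
    then show ?thesis by (intro exI[of _ "c(4 := c 4 + k)"]) (simp add: u m(1) mon_def distrib_right)
  next
    assume "i = 0 \<and> j = 1 \<and> l = 1"
    then show ?thesis by (intro exI[of _ "c(5 := c 5 + k)"]) (simp add: u m(1) mon_def distrib_right)
  qed
qed

text \<open>Polarization: u (X + Y) - u X - u Y is the bilinear form belonging to the quadratic form
  \<open>u\<close>.\<close>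

lemma quadratic_expansion:
  assumes "pf u" "homog 2 u"
  shows "u (s *s X + t *s Y + Z) = s\<^sup>2 * u X + s * t * (u (X + Y) - u X - u Y) + t\<^sup>2 * u Y
    + s * (u (X + Z) - u X - u Z) + t * (u (Y + Z) - u Y - u Z) + u Z"
proof -
  obtain c :: "nat \<Rightarrow> complex" where u: "\<And>x. u x = c 0 * (x $ 1)\<^sup>2 + c 1 * (x $ 2)\<^sup>2 + c 2 * (x $ 3)\<^sup>2
    + c 3 * (x $ 1 * x $ 2) + c 4 * (x $ 1 * x $ 3) + c 5 * (x $ 2 * x $ 3)"
    using quadratic_form_explicit[OF assms] by blast
  show ?thesis unfolding u by (simp add: power2_eq_square algebra_simps)
qed

text \<open>The system \<open>\<theta>A = \<sigma>B\<close>, \<open>\<theta>B = \<sigma>C\<close> for \<open>A = s\<^sup>2 + a\<close>, \<open>B = st + b\<close>, \<open>C = t\<^sup>2 + c\<close> with affine \<open>a\<close>, \<open>b\<close>, \<open>c\<close>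
  reduces, in terms of \<open>u = \<theta>s - \<sigma>t\<close>, to a cubic equation for \<open>u\<close>, unless its leading coefficient vanishes.\<close>

lemma two_conics_meet_aux:
  fixes \<sigma> \<theta> :: complex
  assumes "\<sigma> \<noteq> 0"
    and N: "2 * \<sigma> * \<theta> * (b0 * \<sigma> + b1 * \<theta>) - \<sigma>\<^sup>2 * (c0 * \<sigma> + c1 * \<theta>) - \<theta>\<^sup>2 * (a0 * \<sigma> + a1 * \<theta>) \<noteq> 0" (is "?N \<noteq> 0")
  shows "\<exists>s t. \<theta> * (s\<^sup>2 + a0 * s + a1 * t + a2) = \<sigma> * (s * t + b0 * s + b1 * t + b2) \<and>
    \<theta> * (s * t + b0 * s + b1 * t + b2) = \<sigma> * (t\<^sup>2 + c0 * s + c1 * t + c2)"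
proof -
  \<comment> \<open>In \<theta>(\<theta>A - \<sigma>B) - \<sigma>(\<theta>B - \<sigma>C) the
    quadratic terms combine to u^2. The rest is affine in \<open>s\<close> and \<open>t\<close>;
    with t = (\<theta>s - u)/\<sigma> it becomes n s = \<sigma>(u^2 + e2) - e1 u, which is solved by
    \<open>S\<close> and \<open>T\<close> below.\<close>
  define e1 e2 where "e1 = \<theta>\<^sup>2 * a1 - 2 * \<sigma> * \<theta> * b1 + \<sigma>\<^sup>2 * c1"
    and "e2 = \<theta>\<^sup>2 * a2 - 2 * \<sigma> * \<theta> * b2 + \<sigma>\<^sup>2 * c2"
  define n where "n = ?N"
  have n: "n \<noteq> 0" using N unfolding n_def .
  define S T where "S = [:\<sigma> * e2 / n, - e1 / n, \<sigma> / n:]"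
    and "T = Polynomial.smult (1 / \<sigma>) (Polynomial.smult \<theta> S - [:0, 1:])"
  \<comment> \<open>This is \<theta>A - \<sigma>B along s = S u, t = T u; only the term u S u
    contributes to the cubic coefficient \<sigma> / n.\<close>
  define p where "p = pCons 0 S + Polynomial.smult (\<theta> * a0 - \<sigma> * b0) S
    + Polynomial.smult (\<theta> * a1 - \<sigma> * b1) T + [:\<theta> * a2 - \<sigma> * b2:]"
  have "coeff p 3 = \<sigma> / n"
    by (simp add: p_def T_def S_def numeral_3_eq_3 numeral_2_eq_2)
  then have "coeff p 3 \<noteq> 0" using assms(1) n by simp
  then have "degree p \<ge> 3" by (rule le_degree)
  then have "\<not> constant (poly p)" by (simp add: constant_degree)
  then obtain u where u: "poly p u = 0" using fundamental_theorem_of_algebra by blast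
  define s t where "s = poly S u" and "t = poly T u"
  have u_eq: "u = \<theta> * s - \<sigma> * t" using assms(1) by (simp add: s_def t_def T_def)
  have "n * s = \<sigma> * (u\<^sup>2 + e2) - e1 * u"
    unfolding s_def S_def using n by (simp add: field_simps power2_eq_square)
  then have "\<sigma> * (u\<^sup>2 + \<theta>\<^sup>2 * (a0 * s + a1 * t + a2) - 2 * \<sigma> * \<theta> * (b0 * s + b1 * t + b2)
     + \<sigma>\<^sup>2 * (c0 * s + c1 * t + c2)) = 0"
    unfolding n_def e1_def e2_def u_eq by (simp add: algebra_simps power2_eq_square)
  then have E12: "u\<^sup>2 + \<theta>\<^sup>2 * (a0 * s + a1 * t + a2) - 2 * \<sigma> * \<theta> * (b0 * s + b1 * t + b2)
     + \<sigma>\<^sup>2 * (c0 * s + c1 * t + c2) = 0" using assms(1) by simp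
  have E1: "u * s + (\<theta> * a0 - \<sigma> * b0) * s + (\<theta> * a1 - \<sigma> * b1) * t + (\<theta> * a2 - \<sigma> * b2) = 0"
    using u by (simp add: p_def s_def t_def)
  have "\<theta> * (s\<^sup>2 + a0 * s + a1 * t + a2) - \<sigma> * (s * t + b0 * s + b1 * t + b2)
    = u * s + (\<theta> * a0 - \<sigma> * b0) * s + (\<theta> * a1 - \<sigma> * b1) * t + (\<theta> * a2 - \<sigma> * b2)"
    unfolding u_eq by (simp add: algebra_simps power2_eq_square)
  then have 1: "\<theta> * (s\<^sup>2 + a0 * s + a1 * t + a2) = \<sigma> * (s * t + b0 * s + b1 * t + b2)"
    using E1 by simp
  have "\<sigma> * (\<theta> * (s * t + b0 * s + b1 * t + b2)) - \<sigma> * (\<sigma> * (t\<^sup>2 + c0 * s + c1 * t + c2))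
    = \<theta> * (\<theta> * (s\<^sup>2 + a0 * s + a1 * t + a2) - \<sigma> * (s * t + b0 * s + b1 * t + b2))
      - (u\<^sup>2 + \<theta>\<^sup>2 * (a0 * s + a1 * t + a2) - 2 * \<sigma> * \<theta> * (b0 * s + b1 * t + b2)
         + \<sigma>\<^sup>2 * (c0 * s + c1 * t + c2))"
    unfolding u_eq by (simp add: algebra_simps power2_eq_square)
  then have "\<sigma> * (\<theta> * (s * t + b0 * s + b1 * t + b2)) = \<sigma> * (\<sigma> * (t\<^sup>2 + c0 * s + c1 * t + c2))"
    using 1 E12 by simp
  then have 2: "\<theta> * (s * t + b0 * s + b1 * t + b2) = \<sigma> * (t\<^sup>2 + c0 * s + c1 * t + c2)"
    using assms(1) by simp
  from 1 2 show ?thesis by blast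
qed

lemma two_conics_meet:
  fixes \<sigma> \<theta> :: complex
  assumes "\<sigma> \<noteq> 0 \<or> \<theta> \<noteq> 0"
    and N: "2 * \<sigma> * \<theta> * (b0 * \<sigma> + b1 * \<theta>) - \<sigma>\<^sup>2 * (c0 * \<sigma> + c1 * \<theta>) - \<theta>\<^sup>2 * (a0 * \<sigma> + a1 * \<theta>) \<noteq> 0"
  shows "\<exists>s t. \<theta> * (s\<^sup>2 + a0 * s + a1 * t + a2) = \<sigma> * (s * t + b0 * s + b1 * t + b2) \<and>
    \<theta> * (s * t + b0 * s + b1 * t + b2) = \<sigma> * (t\<^sup>2 + c0 * s + c1 * t + c2)"
proof (cases "\<sigma> = 0")
  case False
  then show ?thesis using two_conics_meet_aux[OF False N] by blast
next
  case True
  then have \<theta>: "\<theta> \<noteq> 0" using assms(1) by blast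
  have "2 * \<theta> * \<sigma> * (b1 * \<theta> + b0 * \<sigma>) - \<theta>\<^sup>2 * (a1 * \<theta> + a0 * \<sigma>) - \<sigma>\<^sup>2 * (c1 * \<theta> + c0 * \<sigma>) \<noteq> 0"
    using N by (simp add: algebra_simps)
  \<comment> \<open>The system is symmetric under exchanging \<sigma> with \<theta>,
    \<open>s\<close> with \<open>t\<close>, and \<open>A\<close> with \<open>C\<close>.\<close>
  from two_conics_meet_aux[OF \<theta> this, of c2 b2 a2] obtain s t where
    "\<sigma> * (s\<^sup>2 + c1 * s + c0 * t + c2) = \<theta> * (s * t + b1 * s + b0 * t + b2)"
    "\<sigma> * (s * t + b1 * s + b0 * t + b2) = \<theta> * (t\<^sup>2 + a1 * s + a0 * t + a2)" by blast
  then show ?thesis by (intro exI[of _ t] exI[of _ s]) (simp add: algebra_simps)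
qed

text \<open>The condition \<open>nosol\<close> says that \<open>(A : B : C) = (\<sigma>\<^sup>2 : \<sigma>\<theta> : \<theta>\<^sup>2)\<close> has no affine solution.\<close>

lemma no_quadratic_map:
  fixes \<sigma>0 \<theta>0 a0 a1 a2 b0 b1 b2 c0 c1 c2 :: complex
  defines "A \<equiv> \<lambda>s t. s\<^sup>2 + a0 * s + a1 * t + a2" and "B \<equiv> \<lambda>s t. s * t + b0 * s + b1 * t + b2"
    and "C \<equiv> \<lambda>s t. t\<^sup>2 + c0 * s + c1 * t + c2"
  assumes nz: "\<And>s t. \<not> (A s t = 0 \<and> B s t = 0 \<and> C s t = 0)"
    and nosol: "\<And>\<sigma> \<theta> s t. (\<sigma>, \<theta>) \<in> {(1, 0), (0, 1), (1, 1), (\<sigma>0, \<theta>0)} \<Longrightarrow>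
      \<not> (\<theta> * A s t = \<sigma> * B s t \<and> \<theta> * B s t = \<sigma> * C s t)"
    and dir: "\<sigma>0 \<noteq> 0" "\<theta>0 \<noteq> 0" "\<sigma>0 \<noteq> \<theta>0"
  shows False
proof -
  \<comment> \<open>A binary cubic form that vanishes in four distinct directions is zero.
    Evaluating it at these directions gives c0 = a1 = 0, a0 = 2 b1 and c1 = 2 b0.\<close>
  have N: "2 * \<sigma> * \<theta> * (b0 * \<sigma> + b1 * \<theta>) - \<sigma>\<^sup>2 * (c0 * \<sigma> + c1 * \<theta>) - \<theta>\<^sup>2 * (a0 * \<sigma> + a1 * \<theta>) = 0"
    if "(\<sigma>, \<theta>) \<in> {(1, 0), (0, 1), (1, 1), (\<sigma>0, \<theta>0)}" for \<sigma> \<theta>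
  proof (rule ccontr)
    assume "2 * \<sigma> * \<theta> * (b0 * \<sigma> + b1 * \<theta>) - \<sigma>\<^sup>2 * (c0 * \<sigma> + c1 * \<theta>) - \<theta>\<^sup>2 * (a0 * \<sigma> + a1 * \<theta>) \<noteq> 0"
    moreover have "\<sigma> \<noteq> 0 \<or> \<theta> \<noteq> 0" using that dir by auto
    ultimately obtain s t where "\<theta> * A s t = \<sigma> * B s t" "\<theta> * B s t = \<sigma> * C s t"
      using two_conics_meet[of \<sigma> \<theta> b0 b1 c0 c1 a0 a1 a2 b2 c2] unfolding A_def B_def C_def by blast
    then show False using nosol[OF that] by blast
  qed
  have c0: "c0 = 0" using N[of 1 0] by simp
  have a1: "a1 = 0" using N[of 0 1] by simp
  have "2 * (b0 + b1) - c1 - a0 = 0" using N[of 1 1] by (simp add: c0 a1)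
  then have c1: "c1 = 2 * b0 + 2 * b1 - a0" by (simp add: algebra_simps)
  have "2 * \<sigma>0 * \<theta>0 * (b0 * \<sigma>0 + b1 * \<theta>0) - \<sigma>0\<^sup>2 * (c1 * \<theta>0) - \<theta>0\<^sup>2 * (a0 * \<sigma>0) = 0"
    using N[of \<sigma>0 \<theta>0] by (simp add: c0 a1)
  moreover have "2 * \<sigma>0 * \<theta>0 * (b0 * \<sigma>0 + b1 * \<theta>0) - \<sigma>0\<^sup>2 * (c1 * \<theta>0) - \<theta>0\<^sup>2 * (a0 * \<sigma>0)
      = \<sigma>0 * \<theta>0 * ((\<sigma>0 - \<theta>0) * (a0 - 2 * b1))"
    unfolding c1 by (simp add: algebra_simps power2_eq_square)
  ultimately have a0: "a0 = 2 * b1" using dir by simp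
  then have c1: "c1 = 2 * b0" using c1 by simp
  define a b c where "a = a2 - b1\<^sup>2" and "b = b2 - b0 * b1" and "c = c2 - b0\<^sup>2"
  \<comment> \<open>With these values a translation completes the squares and removes all linear
    terms.\<close>
  have sq: "A (X - b1) (Y - b0) = X\<^sup>2 + a" "B (X - b1) (Y - b0) = X * Y + b" "C (X - b1) (Y - b0) = Y\<^sup>2 + c" for X Y
    by (simp_all add: A_def B_def C_def c0 a1 a0 c1 a_def b_def c_def power2_eq_square algebra_simps)
  \<comment> \<open>Otherwise an explicit solution exists: the chosen X and Y satisfy \<theta>X -
    \<sigma>Y = \<kappa>M, and \<kappa>^2 M = -1 gives X(\<theta>X - \<sigma>Y) = -(\<theta>a -
    \<sigma>b), likewise for Y. Vanishing of M in three directions leaves a = b = c = 0.\<close>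
  have M: "\<theta>\<^sup>2 * a - 2 * \<sigma> * \<theta> * b + \<sigma>\<^sup>2 * c = 0" (is "?M = 0")
    if "(\<sigma>, \<theta>) \<in> {(1, 0), (0, 1), (1, 1), (\<sigma>0, \<theta>0)}" for \<sigma> \<theta>
  proof (rule ccontr)
    assume M: "?M \<noteq> 0"
    obtain \<kappa> where "\<kappa>\<^sup>2 = - 1 / ?M" using complex_root_exists[of 2] by auto
    then have \<kappa>: "\<kappa>\<^sup>2 * ?M = - 1" using M by simp
    let ?X = "\<kappa> * (\<theta> * a - \<sigma> * b)" and ?Y = "\<kappa> * (\<theta> * b - \<sigma> * c)"
    have "\<theta> * (?X\<^sup>2 + a) - \<sigma> * (?X * ?Y + b) = (\<theta> * a - \<sigma> * b) * (\<kappa>\<^sup>2 * ?M + 1)"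
      by (simp add: algebra_simps power2_eq_square)
    then have 1: "\<theta> * (?X\<^sup>2 + a) = \<sigma> * (?X * ?Y + b)" unfolding \<kappa> by simp
    have "\<theta> * (?X * ?Y + b) - \<sigma> * (?Y\<^sup>2 + c) = (\<theta> * b - \<sigma> * c) * (\<kappa>\<^sup>2 * ?M + 1)"
      by (simp add: algebra_simps power2_eq_square)
    then have "\<theta> * (?X * ?Y + b) = \<sigma> * (?Y\<^sup>2 + c)" unfolding \<kappa> by simp
    with 1 show False using nosol[OF that, of "?X - b1" "?Y - b0"] unfolding sq by blast
  qed
  have "c = 0" using M[of 1 0] by simp
  moreover have "a = 0" using M[of 0 1] by simp
  moreover have "b = 0" using M[of 1 1] \<open>c = 0\<close> \<open>a = 0\<close> by simp
  ultimately show False using nz[of "0 - b1" "0 - b0"] unfolding sq by simp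
qed

section \<open>Four points in degree two\<close>

text \<open>\<open>l\<close> is the determinant of q1, q2 and x; where it vanishes, Cramer's rule
  expresses x through q1 and q2.\<close>

lemma plane_through:
  assumes "indep q1 q2"
  shows "\<exists>l. pf l \<and> homog 1 l \<and> l q1 = 0 \<and> l q2 = 0 \<and> (\<exists>w. \<forall>s t. w \<noteq> s *s q1 + t *s q2) \<and>
    (\<forall>x. l x = 0 \<longrightarrow> (\<exists>s t. x = s *s q1 + t *s q2))"
proof -
  obtain i where i: "q2 $ i \<noteq> 0" using assms by (auto simp: indep_def Finite_Cartesian_Product.vec_eq_iff)
  have "\<exists>j. q1 $ i * q2 $ j - q1 $ j * q2 $ i \<noteq> 0"
  proof (rule ccontr)
    assume "\<nexists>j. q1 $ i * q2 $ j - q1 $ j * q2 $ i \<noteq> 0"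
    then have z: "q1 $ i * q2 $ j - q1 $ j * q2 $ i = 0" for j by blast
    have eq: "q1 $ j = ((q1 $ i / q2 $ i) *s q2) $ j" for j using z[of j] i by (simp add: field_simps)
    have "q1 = (q1 $ i / q2 $ i) *s q2" unfolding Finite_Cartesian_Product.vec_eq_iff using eq by blast
    then show False using assms unfolding indep_def by blast
  qed
  then obtain j where m: "q1 $ i * q2 $ j - q1 $ j * q2 $ i \<noteq> 0" by blast
  then have "i \<noteq> j" by auto
  then have "\<exists>k. k \<noteq> i \<and> k \<noteq> j \<and> (\<forall>l. l = i \<or> l = j \<or> l = k)"
    using exhaust_3[of i] exhaust_3[of j] exhaust_3 by (elim disjE) force+
  then obtain k where k: "k \<noteq> i" "k \<noteq> j" "\<And>l. l = i \<or> l = j \<or> l = k" by blast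
  let ?m = "q1 $ i * q2 $ j - q1 $ j * q2 $ i"
  let ?l = "\<lambda>x :: complex^3. ?m * x $ k - (q2 $ j * q1 $ k - q1 $ j * q2 $ k) * x $ i
    - (q1 $ i * q2 $ k - q2 $ i * q1 $ k) * x $ j"
  have "pf ?l" by (intro pf_intros)
  moreover have "homog 1 ?l" by (intro homog_diff homog_scale homog_coord)
  moreover have "?l q1 = 0" "?l q2 = 0" by (simp_all add: algebra_simps)
  moreover have "axis k 1 \<noteq> s *s q1 + t *s q2" for s t
  proof
    assume "axis k 1 = s *s q1 + t *s q2"
    then have "?l (axis k 1) = ?l (s *s q1 + t *s q2)" by (rule arg_cong)
    also have "\<dots> = 0" by (simp add: algebra_simps)
    finally show False using m k by (simp add: axis_def)
  qed
  moreover have "\<exists>s t. x = s *s q1 + t *s q2" if lx: "?l x = 0" for x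
  proof -
    define s t where "s = (q2 $ j * x $ i - q2 $ i * x $ j) / ?m" and "t = (q1 $ i * x $ j - q1 $ j * x $ i) / ?m"
    have st: "?m * s = q2 $ j * x $ i - q2 $ i * x $ j" "?m * t = q1 $ i * x $ j - q1 $ j * x $ i"
      using m by (simp_all add: s_def t_def)
    have "?m * x $ l = ?m * (s * q1 $ l + t * q2 $ l)" if "l = i \<or> l = j \<or> l = k" for l
      using that
    proof -
      have "?m * (s * q1 $ l + t * q2 $ l) = (?m * s) * q1 $ l + (?m * t) * q2 $ l"
        by (simp add: algebra_simps)
      also have "\<dots> = (q2 $ j * x $ i - q2 $ i * x $ j) * q1 $ l + (q1 $ i * x $ j - q1 $ j * x $ i) * q2 $ l"
        by (simp only: st)
      also have "\<dots> = ?m * x $ l"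
        using that
      proof (elim disjE)
        assume "l = k"
        have "(q2 $ j * x $ i - q2 $ i * x $ j) * q1 $ k + (q1 $ i * x $ j - q1 $ j * x $ i) * q2 $ k
          = ?m * x $ k - ?l x" by (simp add: algebra_simps)
        then show ?thesis using lx \<open>l = k\<close> by simp
      qed (simp_all add: algebra_simps)
      finally show ?thesis by (rule sym)
    qed
    then have "x $ l = (s *s q1 + t *s q2) $ l" for l using k(3) m by simp
    then have "x = s *s q1 + t *s q2" unfolding Finite_Cartesian_Product.vec_eq_iff by blast
    then show ?thesis by blast
  qed
  ultimately show ?thesis by (intro exI[of _ ?l] conjI exI[of _ "axis k 1"] allI impI)
qed

lemma spanning_triple:
  assumes "\<And>a b c. a *s u + b *s v + c *s w = 0 \<Longrightarrow> a = 0 \<and> b = 0 \<and> c = (0 :: complex)"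
  shows "\<exists>a b c. (x :: complex^3) = a *s u + b *s v + c *s w"
proof -
  let ?V = "\<lambda>j :: nat. if j = 0 then u else if j = 1 then v else if j = 2 then w else x"
  obtain \<beta> where \<beta>: "\<exists>j\<in>{..<4}. \<beta> j \<noteq> 0" "\<And>i. (\<Sum>j\<in>{..<4}. \<beta> j * ?V j $ i) = 0"
    using nontrivial_kernel[of "UNIV :: 3 set" "{..<4 :: nat}" "\<lambda>i j. ?V j $ i"] by auto
  have rel: "\<beta> 0 * u $ i + \<beta> 1 * v $ i + \<beta> 2 * w $ i + \<beta> 3 * x $ i = 0" for i
    using \<beta>(2)[of i] by (simp add: eval_nat_numeral add_ac)
  have "\<beta> 3 \<noteq> 0"
  proof
    assume 3: "\<beta> 3 = 0"
    then have "\<beta> 0 *s u + \<beta> 1 *s v + \<beta> 2 *s w = 0"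
      using rel by (simp add: Finite_Cartesian_Product.vec_eq_iff)
    then have "\<beta> 0 = 0 \<and> \<beta> 1 = 0 \<and> \<beta> 2 = 0" by (rule assms)
    then have "\<beta> j = 0" if "j < 4" for j using 3 that by (auto simp: eval_nat_numeral less_Suc_eq)
    then show False using \<beta>(1) by auto
  qed
  have "x $ i = (- \<beta> 0 / \<beta> 3) * u $ i + (- \<beta> 1 / \<beta> 3) * v $ i + (- \<beta> 2 / \<beta> 3) * w $ i" for i
  proof -
    have "\<beta> 3 * x $ i = - \<beta> 0 * u $ i - \<beta> 1 * v $ i - \<beta> 2 * w $ i"
    proof -
      have "\<beta> 3 * x $ i - (- \<beta> 0 * u $ i - \<beta> 1 * v $ i - \<beta> 2 * w $ i) = 0"
        using rel[of i] by (simp add: algebra_simps)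
      then show ?thesis by simp
    qed
    then have "x $ i = (- \<beta> 0 * u $ i - \<beta> 1 * v $ i - \<beta> 2 * w $ i) / \<beta> 3"
      using \<open>\<beta> 3 \<noteq> 0\<close> by (metis nonzero_mult_div_cancel_left)
    then show ?thesis by (simp add: diff_divide_distrib)
  qed
  then have "x = (- \<beta> 0 / \<beta> 3) *s u + (- \<beta> 1 / \<beta> 3) *s v + (- \<beta> 2 / \<beta> 3) *s w"
    by (simp only: Finite_Cartesian_Product.vec_eq_iff vector_add_component vector_smult_component) blast
  then show ?thesis by blast
qed

lemma indep_scale: "indep p q \<Longrightarrow> s \<noteq> 0 \<Longrightarrow> indep (s *s p) q"
  unfolding indep_def
proof (elim conjE, intro conjI allI notI)
  fix w assume "s \<noteq> 0" "\<forall>w. p \<noteq> w *s q" "s *s p = w *s q"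
  then have "p = (w / s) *s q" by (metis divide_inverse_commute left_inverse vector_smult_assoc vector_smult_lid)
  then show False using \<open>\<forall>w. p \<noteq> w *s q\<close> by blast
qed (simp_all add: vector_mul_eq_0)

text \<open>The quadratic form l l' kills q1 and q2 by \<open>l\<close> and q3 by \<open>l'\<close>,
  so the transferred relation leaves only a4 l(q4) l'(q4) = 0.\<close>

lemma (in forms) ram_quadruple_plane:
  assumes "d = 2" "ram F q1" "ram F q2" "ram F q3" "ram F q4"
    and "indep q4 q3" "pf l" "homog 1 l" "l q1 = 0" "l q2 = 0"
    and nz: "a1 \<noteq> 0" "a2 \<noteq> 0" "a3 \<noteq> 0" "a4 \<noteq> 0"
    and rel: "a1 *s F q1 + a2 *s F q2 + a3 *s F q3 + a4 *s F q4 = 0"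
  shows "l q4 = 0"
proof -
  obtain l' where l': "pf l'" "homog 1 l'" "l' q3 = 0" "l' q4 \<noteq> 0"
    using indep_separates[OF assms(6)] by blast
  let ?g = "\<lambda>x. l x * l' x"
  have "homog (1 + 1) ?g" by (intro homog_mult assms l')
  moreover have "1 + 1 = d" using assms(1) by simp
  ultimately have hom: "homog d ?g" by (simp only:)
  have "pf ?g" by (intro pf_intros assms l')
  from relation4[OF this hom assms(2-5) nz rel] have "a4 * (l q4 * l' q4) = 0"
    by (simp only: assms(9,10) l'(3)) simp
  then show ?thesis using nz(4) l'(4) by simp
qed

lemma (in forms) ram_quadruple_degree2:
  assumes d: "d = 2" and ram: "ram F q1" "ram F q2" "ram F q3" "ram F q4"
    and indep: "indep q1 q2" "indep q1 q3" "indep q1 q4" "indep q2 q3" "indep q2 q4" "indep q3 q4"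
    and nz: "a1 \<noteq> 0" "a2 \<noteq> 0" "a3 \<noteq> 0" "a4 \<noteq> 0"
    and rel: "a1 *s F q1 + a2 *s F q2 + a3 *s F q3 + a4 *s F q4 = 0"
  shows False
proof -
  obtain l where l0: "pf l \<and> homog 1 l \<and> l q1 = 0 \<and> l q2 = 0 \<and> (\<exists>w. \<forall>s t. w \<noteq> s *s q1 + t *s q2) \<and>
      (\<forall>x. l x = 0 \<longrightarrow> (\<exists>s t. x = s *s q1 + t *s q2))"
    using plane_through[OF indep(1)] ..
  then have l: "pf l" "homog 1 l" "l q1 = 0" "l q2 = 0" by - (elim conjE, assumption)+
  from l0 obtain w where w: "\<forall>s t. w \<noteq> s *s q1 + t *s q2" by (elim conjE exE)
  from l0 have plane: "\<forall>x. l x = 0 \<longrightarrow> (\<exists>s t. x = s *s q1 + t *s q2)" by (elim conjE)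
  have "l q4 = 0"
    by (rule ram_quadruple_plane[OF d ram indep_sym[OF indep(6)] l nz rel])
  moreover have "l q3 = 0"
    by (rule ram_quadruple_plane[OF d ram(1,2,4,3) indep(6) l nz(1,2,4,3)]) (use rel in \<open>simp add: add_ac\<close>)
  ultimately obtain s3 t3 s4 t4 where q3: "q3 = s3 *s q1 + t3 *s q2" and q4: "q4 = s4 *s q1 + t4 *s q2"
    using plane by blast
  have st: "s3 \<noteq> 0" "t3 \<noteq> 0" "s4 \<noteq> 0" "t4 \<noteq> 0"
    using indep_sym[OF indep(2)] indep_sym[OF indep(3)] indep_sym[OF indep(4)] indep_sym[OF indep(5)]
    unfolding indep_def q3 q4 by auto
  \<comment> \<open>Normalizes the first three points on the line to the directions (1,0), (0,1),
    (1,1); the fourth becomes (\<sigma>, \<theta>).\<close>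
  define Q1 Q2 \<sigma> \<theta> where "Q1 = s3 *s q1" and "Q2 = t3 *s q2" and "\<sigma> = s4 / s3" and "\<theta> = t4 / t3"
  have q3: "q3 = Q1 + Q2" by (simp add: q3 Q1_def Q2_def)
  have q4: "q4 = \<sigma> *s Q1 + \<theta> *s Q2" using st by (simp add: q4 Q1_def Q2_def \<sigma>_def \<theta>_def)
  have "\<sigma> \<noteq> \<theta>"
  proof
    assume "\<sigma> = \<theta>"
    then have "q4 = \<sigma> *s q3" by (simp add: q3 q4 vector_add_ldistrib)
    then show False using indep_sym[OF indep(6)] unfolding indep_def by blast
  qed
  have \<sigma>: "\<sigma> \<noteq> 0" "\<theta> \<noteq> 0" using st by (simp_all add: \<sigma>_def \<theta>_def)
  have outside: "s *s Q1 + t *s Q2 + w \<noteq> s' *s Q1 + t' *s Q2" for s t s' t'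
  proof
    assume "s *s Q1 + t *s Q2 + w = s' *s Q1 + t' *s Q2"
    then have "w = (s' *s Q1 + t' *s Q2) - (s *s Q1 + t *s Q2)" by (simp add: algebra_simps)
    also have "\<dots> = ((s' - s) * s3) *s q1 + ((t' - t) * t3) *s q2"
      by (simp add: Q1_def Q2_def Finite_Cartesian_Product.vec_eq_iff algebra_simps)
    finally show False using w by blast
  qed
  have ramQ: "ram F Q1" "ram F Q2" unfolding Q1_def Q2_def using ram st by (auto intro: ram_scale)
  have ram_dir: "ram F (\<sigma>' *s Q1 + \<theta>' *s Q2)" if "(\<sigma>', \<theta>') \<in> {(1, 0), (0, 1), (1, 1), (\<sigma>, \<theta>)}" for \<sigma>' \<theta>'
    using that ramQ ram(3,4) unfolding q3 q4 by auto
  \<comment> \<open>In this basis \<open>F\<close> maps s Q1 + t Q2 to (s^2, st, t^2). Its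
    independence is that of the images of the first three points.\<close>
  define \<alpha> \<beta> \<gamma> where "\<alpha> = F Q1" and "\<beta> = F (Q1 + Q2) - F Q1 - F Q2" and "\<gamma> = F Q2"
  have independent: "a = 0 \<and> b = 0 \<and> c = 0" if "a *s \<alpha> + b *s \<beta> + c *s \<gamma> = 0" for a b c
  proof -
    have "(a - b) *s F Q1 + (c - b) *s F Q2 + b *s F q3 = a *s \<alpha> + b *s \<beta> + c *s \<gamma>"
      by (simp add: \<alpha>_def \<beta>_def \<gamma>_def q3 Finite_Cartesian_Product.vec_eq_iff algebra_simps)
    then have "(a - b) *s F Q1 + (c - b) *s F Q2 + b *s F q3 = 0" using that by simp
    moreover have "indep Q1 q3" "indep Q2 q3" "indep Q1 Q2"
      unfolding Q1_def Q2_def using indep st by (auto intro: indep_scale indep_sym)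
    ultimately have "a - b = 0 \<and> c - b = 0 \<and> b = 0"
      using d by (intro ram_triple_independent[OF _ ramQ ram(3)]) auto
    then show ?thesis by simp
  qed
  obtain a0 b0 c0 where 0: "F (Q1 + w) - F Q1 - F w = a0 *s \<alpha> + b0 *s \<beta> + c0 *s \<gamma>"
    using spanning_triple[OF independent] by blast
  obtain a1 b1 c1 where 1: "F (Q2 + w) - F Q2 - F w = a1 *s \<alpha> + b1 *s \<beta> + c1 *s \<gamma>"
    using spanning_triple[OF independent] by blast
  obtain a2 b2 c2 where 2: "F w = a2 *s \<alpha> + b2 *s \<beta> + c2 *s \<gamma>"
    using spanning_triple[OF independent] by blast
  have hom2: "homog 2 (\<lambda>x. F x $ i)" for i using homog_F d by simp
  define A B C where "A = (\<lambda>s t. s\<^sup>2 + a0 * s + a1 * t + a2)"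
    and "B = (\<lambda>s t. s * t + b0 * s + b1 * t + b2)" and "C = (\<lambda>s t. t\<^sup>2 + c0 * s + c1 * t + c2)"
  have expand: "F (s *s X + t *s Y + Z) = s\<^sup>2 *s F X + (s * t) *s (F (X + Y) - F X - F Y) + t\<^sup>2 *s F Y
      + s *s (F (X + Z) - F X - F Z) + t *s (F (Y + Z) - F Y - F Z) + F Z" for s t X Y Z
    unfolding Finite_Cartesian_Product.vec_eq_iff
    by (simp only: quadratic_expansion[OF pf_F hom2, of s X t Y Z] vector_add_component
      vector_minus_component vector_smult_component simp_thms)
  have F_eq: "F (s *s Q1 + t *s Q2 + w) = A s t *s \<alpha> + B s t *s \<beta> + C s t *s \<gamma>" for s t
    unfolding expand 0 1 unfolding 2 unfolding \<beta>_def[symmetric] unfolding \<alpha>_def[symmetric] \<gamma>_def[symmetric]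
    by (simp add: A_def B_def C_def Finite_Cartesian_Product.vec_eq_iff algebra_simps)
  have F_dir: "F (\<sigma>' *s Q1 + \<theta>' *s Q2) = \<sigma>'\<^sup>2 *s \<alpha> + (\<sigma>' * \<theta>') *s \<beta> + \<theta>'\<^sup>2 *s \<gamma>" for \<sigma>' \<theta>'
    using expand[of \<sigma>' Q1 \<theta>' Q2 0] by (simp add: F_0 \<alpha>_def \<beta>_def \<gamma>_def)
  have F_nonzero: "F (s *s Q1 + t *s Q2 + w) \<noteq> 0" for s t
  proof
    assume "F (s *s Q1 + t *s Q2 + w) = 0"
    then have "s *s Q1 + t *s Q2 + w = 0 *s Q1 + 0 *s Q2" using zero_F by simp
    then show False using outside by blast
  qed
  show False
  proof (rule no_quadratic_map[of a0 a1 a2 b0 b1 b2 c0 c1 c2 \<sigma> \<theta>])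
    show "\<not> (s\<^sup>2 + a0 * s + a1 * t + a2 = 0 \<and> s * t + b0 * s + b1 * t + b2 = 0 \<and> t\<^sup>2 + c0 * s + c1 * t + c2 = 0)"
      for s t
    proof -
      have "\<not> (A s t = 0 \<and> B s t = 0 \<and> C s t = 0)" using F_nonzero[of s t] unfolding F_eq by auto
      then show ?thesis unfolding A_def B_def C_def .
    qed
    show "\<sigma> \<noteq> 0" "\<theta> \<noteq> 0" "\<sigma> \<noteq> \<theta>" by fact+
    fix \<sigma>' \<theta>' s t
    assume mem: "(\<sigma>', \<theta>') \<in> {(1, 0), (0, 1), (1, 1), (\<sigma>, \<theta>)}"
    then have nz': "\<sigma>' \<noteq> 0 \<or> \<theta>' \<noteq> 0" using \<sigma> by auto
    have "\<not> (\<theta>' * A s t = \<sigma>' * B s t \<and> \<theta>' * B s t = \<sigma>' * C s t)"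
    proof
      assume E: "\<theta>' * A s t = \<sigma>' * B s t \<and> \<theta>' * B s t = \<sigma>' * C s t"
      \<comment> \<open>A solution means that F, at a point off the plane of Q1 and Q2, is
        proportional to its value in a ramified direction; that fibre lies inside the plane.\<close>
      have "\<exists>\<kappa>. A s t = \<kappa> * \<sigma>'\<^sup>2 \<and> B s t = \<kappa> * (\<sigma>' * \<theta>') \<and> C s t = \<kappa> * \<theta>'\<^sup>2"
      proof (cases "\<sigma>' = 0")
        case True
        then show ?thesis using E nz' by (intro exI[of _ "C s t / \<theta>'\<^sup>2"]) auto
      next
        case False
        have "B s t = \<theta>' * A s t / \<sigma>'" using E False by (simp add: field_simps)
        moreover have "C s t = \<theta>' * B s t / \<sigma>'" using E False by (simp add: field_simps)
        ultimately show ?thesis using False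
          by (intro exI[of _ "A s t / \<sigma>'\<^sup>2"]) (simp add: power2_eq_square)
      qed
      then obtain \<kappa> where \<kappa>: "A s t = \<kappa> * \<sigma>'\<^sup>2" "B s t = \<kappa> * (\<sigma>' * \<theta>')" "C s t = \<kappa> * \<theta>'\<^sup>2" by blast
      have F\<kappa>: "F (s *s Q1 + t *s Q2 + w) = \<kappa> *s F (\<sigma>' *s Q1 + \<theta>' *s Q2)"
        unfolding F_eq F_dir \<kappa> by (simp add: vector_add_ldistrib)
      then have "\<kappa> \<noteq> 0" using F_nonzero[of s t] by auto
      then obtain v where "s *s Q1 + t *s Q2 + w = v *s (\<sigma>' *s Q1 + \<theta>' *s Q2)"
        using F\<kappa> ram_dir[OF mem] unfolding ram_def by blast
      also have "\<dots> = (v * \<sigma>') *s Q1 + (v * \<theta>') *s Q2" by (simp add: vector_add_ldistrib)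
      finally show False using outside by blast
    qed
    then show "\<not> (\<theta>' * (s\<^sup>2 + a0 * s + a1 * t + a2) = \<sigma>' * (s * t + b0 * s + b1 * t + b2) \<and>
        \<theta>' * (s * t + b0 * s + b1 * t + b2) = \<sigma>' * (t\<^sup>2 + c0 * s + c1 * t + c2))"
      unfolding A_def B_def C_def .
  qed
qed

text \<open>Three images form a basis, and expanding the fourth in it gives a relation. A zero
  coefficient would make three images dependent, so the lemmas for nonzero coefficients
  apply.\<close>

lemma (in forms) no_four_ram:
  assumes "d \<ge> 2" and ram: "ram F q1" "ram F q2" "ram F q3" "ram F q4"
    and indep: "indep q1 q2" "indep q1 q3" "indep q1 q4" "indep q2 q3" "indep q2 q4" "indep q3 q4"
  shows False
proof -
  have "\<exists>a b c. F q4 = a *s F q1 + b *s F q2 + c *s F q3"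
    by (rule spanning_triple, rule ram_triple_independent[OF assms(1) ram(1-3) indep(1,2,4)])
  then obtain a b c where abc: "F q4 = a *s F q1 + b *s F q2 + c *s F q3" by blast
  have rel: "a *s F q1 + b *s F q2 + c *s F q3 + (- 1) *s F q4 = 0"
    by (simp add: abc Finite_Cartesian_Product.vec_eq_iff)
  have "a \<noteq> 0"
  proof
    assume "a = 0"
    then have "b *s F q2 + c *s F q3 + (- 1) *s F q4 = 0" using rel by simp
    from ram_triple_independent[OF assms(1) ram(2,3,4) indep(4,5,6) this] show False by simp
  qed
  moreover have "b \<noteq> 0"
  proof
    assume "b = 0"
    then have "a *s F q1 + c *s F q3 + (- 1) *s F q4 = 0" using rel by simp
    from ram_triple_independent[OF assms(1) ram(1,3,4) indep(2,3,6) this] show False by simp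
  qed
  moreover have "c \<noteq> 0"
  proof
    assume "c = 0"
    then have "a *s F q1 + b *s F q2 + (- 1) *s F q4 = 0" using rel by simp
    from ram_triple_independent[OF assms(1) ram(1,2,4) indep(1,3,5) this] show False by simp
  qed
  moreover have "(- 1 :: complex) \<noteq> 0" by simp
  ultimately have nz: "a \<noteq> 0" "b \<noteq> 0" "c \<noteq> 0" "(- 1 :: complex) \<noteq> 0" by blast+
  show False
  proof (cases "d = 2")
    case True
    then show ?thesis using ram_quadruple_degree2[OF True ram indep nz rel] by blast
  next
    case False
    then have "d \<ge> 3" using assms(1) by simp
    then show ?thesis using ram_quadruple_high_degree[OF _ ram indep(3,5,6) nz rel] by blast
  qed
qed

section \<open>Forms as polynomial functions\<close>

lemma pf_eval3: "pf (eval3 G)"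
  unfolding eval3_def[abs_def] by (intro pf_sum pf.mult pf.const pf_prod pf_power pf.coord)

lemma homog_eval3: "homogeneous3 d G \<Longrightarrow> homog d (eval3 G)"
  by (simp add: homog_def eval3_scale)

lemma eval3_superset:
  assumes "finite K" "Poly_Mapping.keys G \<subseteq> K"
  shows "eval3 G x = (\<Sum>m\<in>K. Poly_Mapping.lookup G m * (\<Prod>i\<in>UNIV. (x $ i) ^ Poly_Mapping.lookup m i))"
  unfolding eval3_def
  by (rule sum.mono_neutral_left) (use assms in \<open>auto simp: in_keys_iff\<close>)

lemma eval3_add_single:
  "eval3 (G + Poly_Mapping.single m c) x = eval3 G x + c * (\<Prod>i\<in>UNIV. (x $ i) ^ Poly_Mapping.lookup m i)"
proof -
  let ?K = "insert m (Poly_Mapping.keys G)"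
  have sub: "Poly_Mapping.keys (G + Poly_Mapping.single m c) \<subseteq> ?K"
    using Poly_Mapping.keys_add[of G "Poly_Mapping.single m c"] by (auto split: if_splits)
  have "eval3 (G + Poly_Mapping.single m c) x =
      (\<Sum>m'\<in>?K. Poly_Mapping.lookup (G + Poly_Mapping.single m c) m' * (\<Prod>i\<in>UNIV. (x $ i) ^ Poly_Mapping.lookup m' i))"
    by (rule eval3_superset) (use sub in auto)
  also have "\<dots> = (\<Sum>m'\<in>?K. Poly_Mapping.lookup G m' * (\<Prod>i\<in>UNIV. (x $ i) ^ Poly_Mapping.lookup m' i))
     + (\<Sum>m'\<in>?K. Poly_Mapping.lookup (Poly_Mapping.single m c) m' * (\<Prod>i\<in>UNIV. (x $ i) ^ Poly_Mapping.lookup m' i))"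
    by (simp only: lookup_add distrib_right sum.distrib)
  also have "(\<Sum>m'\<in>?K. Poly_Mapping.lookup G m' * (\<Prod>i\<in>UNIV. (x $ i) ^ Poly_Mapping.lookup m' i)) = eval3 G x"
    by (rule eval3_superset[symmetric]) auto
  also have "(\<Sum>m'\<in>?K. Poly_Mapping.lookup (Poly_Mapping.single m c) m' * (\<Prod>i\<in>UNIV. (x $ i) ^ Poly_Mapping.lookup m' i))
     = (\<Sum>m'\<in>?K. if m' = m then c * (\<Prod>i\<in>UNIV. (x $ i) ^ Poly_Mapping.lookup m i) else 0)"
    by (rule sum.cong) (auto simp: lookup_single)
  also have "\<dots> = c * (\<Prod>i\<in>UNIV. (x $ i) ^ Poly_Mapping.lookup m i)" by simp
  finally show ?thesis .
qed

lemma prod_UNIV_3: "prod f (UNIV :: 3 set) = f 1 * f 2 * (f 3 :: complex)"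
  unfolding UNIV_3 by (simp add: mult.assoc)

text \<open>The way back from functions to formal forms, needed because \<open>endo_degree\<close>
  quantifies over triples of \<open>poly3\<close>.\<close>

lemma homog_pf_eval3:
  assumes "pf u" "homog n u"
  shows "\<exists>G. homogeneous3 n G \<and> eval3 G = u"
  using homog_pf_span[OF assms]
proof induction
  case zero
  show ?case by (rule exI[of _ 0]) (simp add: homogeneous3_def eval3_def fun_eq_iff)
next
  case (step u b c)
  then obtain G where G: "homogeneous3 n G" "eval3 G = u" by blast
  from step obtain i j k where b: "b = mon i j k" "i + j + k = n" by blast
  define m :: "3 \<Rightarrow>\<^sub>0 nat" where
    "m = Poly_Mapping.single 1 i + Poly_Mapping.single 2 j + Poly_Mapping.single 3 k"
  have m: "Poly_Mapping.lookup m 1 = i" "Poly_Mapping.lookup m 2 = j" "Poly_Mapping.lookup m 3 = k"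
    by (simp_all add: m_def lookup_add lookup_single)
  have "(\<Prod>l\<in>UNIV. (x $ l) ^ Poly_Mapping.lookup m l) = b x" for x :: "complex^3"
    unfolding prod_UNIV_3 m b(1) mon_def ..
  then have "eval3 (G + Poly_Mapping.single m c) = (\<lambda>x. u x + c * b x)"
    by (simp add: fun_eq_iff eval3_add_single G(2))
  moreover have "homogeneous3 n (G + Poly_Mapping.single m c)"
    unfolding homogeneous3_def
  proof
    fix m' assume "m' \<in> Poly_Mapping.keys (G + Poly_Mapping.single m c)"
    then have "m' \<in> Poly_Mapping.keys G \<or> m' = m"
      using Poly_Mapping.keys_add[of G "Poly_Mapping.single m c"] by (auto split: if_splits)
    then show "(\<Sum>i\<in>UNIV. Poly_Mapping.lookup m' i) = n"
      using G(1) b(2) m by (auto simp: homogeneous3_def sum_3)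
  qed
  ultimately show ?case by blast
qed

section \<open>Polynomial functions as elements of a factorial ring\<close>

type_synonym cpoly3 = "complex poly poly poly"

text \<open>Nested univariate polynomials are used because they have gcds; the outermost variable is
  x_3.\<close>

definition ev3 :: "cpoly3 \<Rightarrow> complex^3 \<Rightarrow> complex" where
  "ev3 h x = poly (poly (poly h [:[:x $ 3:]:]) [:x $ 2:]) (x $ 1)"

lemma ev3_simps [simp]:
  "ev3 (p + q) x = ev3 p x + ev3 q x" "ev3 (p * q) x = ev3 p x * ev3 q x"
  "ev3 (p - q) x = ev3 p x - ev3 q x" "ev3 0 x = 0" "ev3 1 x = 1"
  by (simp_all add: ev3_def)

lemma pf_ev3: "pf (ev3 h)"
proof -
  have 1: "pf (\<lambda>x. poly p (x $ 1))" for p :: "complex poly"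
  proof (induction p)
    case (pCons a p)
    then show ?case using pf.add[OF pf.const pf.mult[OF pf.coord pCons.IH], of a 1] by simp
  qed (simp add: pf.const)
  have 2: "pf (\<lambda>x. poly (poly p [:x $ 2:]) (x $ 1))" for p :: "complex poly poly"
  proof (induction p)
    case (pCons a p)
    then show ?case using pf.add[OF 1[of a] pf.mult[OF pf.coord pCons.IH], of 2] by simp
  qed (simp add: pf.const)
  have "pf (\<lambda>x. poly (poly (poly h [:[:x $ 3:]:]) [:x $ 2:]) (x $ 1))"
  proof (induction h)
    case (pCons a p)
    then show ?case using pf.add[OF 2[of a] pf.mult[OF pf.coord pCons.IH], of 3] by simp
  qed (simp add: pf.const)
  then show ?thesis by (simp add: ev3_def[abs_def])
qed

lemma pf_exists_ev3: "pf u \<Longrightarrow> \<exists>h. ev3 h = u"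
proof (induction rule: pf.induct)
  case (const c)
  show ?case by (rule exI[of _ "[:[:[:c:]:]:]"]) (simp add: ev3_def fun_eq_iff)
next
  case (coord i)
  have "ev3 [:[:[:0, 1:]:]:] = (\<lambda>x. x $ 1)" "ev3 [:[:0, 1:]:] = (\<lambda>x. x $ 2)" "ev3 [:0, 1:] = (\<lambda>x. x $ 3)"
    by (simp_all add: ev3_def fun_eq_iff)
  then show ?case using exhaust_3[of i] by blast
next
  case (add u v)
  then obtain p q where "ev3 p = u" "ev3 q = v" by blast
  then have "ev3 (p + q) = (\<lambda>x. u x + v x)" by (simp add: fun_eq_iff)
  then show ?case by blast
next
  case (mult u v)
  then obtain p q where "ev3 p = u" "ev3 q = v" by blast
  then have "ev3 (p * q) = (\<lambda>x. u x * v x)" by (simp add: fun_eq_iff)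
  then show ?case by blast
qed

lemma poly_zero_of_infinite:
  fixes p :: "'a :: idom poly"
  assumes "inj \<phi>" "\<And>c :: complex. c \<noteq> 0 \<Longrightarrow> poly p (\<phi> c) = 0"
  shows "p = 0"
proof (rule ccontr)
  assume "p \<noteq> 0"
  then have "finite {z. poly p z = 0}" by (rule poly_roots_finite)
  moreover have "\<phi> ` (UNIV - {0}) \<subseteq> {z. poly p z = 0}" using assms(2) by auto
  ultimately have "finite (\<phi> ` (UNIV - {0}))" using finite_subset by blast
  then have "finite (UNIV - {0 :: complex})" using inj_on_subset[OF assms(1) subset_UNIV] finite_imageD by blast
  then show False using infinite_UNIV_char_0[where 'a = complex] by simp
qed

lemma ev3_eq_0:
  assumes "\<And>x. x \<noteq> 0 \<Longrightarrow> ev3 h x = 0"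
  shows "h = 0"
proof (rule poly_zero_of_infinite[of "\<lambda>c. [:[:c:]:]"])
  show "inj (\<lambda>c :: complex. [:[:c:]:])" by (simp add: inj_on_def)
  \<comment> \<open>Vanishing is assumed only off the origin, so the outermost variable takes
    nonzero values only.\<close>
  fix c :: complex assume "c \<noteq> 0"
  show "poly h [:[:c:]:] = 0"
  proof (rule poly_zero_of_infinite[of "\<lambda>b. [:b:]"])
    show "inj (\<lambda>b :: complex. [:b:])" by (simp add: inj_on_def)
    fix b :: complex
    show "poly (poly h [:[:c:]:]) [:b:] = 0"
    proof (rule poly_zero_of_infinite[of "\<lambda>a. a"])
      fix a :: complex
      have "vector [a, b, c] \<noteq> (0 :: complex^3)" using \<open>c \<noteq> 0\<close> by (auto simp: Finite_Cartesian_Product.vec_eq_iff forall_3)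
      from assms[OF this] show "poly (poly (poly h [:[:c:]:]) [:b:]) a = 0" by (simp add: ev3_def)
    qed simp
  qed
qed

section \<open>Coprime triples\<close>

definition gcd3 :: "(3 \<Rightarrow> cpoly3) \<Rightarrow> cpoly3" where
  "gcd3 A = gcd (A 1) (gcd (A 2) (A 3))"

lemma gcd3_mult: "gcd3 (\<lambda>i. h * A i) = normalize (h * gcd3 A)"
  unfolding gcd3_def by (simp add: gcd_mult_left)

lemma gcd3_greatest: "(\<And>i. p dvd A i) \<Longrightarrow> p dvd gcd3 A"
  by (simp add: gcd3_def)

lemma gcd3_dvd: "gcd3 A dvd A i"
proof -
  have "gcd3 A dvd A 1" "gcd3 A dvd A 2" "gcd3 A dvd A 3"
    unfolding gcd3_def by (auto intro: dvd_trans[OF gcd_dvd2])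
  then show ?thesis using exhaust_3[of i] by auto
qed

lemma coprime_triple:
  assumes "A i0 \<noteq> 0"
  obtains h B where "h \<noteq> 0" "\<forall>i. A i = h * B i" "gcd3 B = 1"
proof -
  define h where "h = gcd3 A"
  define B where "B i = A i div h" for i
  have A: "A i = h * B i" for i unfolding B_def h_def using gcd3_dvd[of A i] by simp
  have h: "h \<noteq> 0" using assms A[of i0] by auto
  have "(\<lambda>i. h * B i) = A" using A by (intro ext) (rule sym)
  then have eq: "normalize (h * gcd3 B) = h" using gcd3_mult[of h B] unfolding h_def by simp
  have "normalize h = h" unfolding h_def gcd3_def by simp
  then have "h * normalize (gcd3 B) = h * 1" using eq by (simp add: normalize_mult)
  then have "gcd3 B = 1" using h by (simp add: gcd3_def)
  then show ?thesis using A h by (intro that[of h B]) auto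
qed

text \<open>B_i divides every C_i B_j, hence C_i times the gcd of the B_j, which is C_i up to a
  unit.\<close>

lemma proportional_to_coprime:
  assumes "gcd3 B = 1" "\<And>i j. B i * C j = B j * C i"
  shows "\<exists>k. \<forall>i. C i = k * B i"
proof -
  obtain i where i: "B i \<noteq> 0"
  proof (rule ccontr)
    assume "\<not> thesis"
    then have "B i = 0" for i using that by blast
    then show False using assms(1) by (simp add: gcd3_def)
  qed
  have "B i dvd C i * B j" for j using assms(2)[of i j] by (metis dvd_triv_left mult.commute)
  then have "B i dvd gcd3 (\<lambda>j. C i * B j)" by (rule gcd3_greatest)
  then have "B i dvd C i" unfolding gcd3_mult assms(1) by simp
  then obtain k where k: "C i = B i * k" by (rule dvdE)
  have "C j = k * B j" for j
  proof -
    have "B i * C j = B i * (k * B j)" using assms(2)[of i j] k by (simp add: mult_ac)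
    then show ?thesis using i by simp
  qed
  then show ?thesis by blast
qed

text \<open>One of the two constant coefficients must vanish, so one factor is divisible by the
  variable, which is cancelled.\<close>

lemma factor_of_monom:
  fixes p q :: "'a :: idom poly"
  assumes "p * q = monom a d" "a \<noteq> 0"
  shows "\<exists>b e. p = monom b e \<and> b \<noteq> 0 \<and> e \<le> d"
  using assms(1)
proof (induction d arbitrary: p q)
  case 0
  then have "p \<noteq> 0" "q \<noteq> 0" using assms(2) by auto
  then have "degree p + degree q = 0" using 0 by (metis degree_mult_eq degree_monom_eq assms(2))
  then obtain b where "p = [:b:]" by (auto elim: degree_eq_zeroE)
  then show ?case using \<open>p \<noteq> 0\<close> by (intro exI[of _ b] exI[of _ 0]) (simp add: monom_0)
next
  case (Suc d)
  have "coeff p 0 * coeff q 0 = 0" using arg_cong[OF Suc.prems, of "\<lambda>p. coeff p 0"] by (simp add: coeff_mult)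
  then consider "coeff p 0 = 0" | "coeff q 0 = 0" by auto
  then show ?case
  proof cases
    case 1
    then obtain p' where p': "p = pCons 0 p'" by (metis coeff_pCons_0 pCons_cases)
    then have "pCons 0 (p' * q) = pCons 0 (monom a d)" using Suc.prems by (simp add: monom_Suc)
    then have "p' * q = monom a d" by simp
    from Suc.IH[OF this] obtain b e where "p' = monom b e" "b \<noteq> 0" "e \<le> d" by blast
    then show ?thesis using p' by (intro exI[of _ b] exI[of _ "Suc e"]) (simp add: monom_Suc)
  next
    case 2
    then obtain q' where q': "q = pCons 0 q'" by (metis coeff_pCons_0 pCons_cases)
    then have "pCons 0 (p * q') = pCons 0 (monom a d)" using Suc.prems by (simp add: monom_Suc)
    then have "p * q' = monom a d" by simp
    from Suc.IH[OF this] obtain b e where "p = monom b e" "b \<noteq> 0" "e \<le> d" by blast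
    then show ?thesis by (intro exI[of _ b] exI[of _ e]) simp
  qed
qed

lemma scaling_polynomial:
  "\<exists>S :: cpoly3 poly. \<forall>c x. ev3 (poly S [:[:[:c:]:]:]) x = ev3 h (c *s x)"
  using pf_ev3[of h]
proof induction
  case (const a)
  show ?case by (rule exI[of _ "[:[:[:[:a:]:]:]:]"]) (simp add: ev3_def)
next
  case (coord i)
  obtain X where "ev3 X = (\<lambda>x. x $ i)" using pf_exists_ev3[OF pf.coord] by blast
  moreover have "ev3 (Polynomial.smult [:[:c:]:] X) x = c * ev3 X x" for c x by (simp add: ev3_def)
  ultimately have "ev3 (poly [:0, X:] [:[:[:c:]:]:]) x = (c *s x) $ i" for c x by simp
  then show ?case by blast
next
  case (add u v)
  then obtain S T where "\<forall>c x. ev3 (poly S [:[:[:c:]:]:]) x = u (c *s x)"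
    "\<forall>c x. ev3 (poly T [:[:[:c:]:]:]) x = v (c *s x)" by blast
  then have "\<forall>c x. ev3 (poly (S + T) [:[:[:c:]:]:]) x = u (c *s x) + v (c *s x)" by simp
  then show ?case by blast
next
  case (mult u v)
  then obtain S T where "\<forall>c x. ev3 (poly S [:[:[:c:]:]:]) x = u (c *s x)"
    "\<forall>c x. ev3 (poly T [:[:[:c:]:]:]) x = v (c *s x)" by blast
  then have "\<forall>c x. ev3 (poly (S * T) [:[:[:c:]:]:]) x = u (c *s x) * v (c *s x)" by simp
  then show ?case by blast
qed

text \<open>Factors of forms are forms: as polynomials in the scaling parameter c, \<open>h\<close>
  and B_i multiply to the monomial A_i c^d. So \<open>h\<close> contributes a monomial of some
  degree e, the same for all i, and B_i one of degree d - e.\<close>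

lemma coprime_part_homogeneous:
  assumes A: "\<And>i. A i = h * B i" and hom: "\<And>i. homog d (ev3 (A i))" and nz: "A i0 \<noteq> 0"
  shows "\<exists>n. \<forall>i. homog n (ev3 (B i))"
proof -
  have "\<forall>h. \<exists>S :: cpoly3 poly. \<forall>c x. ev3 (poly S [:[:[:c:]:]:]) x = ev3 h (c *s x)"
    using scaling_polynomial by blast
  from choice[OF this] obtain S :: "cpoly3 \<Rightarrow> cpoly3 poly" where
    S: "\<And>h c x. ev3 (poly (S h) [:[:[:c:]:]:]) x = ev3 h (c *s x)" by blast
  have prod: "S h * S (B i) = monom (A i) d" for i
  proof -
    have "S h * S (B i) - monom (A i) d = 0"
    proof (rule poly_zero_of_infinite[of "\<lambda>c. [:[:[:c:]:]:]"])
      show "inj (\<lambda>c :: complex. [:[:[:c:]:]:])" by (simp add: inj_on_def)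
      fix c :: complex
      have pow: "ev3 ([:[:[:c:]:]:] ^ d) x = c ^ d" for x
        by (induction d) (simp_all add: ev3_def)
      show "poly (S h * S (B i) - monom (A i) d) [:[:[:c:]:]:] = 0"
      proof (rule ev3_eq_0)
        fix x :: "complex^3"
        have "ev3 h (c *s x) * ev3 (B i) (c *s x) = c ^ d * ev3 (A i) x"
          using hom[of i] unfolding homog_def by (metis A ev3_simps(2))
        then show "ev3 (poly (S h * S (B i) - monom (A i) d) [:[:[:c:]:]:]) x = 0"
          by (simp add: poly_monom S pow)
      qed
    qed
    then show ?thesis by simp
  qed
  obtain b e where b: "S h = monom b e" "b \<noteq> 0" "e \<le> d"
    using factor_of_monom[OF prod nz] by blast
  have SB: "S (B i) = monom (coeff (S (B i)) (d - e)) (d - e)" for i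
  proof (rule poly_eqI)
    fix n
    have "b * coeff (S (B i)) n = coeff (monom b e * S (B i)) (n + e)"
      by (simp add: coeff_monom_mult)
    also have "\<dots> = coeff (monom (A i) d) (n + e)" by (simp only: prod flip: b(1))
    finally show "coeff (S (B i)) n = coeff (monom (coeff (S (B i)) (d - e)) (d - e)) n"
      using b(2,3) by (cases "n = d - e") (auto split: if_splits)
  qed
  have "homog (d - e) (ev3 (B i))" for i
  proof -
    define k where "k = coeff (S (B i)) (d - e)"
    have val: "ev3 (B i) (c *s x) = c ^ (d - e) * ev3 k x" for c x
    proof -
      have pow: "ev3 ([:[:[:c:]:]:] ^ n) x = c ^ n" for n
        by (induction n) (simp_all add: ev3_def)
      have "ev3 (B i) (c *s x) = ev3 (poly (monom k (d - e)) [:[:[:c:]:]:]) x"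
        using SB[of i] S[of "B i" c x] unfolding k_def by simp
      then show ?thesis by (simp add: poly_monom pow)
    qed
    from val[of 1] have "ev3 (B i) x = ev3 k x" for x by simp
    with val show ?thesis by (simp add: homog_def)
  qed
  then show ?thesis by blast
qed

section \<open>Endomorphisms are given by forms globally\<close>

lemma zariski_open_dense:
  assumes "zariski_open U" "P \<in> U"
  shows "\<exists>\<delta>. \<delta> \<noteq> 0 \<and> (\<forall>x. x \<noteq> 0 \<longrightarrow> ev3 \<delta> x \<noteq> 0 \<longrightarrow> proj_point x \<in> U)"
proof -
  obtain A where A: "U = - {P. \<forall>G\<in>A. vanishes_at G P}"
    using assms(1) unfolding zariski_open_def by blast
  then obtain G where G: "G \<in> A" "\<not> vanishes_at G P" using assms(2) by blast
  then obtain x where x: "x \<noteq> 0" "proj_point x = P" "eval3 G x \<noteq> 0" unfolding vanishes_at_def by blast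
  obtain \<delta> where \<delta>: "ev3 \<delta> = eval3 G" using pf_exists_ev3[OF pf_eval3] by blast
  have "\<delta> \<noteq> 0"
  proof
    assume "\<delta> = 0"
    then show False using x(3) by (simp flip: \<delta>)
  qed
  moreover have "proj_point y \<in> U" if "y \<noteq> 0" "ev3 \<delta> y \<noteq> 0" for y
  proof -
    have "\<not> vanishes_at G (proj_point y)" using that unfolding vanishes_at_def \<delta> by blast
    then show ?thesis using G(1) unfolding A by blast
  qed
  ultimately show ?thesis by blast
qed

definition represents :: "(3 \<Rightarrow> cpoly3) \<Rightarrow> (proj_plane \<Rightarrow> proj_plane) \<Rightarrow> complex^3 \<Rightarrow> bool" where
  "represents B f x \<longleftrightarrow> (\<chi> i. ev3 (B i) x) \<noteq> 0 \<and> f (proj_point x) = proj_point (\<chi> i. ev3 (B i) x)"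

lemma represents_proportional:
  assumes "represents B f x" "represents C f x"
  shows "\<exists>c. c \<noteq> 0 \<and> (\<forall>i. ev3 (C i) x = c * ev3 (B i) x)"
proof -
  have "proj_point (\<chi> i. ev3 (B i) x) = proj_point (\<chi> i. ev3 (C i) x)"
    using assms by (simp add: represents_def)
  then obtain c where "c \<noteq> 0" "(\<chi> i. ev3 (C i) x) = c *s (\<chi> i. ev3 (B i) x)"
    using assms proj_point_eq_iff unfolding represents_def by blast
  then show ?thesis by (auto simp: Finite_Cartesian_Product.vec_eq_iff)
qed

text \<open>The cross product vanishes wherever both triples represent \<open>f\<close>, so its
  product with \<delta> \<epsilon> vanishes everywhere; in a domain the two factors cancel.\<close>

lemma represents_cross:
  assumes "\<delta> \<noteq> 0" "\<epsilon> \<noteq> 0"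
    and "\<And>x. x \<noteq> 0 \<Longrightarrow> ev3 \<delta> x \<noteq> 0 \<Longrightarrow> represents B f x"
    and "\<And>x. x \<noteq> 0 \<Longrightarrow> ev3 \<epsilon> x \<noteq> 0 \<Longrightarrow> represents C f x"
  shows "B i * C j = B j * C i"
proof -
  have "\<delta> * \<epsilon> * (B i * C j - B j * C i) = 0"
  proof (rule ev3_eq_0)
    fix x :: "complex^3" assume x: "x \<noteq> 0"
    show "ev3 (\<delta> * \<epsilon> * (B i * C j - B j * C i)) x = 0"
    proof (cases "ev3 \<delta> x = 0 \<or> ev3 \<epsilon> x = 0")
      case False
      then obtain c where c: "\<And>i. ev3 (C i) x = c * ev3 (B i) x"
        using represents_proportional[OF assms(3,4)[OF x]] by blast
      show ?thesis by (simp add: c)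
    qed auto
  qed
  then show ?thesis using assms(1,2) by simp
qed

lemma given_by_forms_polys:
  assumes "given_by_forms d G U f"
  obtains A where "\<forall>i. homog d (ev3 (A i))" "\<forall>x. x \<noteq> 0 \<longrightarrow> proj_point x \<in> U \<longrightarrow> represents A f x"
proof -
  have "\<forall>i. \<exists>a. ev3 a = eval3 (G i)" using pf_exists_ev3[OF pf_eval3] by blast
  from choice[OF this] obtain A where A: "\<And>i. ev3 (A i) = eval3 (G i)" by blast
  have "\<forall>i. homog d (ev3 (A i))"
    using assms homog_eval3 unfolding given_by_forms_def A by blast
  moreover have "\<forall>x. x \<noteq> 0 \<longrightarrow> proj_point x \<in> U \<longrightarrow> represents A f x"
    using assms unfolding given_by_forms_def represents_def A by blast
  ultimately show ?thesis by (rule that)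
qed

text \<open>The reduced triple B of one local representation works everywhere: near any other point
  the local triple is a polynomial multiple k B, and where that triple is nonzero so are k and
  B.\<close>

lemma endomorphism_global:
  assumes "endomorphism f"
  shows "\<exists>n B. gcd3 B = 1 \<and> (\<forall>i. homog n (ev3 (B i))) \<and> (\<forall>x. x \<noteq> 0 \<longrightarrow> represents B f x)"
proof -
  have local: "\<exists>d A \<delta>. \<delta> \<noteq> 0 \<and> (\<forall>i. homog d (ev3 (A i))) \<and> represents A f x \<and>
      (\<forall>y. y \<noteq> 0 \<longrightarrow> ev3 \<delta> y \<noteq> 0 \<longrightarrow> represents A f y)" if x: "x \<noteq> 0" for x
  proof -
    obtain U d G where U: "zariski_open U" "proj_point x \<in> U" "given_by_forms d G U f"
      using assms unfolding endomorphism_def by blast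
    obtain A where A: "\<forall>i. homog d (ev3 (A i))" "\<forall>x. x \<noteq> 0 \<longrightarrow> proj_point x \<in> U \<longrightarrow> represents A f x"
      by (rule given_by_forms_polys[OF U(3)])
    obtain \<delta> where "\<delta> \<noteq> 0" "\<forall>x. x \<noteq> 0 \<longrightarrow> ev3 \<delta> x \<noteq> 0 \<longrightarrow> proj_point x \<in> U"
      using zariski_open_dense[OF U(1,2)] by blast
    then show ?thesis using A U(2) x by blast
  qed
  define x0 :: "complex^3" where "x0 = axis 1 1"
  have "x0 \<noteq> 0" by (simp add: x0_def axis_eq_0_iff)
  from local[OF this] obtain d A \<delta> where \<delta>: "\<delta> \<noteq> 0" and homA: "\<forall>i. homog d (ev3 (A i))"
    and A0: "represents A f x0" and repA: "\<forall>y. y \<noteq> 0 \<longrightarrow> ev3 \<delta> y \<noteq> 0 \<longrightarrow> represents A f y"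
    by (elim exE conjE)
  have "\<exists>i. A i \<noteq> 0"
  proof (rule ccontr)
    assume "\<nexists>i. A i \<noteq> 0"
    then have "(\<chi> i. ev3 (A i) x0) = 0" by (simp add: Finite_Cartesian_Product.vec_eq_iff)
    then show False using A0 by (simp add: represents_def)
  qed
  then obtain i0 where i0: "A i0 \<noteq> 0" by blast
  obtain h B where h: "h \<noteq> 0" and AB: "\<forall>i. A i = h * B i" and gcd: "gcd3 B = 1"
    by (rule coprime_triple[of A i0, OF i0])
  obtain n where n: "\<forall>i. homog n (ev3 (B i))"
    using coprime_part_homogeneous[of A h B d i0] AB homA i0 by blast
  have "represents B f x" if x: "x \<noteq> 0" for x
  proof -
    from local[OF x] obtain e C \<epsilon> where \<epsilon>: "\<epsilon> \<noteq> 0" and C0: "represents C f x"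
      and repC: "\<forall>y. y \<noteq> 0 \<longrightarrow> ev3 \<epsilon> y \<noteq> 0 \<longrightarrow> represents C f y" by (elim exE conjE)
    have "A i * C j = A j * C i" for i j
      by (rule represents_cross[OF \<delta> \<epsilon>, where f = f]) (use repA repC in simp_all)
    then have "h * (B i * C j) = h * (B j * C i)" for i j using AB by (simp add: mult.assoc)
    then have "B i * C j = B j * C i" for i j using h by simp
    then obtain k where k: "\<forall>i. C i = k * B i" using proportional_to_coprime[OF gcd] by blast
    have eq: "(\<chi> i. ev3 (C i) x) = ev3 k x *s (\<chi> i. ev3 (B i) x)"
      using k by (simp add: Finite_Cartesian_Product.vec_eq_iff)
    then have nz: "ev3 k x \<noteq> 0" "(\<chi> i. ev3 (B i) x) \<noteq> 0" using C0 by (auto simp: represents_def)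
    have "proj_point (\<chi> i. ev3 (B i) x) = proj_point (\<chi> i. ev3 (C i) x)"
      using proj_point_eq_iff[of "\<chi> i. ev3 (B i) x" "\<chi> i. ev3 (C i) x"] nz eq C0
      unfolding represents_def by blast
    then show ?thesis using nz(2) C0 by (simp add: represents_def)
  qed
  then show ?thesis using gcd n by blast
qed

text \<open>Two global triples differ by a polynomial k without zeros off the origin; such a k is
  constant on lines missing the origin, and its scaling behaviour then forces equal degrees.\<close>

lemma global_degree_unique:
  assumes B: "gcd3 B = 1" "\<And>i. homog n (ev3 (B i))" "\<And>x. x \<noteq> 0 \<Longrightarrow> represents B f x"
    and C: "\<And>i. homog d (ev3 (C i))" "\<And>x. x \<noteq> 0 \<Longrightarrow> represents C f x"
  shows "d = n"
proof -
  have "B i * C j = B j * C i" for i j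
    by (rule represents_cross[of 1 1 B f C]) (use B(3) C(2) in simp_all)
  then obtain k where k: "\<And>i. C i = k * B i" using proportional_to_coprime[OF B(1)] by blast
  have knz: "ev3 k x \<noteq> 0" if "x \<noteq> 0" for x
  proof
    assume "ev3 k x = 0"
    then have "(\<chi> i. ev3 (C i) x) = 0" by (simp add: k Finite_Cartesian_Product.vec_eq_iff)
    then show False using C(2)[OF that] by (simp add: represents_def)
  qed
  have scale: "c ^ n * ev3 k (c *s x) = c ^ d * ev3 k x" if x: "x \<noteq> 0" for c x
  proof -
    obtain i where i: "ev3 (B i) x \<noteq> 0"
      using B(3)[OF x] by (auto simp: represents_def Finite_Cartesian_Product.vec_eq_iff)
    have "ev3 k (c *s x) * (c ^ n * ev3 (B i) x) = c ^ d * (ev3 k x * ev3 (B i) x)"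
      using B(2)[of i] C(1)[of i] by (simp add: homog_def k)
    then have "(c ^ n * ev3 k (c *s x)) * ev3 (B i) x = (c ^ d * ev3 k x) * ev3 (B i) x"
      by (simp add: mult_ac)
    then show ?thesis using i by simp
  qed
  \<comment> \<open>Restricted to such a line, k is a univariate polynomial without zeros.\<close>
  have const: "ev3 k (s *s x + y) = ev3 k y" if "\<And>s. s *s x + y \<noteq> 0" for s x y
  proof -
    have "\<exists>p. \<forall>t. (t *s x + y) $ i = poly p t" for i
      by (rule exI[of _ "[:y $ i, x $ i:]"]) simp
    from pf_along_polynomial_curve[OF pf_ev3 this, of k]
    obtain p where p: "\<And>t. ev3 k (t *s x + y) = poly p t" by blast
    have "poly p z \<noteq> 0" for z using knz[OF that] by (simp flip: p)
    then have "constant (poly p)" using fundamental_theorem_of_algebra by blast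
    then have "poly p s = poly p 0" unfolding constant_def by blast
    then show ?thesis by (simp flip: p)
  qed
  define x y :: "complex^3" where "x = axis 1 1" and "y = axis 2 1"
  have xy: "s *s x + y \<noteq> 0" "s *s y + x \<noteq> 0" for s
    by (auto simp: x_def y_def axis_def Finite_Cartesian_Product.vec_eq_iff forall_3)
  \<comment> \<open>The point s x + y lies on a line parallel to x through y and, up to the factor
    s, on a line parallel to y through x. Comparing s = 1 with s = 2 yields the degrees.\<close>
  have eq: "s ^ n * ev3 k y = s ^ d * ev3 k x" if "s \<noteq> 0" for s
  proof -
    have e: "s *s x + y = s *s ((1 / s) *s y + x)" using that by (simp add: vector_add_ldistrib add.commute)
    have "s ^ n * ev3 k (s *s x + y) = s ^ d * ev3 k ((1 / s) *s y + x)"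
      unfolding e by (rule scale[OF xy(2)])
    then show ?thesis using const[OF xy(1)] const[OF xy(2)] by simp
  qed
  have "ev3 k y = ev3 k x" using eq[of 1] by simp
  moreover have "ev3 k x \<noteq> 0" by (rule knz) (simp add: x_def axis_eq_0_iff)
  ultimately have "(2 :: complex) ^ n = 2 ^ d" using eq[of 2] by simp
  then have "of_nat (2 ^ n) = (of_nat (2 ^ d) :: complex)" by simp
  then have "(2 :: nat) ^ n = 2 ^ d" by (simp only: of_nat_eq_iff)
  then show ?thesis by simp
qed

lemma endomorphism_forms:
  assumes "endomorphism f"
  obtains F where "\<forall>i. pf (\<lambda>x. F x $ i)" "\<forall>i. homog (endo_degree f) (\<lambda>x. F x $ i)"
    "\<forall>x. x \<noteq> 0 \<longrightarrow> F x \<noteq> 0 \<and> f (proj_point x) = proj_point (F x)"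
proof -
  obtain n B where B: "gcd3 B = 1" "\<forall>i. homog n (ev3 (B i))" "\<forall>x. x \<noteq> 0 \<longrightarrow> represents B f x"
    using endomorphism_global[OF assms] by (elim exE conjE)
  have "\<forall>i. \<exists>G. homogeneous3 n G \<and> eval3 G = ev3 (B i)" using homog_pf_eval3[OF pf_ev3] B(2) by blast
  from choice[OF this] obtain G where G: "\<And>i. homogeneous3 n (G i)" "\<And>i. eval3 (G i) = ev3 (B i)" by blast
  have "endo_degree f = n" unfolding endo_degree_def
  proof (rule the_equality)
    have "given_by_forms n G UNIV f"
      using G B(3) unfolding given_by_forms_def represents_def by simp
    then show "\<exists>F. given_by_forms n F UNIV f" by blast
  next
    fix d assume "\<exists>F. given_by_forms d F UNIV f"
    then obtain G' where "given_by_forms d G' UNIV f" by blast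
    then obtain C where C: "\<forall>i. homog d (ev3 (C i))" "\<forall>x. x \<noteq> 0 \<longrightarrow> proj_point x \<in> UNIV \<longrightarrow> represents C f x"
      by (rule given_by_forms_polys)
    show "d = n" by (rule global_degree_unique[of B n f d C]) (use B C in simp_all)
  qed
  then show ?thesis using B(2,3)
    by (intro that[of "\<lambda>x. \<chi> i. ev3 (B i) x"]) (simp_all add: represents_def pf_ev3)
qed

section \<open>Completely ramified points\<close>

lemma linear_form_additive:
  assumes "pf u" "homog 1 u"
  shows "u (x + y) = u x + u y"
  using homog_pf_span[OF assms]
proof induction
  case zero
  show ?case by simp
next
  case (step u m c)
  from step obtain i j k where m: "m = mon i j k" "i + j + k = 1" by blast
  have "(i = 1 \<and> j = 0 \<and> k = 0) \<or> (i = 0 \<and> j = 1 \<and> k = 0) \<or> (i = 0 \<and> j = 0 \<and> k = 1)"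
    using m(2) by presburger
  then have "m (x + y) = m x + m y" unfolding m(1) by (elim disjE) (simp_all add: mon_def)
  then show ?case using step.IH by (simp add: algebra_simps)
qed

text \<open>A monomial of degree one is a single coordinate x_i, and evaluation at the i-th basis
  vector returns its coefficient.\<close>

lemma linear_eval3_nonzero:
  assumes "homogeneous3 1 G" "G \<noteq> 0"
  shows "\<exists>x. eval3 G x \<noteq> 0"
proof -
  obtain m where m: "m \<in> Poly_Mapping.keys G" using assms(2) by (metis keys_eq_empty equals0I)
  have sum: "(\<Sum>i\<in>UNIV. Poly_Mapping.lookup m' i) = 1" if "m' \<in> Poly_Mapping.keys G" for m'
    using assms(1) that by (simp add: homogeneous3_def)
  have "\<exists>i. Poly_Mapping.lookup m i \<noteq> 0"
  proof (rule ccontr)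
    assume "\<nexists>i. Poly_Mapping.lookup m i \<noteq> 0"
    then show False using sum[OF m] by simp
  qed
  then obtain i where i: "Poly_Mapping.lookup m i \<noteq> 0" by blast
  have split: "(\<Sum>j\<in>UNIV. Poly_Mapping.lookup m' j) = Poly_Mapping.lookup m' i + (\<Sum>j\<in>UNIV - {i}. Poly_Mapping.lookup m' j)"
    for m' :: "3 \<Rightarrow>\<^sub>0 nat" by (simp add: sum.remove)
  have unique: "m' = m" if m': "m' \<in> Poly_Mapping.keys G" "\<And>j. j \<noteq> i \<Longrightarrow> Poly_Mapping.lookup m' j = 0" for m'
  proof (rule poly_mapping_eqI)
    fix j
    have 1: "Poly_Mapping.lookup m' i = 1" using sum[OF m'(1)] split[of m'] m'(2) by simp
    have "Poly_Mapping.lookup m i + (\<Sum>j\<in>UNIV - {i}. Poly_Mapping.lookup m j) = 1" using sum[OF m] split[of m] by simp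
    then have "Poly_Mapping.lookup m i = 1" "(\<Sum>j\<in>UNIV - {i}. Poly_Mapping.lookup m j) = 0" using i by linarith+
    then have "Poly_Mapping.lookup m i = 1" "j \<noteq> i \<Longrightarrow> Poly_Mapping.lookup m j = 0" by auto
    then show "Poly_Mapping.lookup m' j = Poly_Mapping.lookup m j" using 1 m'(2)[of j] by (cases "j = i") auto
  qed
  have val: "(\<Prod>j\<in>UNIV. ((axis i 1 :: complex^3) $ j) ^ Poly_Mapping.lookup m' j) = (if m' = m then 1 else 0)"
    if m': "m' \<in> Poly_Mapping.keys G" for m'
  proof (cases "\<forall>j. j \<noteq> i \<longrightarrow> Poly_Mapping.lookup m' j = 0")
    case True
    then have "m' = m" using unique[OF m'] by blast
    moreover have "(\<Prod>j\<in>UNIV. ((axis i 1 :: complex^3) $ j) ^ Poly_Mapping.lookup m' j) = 1"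
      by (rule prod.neutral) (use True in \<open>auto simp: axis_def\<close>)
    ultimately show ?thesis by simp
  next
    case False
    then obtain j where j: "j \<noteq> i" "Poly_Mapping.lookup m' j \<noteq> 0" by blast
    have "Poly_Mapping.lookup m j = 0"
    proof -
      have "(\<Sum>j\<in>UNIV - {i}. Poly_Mapping.lookup m j) = 0" using sum[OF m] split[of m] i by linarith
      then show ?thesis using j(1) by simp
    qed
    then have "m' \<noteq> m" using j(2) by auto
    moreover have "(\<Prod>j\<in>UNIV. ((axis i 1 :: complex^3) $ j) ^ Poly_Mapping.lookup m' j) = 0"
      by (rule prod_zero) (use j in \<open>auto simp: axis_def intro!: bexI[of _ j]\<close>)
    ultimately show ?thesis by simp
  qed
  have "eval3 G (axis i 1) = (\<Sum>m'\<in>Poly_Mapping.keys G. if m' = m then Poly_Mapping.lookup G m else 0)"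
    unfolding eval3_def by (rule sum.cong) (simp_all add: val)
  also have "\<dots> = Poly_Mapping.lookup G m" using m by simp
  finally have "eval3 G (axis i 1) \<noteq> 0" using m by (simp add: in_keys_iff)
  then show ?thesis ..
qed

lemma completely_ramified_lift:
  assumes F: "\<And>x. x \<noteq> 0 \<Longrightarrow> F x \<noteq> 0 \<and> f (proj_point x) = proj_point (F x)" and F0: "F 0 = 0"
    and P: "completely_ramified f P"
  shows "\<exists>q. ram F q \<and> P = proj_point (F q)"
proof -
  obtain Q where Q: "f -` {P} = {Q}" using P unfolding completely_ramified_def by blast
  obtain q where q: "q \<noteq> 0" "Q = proj_point q" by (rule proj_point_exhaust)
  have fq: "f (proj_point q) = P" using Q q(2) by blast
  then have Pq: "P = proj_point (F q)" using F[OF q(1)] by simp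
  have "\<exists>w. x = w *s q" if c: "c \<noteq> 0" "F x = c *s F q" for x c
  proof -
    have "F x \<noteq> 0" using c F[OF q(1)] by (simp add: vector_mul_eq_0)
    then have x: "x \<noteq> 0" using F0 by auto
    have "proj_point (F q) = proj_point (F x)"
      using proj_point_eq_iff[of "F q" "F x"] F[OF q(1)] F[OF x] c by blast
    then have "f (proj_point x) = P" using F[OF x] Pq by simp
    then have "proj_point x \<in> f -` {P}" by simp
    then have "proj_point q = proj_point x" using Q q(2) by simp
    then show ?thesis using proj_point_eq_iff[OF q(1) x] by blast
  qed
  then have "ram F q" unfolding ram_def using q(1) by blast
  then show ?thesis using Pq by blast
qed

theorem theorem1:
  fixes f :: "proj_plane \<Rightarrow> proj_plane"
  assumes "endomorphism f" and "endo_degree f > 1"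
  defines "R \<equiv> {P. completely_ramified f P}"
  shows "finite R \<and> card R \<le> 9
    \<and> (\<forall>T\<subseteq>R. card T = 3 \<longrightarrow> \<not> (\<exists>L\<in>plane_curves 1. T \<subseteq> curve_points L))
    \<and> (\<forall>T\<subseteq>R. card T = 6 \<longrightarrow> \<not> (\<exists>C\<in>plane_curves 2. T \<subseteq> curve_points C))
    \<and> (card R = 9 \<longrightarrow>
        (\<exists>C. C \<in> plane_curves 3 \<and> R \<subseteq> curve_points C
          \<and> (\<forall>C'\<in>plane_curves 3. R \<subseteq> curve_points C' \<longrightarrow> C' = C)
          \<and> (\<exists>P\<in>R. singular_at C P)))"
proof -
  obtain F where pfF: "\<forall>i. pf (\<lambda>x. F x $ i)" and homF: "\<forall>i. homog (endo_degree f) (\<lambda>x. F x $ i)"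
    and Ff: "\<forall>x. x \<noteq> 0 \<longrightarrow> F x \<noteq> 0 \<and> f (proj_point x) = proj_point (F x)"
    by (rule endomorphism_forms[OF assms(1)])
  interpret forms F "endo_degree f"
    by unfold_locales (use pfF homF Ff assms(2) in auto)
  have "\<exists>q. ram F q \<and> P = proj_point (F q)" if "P \<in> R" for P
    using completely_ramified_lift[of F f P] Ff F_0 that unfolding R_def by blast
  then have "\<forall>P. \<exists>q. P \<in> R \<longrightarrow> ram F q \<and> P = proj_point (F q)" by blast
  from choice[OF this] obtain q where q: "\<And>P. P \<in> R \<Longrightarrow> ram F (q P)" "\<And>P. P \<in> R \<Longrightarrow> P = proj_point (F (q P))"
    by blast
  have indep: "indep (q P) (q P')" if "P \<in> R" "P' \<in> R" "P \<noteq> P'" for P P'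
  proof -
    have nz: "q P \<noteq> 0" "q P' \<noteq> 0" using q(1) that by (auto simp: ram_def)
    have "q P \<noteq> w *s q P'" for w
    proof
      assume w: "q P = w *s q P'"
      then have "w \<noteq> 0" using nz by auto
      then have "proj_point (q P') = proj_point (q P)" using proj_point_eq_iff[OF nz(2,1)] w by blast
      then have "f (proj_point (q P')) = f (proj_point (q P))" by simp
      then have "P' = P" using Ff nz q(2)[OF that(1)] q(2)[OF that(2)] by simp
      then show False using that(3) by simp
    qed
    then show ?thesis using nz by (simp add: indep_def)
  qed
  \<comment> \<open>Four is the only count that has to be excluded: a larger or infinite
    \<open>R\<close> would contain a subset of this size.\<close>
  have no_four: False if "T \<subseteq> R" "card T = 4" for T
  proof -
    obtain P1 P2 P3 P4 where T: "T = {P1, P2, P3, P4}" "distinct [P1, P2, P3, P4]"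
      using \<open>card T = 4\<close> by (auto simp: eval_nat_numeral card_Suc_eq)
    have mem: "P1 \<in> R" "P2 \<in> R" "P3 \<in> R" "P4 \<in> R" using T(1) that(1) by auto
    show False
      by (rule no_four_ram[of "q P1" "q P2" "q P3" "q P4"])
        (use assms(2) mem T(2) in \<open>auto intro!: q(1) indep\<close>)
  qed
  have fin: "finite R"
  proof (rule ccontr)
    assume "infinite R"
    then obtain T where "T \<subseteq> R" "card T = 4" using infinite_arbitrarily_large by blast
    then show False by (rule no_four)
  qed
  have card: "card R \<le> 3"
  proof (rule ccontr)
    assume "\<not> card R \<le> 3"
    then have "4 \<le> card R" by simp
    then obtain T where "T \<subseteq> R" "card T = 4" by (metis obtain_subset_with_card_n)
    then show False by (rule no_four)
  qed
  have no_line: False if T: "T \<subseteq> R" "card T = 3" and L: "L \<in> plane_curves 1" "T \<subseteq> curve_points L" for T L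
  proof -
    obtain G where G: "G \<noteq> 0" "homogeneous3 1 G" "L = {Poly_Mapping.single 0 c * G |c. c \<noteq> 0}"
      using L(1) unfolding plane_curves_def by blast
    have "Poly_Mapping.single 0 1 * G \<in> L" unfolding G(3) using one_neq_zero by blast
    then have "G \<in> L" by simp
    then have vanish: "vanishes_at G P" if "P \<in> T" for P using L(2) that unfolding curve_points_def by blast
    have zero: "eval3 G (F (q P)) = 0" if "P \<in> T" for P
    proof -
      have "P \<in> R" using that T(1) by blast
      then have "vanishes_at G (proj_point (F (q P)))" "F (q P) \<noteq> 0"
        using vanish[OF that] q ram_nonzero by auto
      then show ?thesis using vanishes_at_proj_point[OF G(2)] by blast
    qed
    obtain P1 P2 P3 where P: "T = {P1, P2, P3}" "distinct [P1, P2, P3]"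
      using T(2) by (auto simp: eval_nat_numeral card_Suc_eq)
    have mem: "P1 \<in> R" "P2 \<in> R" "P3 \<in> R" using P(1) T(1) by auto
    have add: "eval3 G (x + y) = eval3 G x + eval3 G y" for x y
      by (rule linear_form_additive[OF pf_eval3 homog_eval3[OF G(2)]])
    \<comment> \<open>The three representatives on the line span the space, so a linear form
      vanishing at them vanishes identically, contrary to G \<noteq> 0.\<close>
    have "eval3 G x = 0" for x
    proof -
      have "\<exists>a b c. x = a *s F (q P1) + b *s F (q P2) + c *s F (q P3)"
      proof (rule spanning_triple, rule ram_triple_independent)
        show "endo_degree f \<ge> 2" using assms(2) by simp
      qed (use mem P(2) q(1) indep in auto)
      then obtain a b c where "x = a *s F (q P1) + b *s F (q P2) + c *s F (q P3)" by blast
      then show ?thesis using zero P(1) by (simp add: add eval3_scale[OF G(2)])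
    qed
    then show False using linear_eval3_nonzero[OF G(2,1)] by blast
  qed
  have small: "card T \<le> 3" if "T \<subseteq> R" for T using card_mono[OF fin that] card by simp
  have no_six: "card T \<noteq> 6" if "T \<subseteq> R" for T using small[OF that] by auto
  have "card R \<noteq> 9" using card by simp
  moreover have "card R \<le> 9" using card by simp
  ultimately show ?thesis using fin no_line no_six by blast
qed

end
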